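(* Let $R$ be a commutative domain of finite character with field of fractions $Q$. Let $\Lambda$ be an $R$-algebra that is finitely generated as an $R$-module and such that $\Lambda\otimes_R Q$ is a simple artinian ring. Let $M=\bigoplus_{i\in\mathbb N_0}A_i$ and $N=\bigoplus_{i\in\mathbb N_0}B_i$ be direct sums of non-zero finitely generated right $\Lambda$-modules which are torsion-free as $R$-modules. If $M$ and $N$ are in the same genus, then there are decompositions $M=\bigoplus_{i\in\mathbb N_0}M_i$ and $N=\bigoplus_{i\in\mathbb N_0}N_i$ with each $M_i$, $N_i$ finitely generated and $M_i\cong N_i$ for every $i$. In particular $M\cong N$.
   Context: A commutative domain has finite character if every non-zero element lies in only finitely many maximal ideals. A module $M$ is torsion-free over $R$ if $M\to M\otimes_R Q$ is injective. Two right $\Lambda$-modules $M,N$ are in the same genus if $M_\mathfrak m\cong N_\mathfrak m$ as $\Lambda_\mathfrak m$-modules for every maximal ideal $\mathfrak m$ of $R$ (localization at $R\setminus\mathfrak m$). *)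

theory Defs
  imports Main
begin

definition comm_ideal :: "'r::comm_ring_1 set \<Rightarrow> bool" where
  "comm_ideal I \<longleftrightarrow> 0 \<in> I \<and> (\<forall>a\<in>I. \<forall>b\<in>I. a + b \<in> I) \<and> (\<forall>a\<in>I. \<forall>r. r * a \<in> I)"

definition maximal_ideal :: "'r::comm_ring_1 set \<Rightarrow> bool" where
  "maximal_ideal m \<longleftrightarrow> comm_ideal m \<and> m \<noteq> UNIV \<and>
     (\<forall>J. comm_ideal J \<and> m \<subseteq> J \<longrightarrow> J = m \<or> J = UNIV)"

definition finite_character :: "'r::comm_ring_1 itself \<Rightarrow> bool" where
  "finite_character _ \<longleftrightarrow> (\<forall>x::'r. x \<noteq> 0 \<longrightarrow> finite {m. maximal_ideal m \<and> x \<in> m})"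

definition R_algebra :: "('r::comm_ring_1 \<Rightarrow> 'l::ring_1) \<Rightarrow> bool" where
  "R_algebra phi \<longleftrightarrow> phi 1 = 1 \<and> (\<forall>a b. phi (a + b) = phi a + phi b) \<and>
     (\<forall>a b. phi (a * b) = phi a * phi b) \<and> (\<forall>a x. phi a * x = x * phi a)"

definition fin_gen_over_R :: "('r::comm_ring_1 \<Rightarrow> 'l::ring_1) \<Rightarrow> bool" where
  "fin_gen_over_R phi \<longleftrightarrow> (\<exists>G. finite G \<and> (\<forall>x::'l. \<exists>c. x = (\<Sum>g\<in>G. phi (c g) * g)))"

definition rmodule :: "('m::ab_group_add \<Rightarrow> 'l::ring_1 \<Rightarrow> 'm) \<Rightarrow> bool" where
  "rmodule act \<longleftrightarrow> (\<forall>x y a. act (x + y) a = act x a + act y a) \<and>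
     (\<forall>x a b. act x (a + b) = act x a + act x b) \<and>
     (\<forall>x a b. act x (a * b) = act (act x a) b) \<and> (\<forall>x. act x 1 = x)"

definition rsubmodule :: "('m::ab_group_add \<Rightarrow> 'l::ring_1 \<Rightarrow> 'm) \<Rightarrow> 'm set \<Rightarrow> bool" where
  "rsubmodule act X \<longleftrightarrow> 0 \<in> X \<and> (\<forall>x\<in>X. \<forall>y\<in>X. x + y \<in> X) \<and> (\<forall>x\<in>X. \<forall>a. act x a \<in> X)"

definition fin_gen_rsubmodule :: "('m::ab_group_add \<Rightarrow> 'l::ring_1 \<Rightarrow> 'm) \<Rightarrow> 'm set \<Rightarrow> bool" where
  "fin_gen_rsubmodule act X \<longleftrightarrow> rsubmodule act X \<and>
     (\<exists>G. finite G \<and> G \<subseteq> X \<and> X = {\<Sum>g\<in>G. act g (c g) | c. True})"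

definition internal_dsum :: "('m::ab_group_add \<Rightarrow> 'l::ring_1 \<Rightarrow> 'm) \<Rightarrow> (nat \<Rightarrow> 'm set) \<Rightarrow> bool" where
  "internal_dsum act A \<longleftrightarrow> (\<forall>i. rsubmodule act (A i)) \<and>
     (\<forall>x. \<exists>!f. (\<forall>i. f i \<in> A i) \<and> finite {i. f i \<noteq> 0} \<and> x = (\<Sum>i\<in>{i. f i \<noteq> 0}. f i))"

definition rmod_iso_on :: "('m::ab_group_add \<Rightarrow> 'l::ring_1 \<Rightarrow> 'm) \<Rightarrow> ('n::ab_group_add \<Rightarrow> 'l \<Rightarrow> 'n)
     \<Rightarrow> 'm set \<Rightarrow> 'n set \<Rightarrow> bool" where
  "rmod_iso_on actM actN X Y \<longleftrightarrow> (\<exists>f. bij_betw f X Y \<and> (\<forall>x\<in>X. \<forall>y\<in>X. f (x + y) = f x + f y) \<and>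
     (\<forall>x\<in>X. \<forall>a. f (actM x a) = actN (f x) a))"

definition loc_rel :: "('r::comm_ring_1 \<Rightarrow> 'l::ring_1) \<Rightarrow> ('m \<Rightarrow> 'l \<Rightarrow> 'm) \<Rightarrow> 'r set \<Rightarrow> 'm set
     \<Rightarrow> (('m \<times> 'r) \<times> ('m \<times> 'r)) set" where
  "loc_rel phi act S X = {((x, s), (y, t)). x \<in> X \<and> y \<in> X \<and> s \<in> S \<and> t \<in> S \<and>
      (\<exists>u\<in>S. act x (phi (t * u)) = act y (phi (s * u)))}"

definition loc_carrier :: "('r::comm_ring_1 \<Rightarrow> 'l::ring_1) \<Rightarrow> ('m \<Rightarrow> 'l \<Rightarrow> 'm) \<Rightarrow> 'r set \<Rightarrow> 'm set
     \<Rightarrow> ('m \<times> 'r) set set" where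
  "loc_carrier phi act S X = (X \<times> S) // loc_rel phi act S X"

definition loc_class :: "('r::comm_ring_1 \<Rightarrow> 'l::ring_1) \<Rightarrow> ('m \<Rightarrow> 'l \<Rightarrow> 'm) \<Rightarrow> 'r set \<Rightarrow> 'm set
     \<Rightarrow> 'm \<times> 'r \<Rightarrow> ('m \<times> 'r) set" where
  "loc_class phi act S X p = loc_rel phi act S X `` {p}"

definition loc_add :: "('r::comm_ring_1 \<Rightarrow> 'l::ring_1) \<Rightarrow> ('m::ab_group_add \<Rightarrow> 'l \<Rightarrow> 'm) \<Rightarrow> 'r set \<Rightarrow> 'm set
     \<Rightarrow> ('m \<times> 'r) set \<Rightarrow> ('m \<times> 'r) set \<Rightarrow> ('m \<times> 'r) set" where
  "loc_add phi act S X c d = (\<Union>(x, s)\<in>c. \<Union>(y, t)\<in>d.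
      loc_class phi act S X (act x (phi t) + act y (phi s), s * t))"

definition loc_smult :: "('r::comm_ring_1 \<Rightarrow> 'l::ring_1) \<Rightarrow> ('m \<Rightarrow> 'l \<Rightarrow> 'm) \<Rightarrow> 'r set \<Rightarrow> 'm set
     \<Rightarrow> ('m \<times> 'r) set \<Rightarrow> ('l \<times> 'r) set \<Rightarrow> ('m \<times> 'r) set" where
  "loc_smult phi act S X c \<alpha> = (\<Union>(x, s)\<in>c. \<Union>(a, t)\<in>\<alpha>. loc_class phi act S X (act x a, s * t))"

abbreviation loc_alg_carrier :: "('r::comm_ring_1 \<Rightarrow> 'l::ring_1) \<Rightarrow> 'r set \<Rightarrow> ('l \<times> 'r) set set" where
  "loc_alg_carrier phi S \<equiv> loc_carrier phi (*) S UNIV"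

definition loc_modules_iso :: "('r::comm_ring_1 \<Rightarrow> 'l::ring_1) \<Rightarrow> ('m::ab_group_add \<Rightarrow> 'l \<Rightarrow> 'm)
     \<Rightarrow> ('n::ab_group_add \<Rightarrow> 'l \<Rightarrow> 'n) \<Rightarrow> 'r set \<Rightarrow> bool" where
  "loc_modules_iso phi actM actN S \<longleftrightarrow> (\<exists>f.
      bij_betw f (loc_carrier phi actM S UNIV) (loc_carrier phi actN S UNIV) \<and>
      (\<forall>c\<in>loc_carrier phi actM S UNIV. \<forall>d\<in>loc_carrier phi actM S UNIV.
          f (loc_add phi actM S UNIV c d) = loc_add phi actN S UNIV (f c) (f d)) \<and>
      (\<forall>c\<in>loc_carrier phi actM S UNIV. \<forall>\<alpha>\<in>loc_alg_carrier phi S.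
          f (loc_smult phi actM S UNIV c \<alpha>) = loc_smult phi actN S UNIV (f c) \<alpha>))"

definition same_genus :: "('r::comm_ring_1 \<Rightarrow> 'l::ring_1) \<Rightarrow> ('m::ab_group_add \<Rightarrow> 'l \<Rightarrow> 'm)
     \<Rightarrow> ('n::ab_group_add \<Rightarrow> 'l \<Rightarrow> 'n) \<Rightarrow> bool" where
  "same_genus phi actM actN \<longleftrightarrow> (\<forall>m. maximal_ideal m \<longrightarrow> loc_modules_iso phi actM actN (UNIV - m))"

text \<open>Torsion-free as R-module: X \<rightarrow> X \<otimes>_R Q = (R-0)^-1 X, x \<mapsto> [(x,1)], is injective.\<close>
definition R_torsion_free :: "('r::comm_ring_1 \<Rightarrow> 'l::ring_1) \<Rightarrow> ('m::ab_group_add \<Rightarrow> 'l \<Rightarrow> 'm)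
     \<Rightarrow> 'm set \<Rightarrow> bool" where
  "R_torsion_free phi act X \<longleftrightarrow> inj_on (\<lambda>x. loc_class phi act (UNIV - {0}) X (x, 1)) X"

definition right_ideal_in :: "'a set \<Rightarrow> ('a \<Rightarrow> 'a \<Rightarrow> 'a) \<Rightarrow> ('a \<Rightarrow> 'a \<Rightarrow> 'a) \<Rightarrow> 'a \<Rightarrow> 'a set \<Rightarrow> bool" where
  "right_ideal_in C add mul z I \<longleftrightarrow> I \<subseteq> C \<and> z \<in> I \<and> (\<forall>a\<in>I. \<forall>b\<in>I. add a b \<in> I) \<and>
     (\<forall>a\<in>I. \<forall>r\<in>C. mul a r \<in> I)"

definition twosided_ideal_in :: "'a set \<Rightarrow> ('a \<Rightarrow> 'a \<Rightarrow> 'a) \<Rightarrow> ('a \<Rightarrow> 'a \<Rightarrow> 'a) \<Rightarrow> 'a \<Rightarrow> 'a set \<Rightarrow> bool" where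
  "twosided_ideal_in C add mul z I \<longleftrightarrow> right_ideal_in C add mul z I \<and> (\<forall>a\<in>I. \<forall>r\<in>C. mul r a \<in> I)"

definition simple_artinian :: "'a set \<Rightarrow> ('a \<Rightarrow> 'a \<Rightarrow> 'a) \<Rightarrow> ('a \<Rightarrow> 'a \<Rightarrow> 'a) \<Rightarrow> 'a \<Rightarrow> 'a \<Rightarrow> bool" where
  "simple_artinian C add mul z u \<longleftrightarrow> z \<noteq> u \<and>
     (\<forall>I. twosided_ideal_in C add mul z I \<longrightarrow> I = {z} \<or> I = C) \<and>
     \<not> (\<exists>I::nat \<Rightarrow> 'a set. \<forall>n. right_ideal_in C add mul z (I n) \<and> I (Suc n) \<subset> I n)"

text \<open>Lambda \<otimes>_R Q realised as the localization (R-0)^-1 Lambda.\<close>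
definition tensor_Q_simple_artinian :: "('r::comm_ring_1 \<Rightarrow> 'l::ring_1) \<Rightarrow> bool" where
  "tensor_Q_simple_artinian phi \<longleftrightarrow>
     simple_artinian (loc_alg_carrier phi (UNIV - {0}))
       (loc_add phi (*) (UNIV - {0}) UNIV) (loc_smult phi (*) (UNIV - {0}) UNIV)
       (loc_class phi (*) (UNIV - {0}) UNIV (0, 1)) (loc_class phi (*) (UNIV - {0}) UNIV (1, 1))"

end

(* A back-and-forth argument. A split monomorphism f from a partial sum X of M to a partial sum Y of N is continued by
   a split monomorphism g from Y to a larger partial sum of M such that g o f is the inclusion; in the limit these maps
   give an isomorphism M = N, and the A_i together with their images are the required decompositions.

   To find g, the complement C of f(X) in Y has to be a summand of a tail of M. At each maximal ideal this holds
   because Y is locally a summand of M and X can be cancelled: the endomorphism ring of a finitely generated module over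
   a local base ring has stable range one, since modulo the ideal of maps into the maximal part it is a finite-dimensional
   algebra. From local to global: generically C splits off every tail, because the generic algebra is simple
   artinian. Hence C splits off some finite part of the tail outside a finite set of maximal ideals; at these finitely many
   ideals local splittings into another finite part are glued by the Chinese remainder theorem, and the sum of both maps
   splits everywhere.

   M and N are regarded as submodules of 'm x 'n, so that all maps live in one ring of additive endomorphisms and
   all summands are idempotents of it. *)

theory Submission
  imports Defs "HOL.Modules" "HOL-Library.Product_Plus" "HOL-Algebra.QuotRing"
begin

section \<open>Stable range one for strongly pi-regular rings\<close>

text \<open>No localized module occurs in the argument itself. A statement at a maximal ideal
  \<open>m\<close> is an identity between global maps up to a scalar \<open>sc t\<close> with
  \<open>t\<close> outside \<open>m\<close>, and a generic statement is one up to a non-zero scalar;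
  the localizations in the theorem are translated into this form. Invertibility at \<open>m\<close>
  can then be tested modulo \<open>m\<close>: Nakayama gives surjectivity up to a scalar, and
  counting linear relations over the field of fractions gives injectivity. The obstacle is
  cancellation. Decompositions over a local base ring need not be unique, so the part already
  matched cannot be removed by a Krull-Schmidt argument; stable range one takes its place. The other
  point is room. Up to denominators all modules in question are sums of copies of one minimal right
  ideal, and every non-zero summand contributes at least one copy. So a sufficiently long piece of
  any tail contains a given finitely generated summand generically, and the pieces used for the
  generic and for the exceptional splittings can be kept disjoint.\<close>

context ring
begin

text \<open>The Peirce corner \<open>fRf\<close>, kept as a subset of the ambient ring so that an
  induction over idempotents never changes the ring. Idempotence of \<open>f\<close> is expressed
  throughout by \<open>f \<in> corner f\<close>.\<close>

definition corner :: "'a \<Rightarrow> 'a set" where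
  "corner f = {x \<in> carrier R. f \<otimes> x = x \<and> x \<otimes> f = x}"

lemma cornerD:
  assumes "x \<in> corner f"
  shows "x \<in> carrier R" "f \<otimes> x = x" "x \<otimes> f = x"
  using assms by (auto simp: corner_def)

lemma corner_closed:
  assumes "f \<in> corner f"
  shows "\<And>x y. x \<in> corner f \<Longrightarrow> y \<in> corner f \<Longrightarrow> x \<otimes> y \<in> corner f"
    and "\<And>x y. x \<in> corner f \<Longrightarrow> y \<in> corner f \<Longrightarrow> x \<oplus> y \<in> corner f"
    and "\<And>x y. x \<in> corner f \<Longrightarrow> y \<in> corner f \<Longrightarrow> x \<ominus> y \<in> corner f"
    and "\<And>x. x \<in> carrier R \<Longrightarrow> f \<otimes> x \<otimes> f \<in> corner f"
proof -
  have f: "f \<in> carrier R" "f \<otimes> f = f" using assms by (auto simp: corner_def)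
  show "x \<otimes> y \<in> corner f" if "x \<in> corner f" "y \<in> corner f" for x y
    using that f by (auto simp: corner_def m_assoc) (simp add: m_assoc[symmetric])
  show "x \<oplus> y \<in> corner f" if "x \<in> corner f" "y \<in> corner f" for x y
    using that f by (auto simp: corner_def l_distr r_distr)
  show "x \<ominus> y \<in> corner f" if "x \<in> corner f" "y \<in> corner f" for x y
    using that f by (auto simp: corner_def l_distr r_distr minus_eq l_minus r_minus)
  show "f \<otimes> x \<otimes> f \<in> corner f" if "x \<in> carrier R" for x
    using that f by (auto simp: corner_def m_assoc) (simp add: m_assoc[symmetric])
qed

lemma corner_pow:
  assumes "f \<in> corner f" "c \<in> corner f"
  shows "c [^] Suc n \<in> corner f"
proof (induction n)
  case 0
  then show ?case using assms cornerD[OF assms(2)] by simp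
next
  case (Suc n)
  then show ?case using corner_closed(1)[OF assms(1) Suc assms(2)] by simp
qed

text \<open>The factor is the geometric sum \<open>1 + c + ... + c^(n-1)\<close>. On a corner that
  is killed by \<open>c^n\<close> it inverts \<open>1 - c\<close>.\<close>

lemma geometric_left_factor:
  assumes "c \<in> carrier R"
  shows "\<exists>y\<in>carrier R. y \<otimes> (\<one> \<ominus> c) = \<one> \<ominus> c [^] (n::nat)"
proof (induction n)
  case 0
  show ?case using assms by (intro bexI[of _ \<zero>]) (auto simp: minus_eq r_neg)
next
  case (Suc n)
  then obtain y where y: "y \<in> carrier R" "y \<otimes> (\<one> \<ominus> c) = \<one> \<ominus> c [^] n" by auto
  define z where "z = c [^] n"
  have z: "z \<in> carrier R" using assms by (simp add: z_def)
  have "(y \<oplus> z) \<otimes> (\<one> \<ominus> c) = y \<otimes> (\<one> \<ominus> c) \<oplus> z \<otimes> (\<one> \<ominus> c)" using y z assms by (simp add: l_distr)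
  also have "\<dots> = (\<one> \<ominus> z) \<oplus> (z \<ominus> z \<otimes> c)" using y z assms by (simp add: z_def[symmetric] minus_eq r_distr r_minus)
  also have "\<dots> = \<one> \<ominus> z \<otimes> c" using z assms by (simp add: minus_eq a_assoc r_neg1 l_neg)
  finally show ?case using y z by (intro bexI[of _ "y \<oplus> z"]) (auto simp: z_def)
qed

text \<open>The form with a commuting \<open>s\<close>. The exponent is at least 1 because the power
  with exponent 0 is the unit of the whole ring, which need not lie in a corner.\<close>

definition strongly_pi_regular :: bool where
  "strongly_pi_regular \<longleftrightarrow> (\<forall>c\<in>carrier R. \<exists>n. \<exists>s\<in>carrier R. c \<otimes> s = s \<otimes> c \<and>
     c [^] Suc n = c [^] Suc n \<otimes> c \<otimes> s)"

text \<open>Direct finiteness: multiplying \<open>a^(n+1) = a^(n+2) t\<close> on the left by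
  \<open>b^(n+1)\<close> leaves \<open>f = a \<otimes> t\<close>, so \<open>a\<close> can be
  cancelled from the other side as well.\<close>

lemma corner_one_sided_inverse:
  assumes "strongly_pi_regular" "f \<in> corner f" "a \<in> corner f" "b \<in> corner f" "b \<otimes> a = f"
  shows "a \<otimes> b = f"
proof -
  obtain n t where t: "t \<in> carrier R" "a [^] Suc n = a [^] Suc n \<otimes> a \<otimes> t"
    using assms(1) cornerD(1)[OF assms(3)] unfolding strongly_pi_regular_def by blast
  note [simp] = cornerD(1)[OF assms(2)] cornerD(1)[OF assms(3)] cornerD(1)[OF assms(4)] t(1)
  have pw: "b [^] Suc k \<otimes> a [^] Suc k = f" for k
  proof (induction k)
    case 0 then show ?case using assms(5) by simp
  next
    case (Suc k)
    have "b [^] Suc (Suc k) \<otimes> a [^] Suc (Suc k) = b \<otimes> (b [^] Suc k \<otimes> a [^] Suc k) \<otimes> a"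
      using nat_pow_Suc2[of b "Suc k"] by (simp add: m_assoc del: nat_pow_Suc)
    then show ?case using Suc assms(5) cornerD[OF assms(4)] by simp
  qed
  have "f = b [^] Suc n \<otimes> (a [^] Suc n \<otimes> a \<otimes> t)" using pw[of n] t by simp
  also have "\<dots> = (b [^] Suc n \<otimes> a [^] Suc n) \<otimes> a \<otimes> t" by (simp add: m_assoc del: nat_pow_Suc)
  also have "\<dots> = a \<otimes> t" unfolding pw using cornerD(2)[OF assms(3)] by simp
  finally have 1: "a \<otimes> t = f" by simp
  have "b = b \<otimes> (a \<otimes> t)" using 1 cornerD(3)[OF assms(4)] by simp
  also have "\<dots> = f \<otimes> t" using assms(5) by (simp add: m_assoc[symmetric])
  finally have "a \<otimes> b = a \<otimes> f \<otimes> t" by (simp add: m_assoc)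
  then show ?thesis using 1 cornerD(3)[OF assms(3)] by simp
qed

text \<open>Fitting decomposition of \<open>c\<close>. With \<open>C = c^(n+1)\<close> and
  \<open>S = s^(n+1)\<close> the product \<open>C S = (c s)^(n+1)\<close> is an idempotent
  \<open>g\<close> that fixes \<open>C\<close>. Hence \<open>c\<close> has a left inverse
  \<open>k\<close> on \<open>g\<close>, while \<open>C\<close> vanishes on
  \<open>e \<ominus> g\<close>, where a geometric sum inverts \<open>e \<ominus> c\<close> from the
  left.\<close>

lemma corner_fitting:
  assumes "strongly_pi_regular" "e \<in> corner e" "c \<in> corner e"
  obtains g k y where "g \<in> corner e" "g \<otimes> g = g" "k \<in> corner e" "k \<otimes> c = g"
    "y \<in> corner e" "(e \<ominus> g) \<otimes> y = y" "y \<otimes> (e \<ominus> c) \<otimes> (e \<ominus> g) = e \<ominus> g"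
proof -
  obtain n s where s: "s \<in> carrier R" "c \<otimes> s = s \<otimes> c" "c [^] Suc n = c [^] Suc n \<otimes> c \<otimes> s"
    using assms(1) cornerD(1)[OF assms(3)] unfolding strongly_pi_regular_def by blast
  note e = cornerD[OF assms(2)] and c = cornerD[OF assms(3)]
  define C where "C = c [^] Suc n"
  define S where "S = s [^] Suc n"
  have C: "C \<in> corner e" unfolding C_def using corner_pow assms by blast
  note Cc = cornerD[OF C]
  have Sc: "S \<in> carrier R" unfolding S_def using s(1) by simp
  have CS: "C \<otimes> S = S \<otimes> C"
    unfolding S_def C_def
    using group_commutes_pow[of c "s [^] Suc n" "Suc n"] group_commutes_pow[of s c "Suc n"] c(1) s
    by (simp del: nat_pow_Suc)
  have Ccs: "C \<otimes> (c \<otimes> s) = C" using s(3) Cc(1) c(1) s(1) unfolding C_def[symmetric] by (simp add: m_assoc)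
  have Cpow: "C \<otimes> (c \<otimes> s) [^] (k::nat) = C" for k
  proof (induction k)
    case 0 then show ?case using Cc by simp
  next
    case (Suc k)
    have "C \<otimes> (c \<otimes> s) [^] Suc k = (C \<otimes> (c \<otimes> s) [^] k) \<otimes> (c \<otimes> s)"
      using Cc(1) c(1) s(1) by (simp add: m_assoc)
    then show ?case using Suc Ccs by simp
  qed
  define g where "g = C \<otimes> S"
  have gc: "g \<in> carrier R" using Cc(1) Sc by (simp add: g_def)
  have "(c \<otimes> s) [^] Suc n = g" unfolding g_def C_def S_def using pow_mult_distrib[of c s "Suc n"] c(1) s by blast
  then have Cg: "C \<otimes> g = C" using Cpow[of "Suc n"] by simp
  have gS: "g = S \<otimes> C" using CS g_def by simp
  have gC: "g \<otimes> C = C"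
    using Cg Cc(1) Sc CS unfolding g_def by (metis m_assoc)
  have g: "g \<in> corner e"
  proof -
    have "e \<otimes> g = g" unfolding g_def using e(1) Cc Sc by (simp add: m_assoc[symmetric])
    moreover have "g \<otimes> e = g" unfolding gS using e(1) Cc Sc by (simp add: m_assoc)
    ultimately show ?thesis using gc by (simp add: corner_def)
  qed
  have gg: "g \<otimes> g = g" using gC Cc(1) Sc gc unfolding g_def by (metis m_assoc m_closed)
  define k where "k = e \<otimes> (S \<otimes> c [^] n) \<otimes> e"
  have k: "k \<in> corner e" unfolding k_def using corner_closed(4)[OF assms(2)] Sc c(1) by simp
  have "k \<otimes> c = e \<otimes> (S \<otimes> (c [^] n \<otimes> c))"
    unfolding k_def using e c Sc by (simp add: m_assoc)
  then have kc: "k \<otimes> c = g" using gS cornerD(2)[OF g] unfolding C_def by simp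
  define b where "b = e \<ominus> g"
  have b: "b \<in> corner e" unfolding b_def using corner_closed(3) assms(2) g by blast
  note bc = cornerD[OF b]
  have bb: "b \<otimes> b = b"
    using e cornerD[OF g] gg unfolding b_def by (simp add: minus_eq l_distr r_distr l_minus r_minus r_neg)
  have Cb: "C \<otimes> b = \<zero>"
    using e cornerD[OF g] Cg Cc unfolding b_def by (simp add: minus_eq r_distr r_minus r_neg)
  obtain z where z: "z \<in> carrier R" "z \<otimes> (\<one> \<ominus> c) = \<one> \<ominus> C"
    using geometric_left_factor[OF c(1), of "Suc n"] unfolding C_def by blast
  define y where "y = b \<otimes> (e \<otimes> z \<otimes> e)"
  have y: "y \<in> corner e" unfolding y_def using corner_closed(1,4) assms(2) b z(1) by simp
  have by1: "b \<otimes> y = y" unfolding y_def using bc(1) bb e(1) z(1) by (simp add: m_assoc[symmetric])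
  have ecb: "e \<otimes> ((e \<ominus> c) \<otimes> b) = (\<one> \<ominus> c) \<otimes> b"
    using e c bc by (simp add: minus_eq l_distr r_distr l_minus r_minus m_assoc[symmetric])
  have "y \<otimes> (e \<ominus> c) \<otimes> b = b \<otimes> (e \<otimes> (z \<otimes> (e \<otimes> ((e \<ominus> c) \<otimes> b))))"
    unfolding y_def using bc(1) e(1) c(1) z(1) by (simp add: m_assoc)
  also have "\<dots> = (b \<otimes> e) \<otimes> ((z \<otimes> (\<one> \<ominus> c)) \<otimes> b)"
    unfolding ecb using bc(1) e(1) c(1) z(1) by (simp add: m_assoc)
  also have "\<dots> = b \<otimes> (b \<ominus> C \<otimes> b)"
    unfolding z(2) bc(3) using bc(1) Cc(1) by (simp add: minus_eq l_distr l_minus)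
  also have "\<dots> = b" using Cb bb bc(1) by (simp add: minus_eq)
  finally show thesis using that g gg k kc y by1 unfolding b_def by blast
qed

text \<open>The strict order of idempotents, with \<open>g\<close> below \<open>f\<close> when
  \<open>fg = g = gf\<close>. Its well-foundedness is a descending chain condition, which replaces a
  dimension in the induction for stable range one.\<close>

definition corner_idempotents :: "('a \<times> 'a) set" where
  "corner_idempotents = {(g, f). g \<in> corner f \<and> g \<in> corner g \<and> g \<noteq> f}"

lemma add_cancel_middle:
  assumes "x \<in> carrier R" "y \<in> carrier R" "z \<in> carrier R"
  shows "(x \<oplus> y) \<oplus> (z \<ominus> y) = x \<oplus> z"
proof -
  have "(x \<oplus> y) \<oplus> (z \<ominus> y) = x \<oplus> z \<oplus> (y \<oplus> \<ominus> y)" using assms by (simp add: minus_eq a_ac)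
  then show ?thesis using assms by (simp add: r_neg)
qed

lemma square_zero_inverse:
  assumes "e \<in> carrier R" "x \<in> carrier R" "e \<otimes> e = e" "e \<otimes> x = x" "x \<otimes> e = x" "x \<otimes> x = \<zero>"
  shows "(e \<oplus> x) \<otimes> (e \<ominus> x) = e" "(e \<ominus> x) \<otimes> (e \<oplus> x) = e"
proof -
  have "(e \<oplus> x) \<otimes> (e \<ominus> x) = e \<oplus> x \<oplus> (\<ominus> x)"
    using assms by (simp add: minus_eq l_distr r_distr l_minus r_minus)
  then show "(e \<oplus> x) \<otimes> (e \<ominus> x) = e" using assms(1,2) by (simp add: a_assoc r_neg)
  have "(e \<ominus> x) \<otimes> (e \<oplus> x) = e \<oplus> x \<oplus> (\<ominus> x)"
    using assms by (simp add: minus_eq l_distr r_distr l_minus r_minus a_ac)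
  then show "(e \<ominus> x) \<otimes> (e \<oplus> x) = e" using assms(1,2) by (simp add: a_assoc r_neg)
qed

text \<open>Fitting's lemma splits e as b + g with c nilpotent on b and invertible on g, so that the g-column of a can be
  chosen freely. The b-column is a split monomorphism; stable range one for b carries it to the standard one by
  elementary transformations.\<close>

theorem corner_stable_range_one:
  assumes spr: "strongly_pi_regular" and wf: "wf corner_idempotents"
  shows "e \<in> corner e \<Longrightarrow> a \<in> corner e \<Longrightarrow> p \<in> corner e \<Longrightarrow> c \<in> corner e \<Longrightarrow> p \<otimes> a \<oplus> c = e
    \<Longrightarrow> \<exists>h\<in>corner e. \<exists>u\<in>corner e. (a \<oplus> h \<otimes> c) \<otimes> u = e \<and> u \<otimes> (a \<oplus> h \<otimes> c) = e"
  using wf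
proof (induction e arbitrary: a p c rule: wf_induct_rule)
  case (less e)
  note cl = corner_closed[OF less.prems(1)]
  note ec = cornerD[OF less.prems(1)] and ac = cornerD[OF less.prems(2)]
    and pc = cornerD[OF less.prems(3)] and cc = cornerD[OF less.prems(4)]
  obtain g k y where g: "g \<in> corner e" "g \<otimes> g = g" and k: "k \<in> corner e" "k \<otimes> c = g"
    and y: "y \<in> corner e" "(e \<ominus> g) \<otimes> y = y" "y \<otimes> (e \<ominus> c) \<otimes> (e \<ominus> g) = e \<ominus> g"
    using corner_fitting[OF spr less.prems(1,4)] by blast
  define b where "b = e \<ominus> g"
  have b: "b \<in> corner e" unfolding b_def using cl(3) less.prems(1) g by blast
  note bc = cornerD[OF b] and gc = cornerD[OF g(1)] and yc = cornerD[OF y(1)] and kc = cornerD[OF k(1)]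
  have bb: "b \<otimes> b = b" and gb: "g \<otimes> b = \<zero>" and bg: "b \<otimes> g = \<zero>"
    using ec gc g(2) unfolding b_def by (simp_all add: minus_eq l_distr r_distr l_minus r_minus r_neg)
  have bpg: "b \<oplus> g = e" unfolding b_def using ec gc by (simp add: minus_eq a_assoc l_neg)
  \<comment> \<open>Since \<open>p a = e - c\<close>, this is a left inverse of \<open>a\<close> on
    \<open>b\<close>: \<open>q a b = b\<close>.\<close>
  define q where "q = y \<otimes> p"
  have q: "q \<in> corner e" unfolding q_def using cl(1) y(1) less.prems by blast
  note qc = cornerD[OF q]
  have bq: "b \<otimes> q = q" unfolding q_def using y(2) bc(1) yc(1) pc(1) by (simp add: b_def[symmetric] m_assoc[symmetric])
  have "p \<otimes> a = e \<ominus> c"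
    using less.prems(5) pc(1) ac(1) cc(1) by (metis add.inv_solve_right' m_closed minus_eq a_closed)
  then have qab: "q \<otimes> a \<otimes> b = b"
    unfolding q_def using y(3) yc(1) pc(1) ac(1) by (simp add: b_def[symmetric] m_assoc)
  show ?case
  proof (cases "b = e")
    \<comment> \<open>Here \<open>g\<close> is zero and \<open>c\<close> is nilpotent;
      \<open>a\<close> is already a unit by direct finiteness, and \<open>h\<close> can be
      zero.\<close>
    case True
    then have "q \<otimes> a = e" using qab ac qc(1) ec(1) by (simp add: m_assoc)
    moreover from this have "a \<otimes> q = e"
      using corner_one_sided_inverse[OF spr less.prems(1,2) q] by blast
    moreover have "\<zero> \<in> corner e" using ec by (simp add: corner_def)
    ultimately show ?thesis using q ac(1) cc(1) by (intro bexI[of _ \<zero>] bexI[of _ q]) auto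
  next
    case False
    have bcb: "b \<in> corner b" using bb bc(1) by (simp add: corner_def)
    have lt: "(b, e) \<in> corner_idempotents" using False b bcb by (simp add: corner_idempotents_def)
    note clb = corner_closed[OF bcb]
    \<comment> \<open>The \<open>b\<close>-column of \<open>a\<close> has the entry
      \<open>a'\<close> in \<open>b\<close> and the entry \<open>g a b\<close> in \<open>g\<close>.
      Splitting \<open>q\<close> as \<open>q b + q g\<close> turns \<open>q a b = b\<close> into
      \<open>p' a' + d = b\<close>, the hypothesis of the theorem for the smaller idempotent
      \<open>b\<close>.\<close>
    define a' where "a' = b \<otimes> a \<otimes> b"
    define p' where "p' = b \<otimes> q \<otimes> b"
    define d where "d = q \<otimes> g \<otimes> a \<otimes> b"
    have d_eq: "b \<otimes> (q \<otimes> g \<otimes> a) \<otimes> b = d"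
      unfolding d_def using bq bc(1) qc(1) gc(1) ac(1) by (simp add: m_assoc[symmetric])
    have a': "a' \<in> corner b" and p': "p' \<in> corner b" and d: "d \<in> corner b"
      unfolding a'_def p'_def d_eq[symmetric] using clb(4) ac(1) qc(1) gc(1) by auto
    have "p' \<otimes> a' \<oplus> d = (q \<otimes> b \<otimes> a \<otimes> b) \<oplus> (q \<otimes> g \<otimes> a \<otimes> b)"
    proof -
      have "p' \<otimes> a' = (b \<otimes> q) \<otimes> ((b \<otimes> b) \<otimes> a \<otimes> b)"
        unfolding p'_def a'_def using bc(1) qc(1) ac(1) by (simp add: m_assoc)
      then show ?thesis unfolding d_def bb bq using bc(1) qc(1) ac(1) by (simp add: m_assoc)
    qed
    also have "\<dots> = q \<otimes> (b \<oplus> g) \<otimes> a \<otimes> b" using bc(1) qc(1) ac(1) gc(1) by (simp add: l_distr r_distr)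
    also have "\<dots> = b" using qab qc by (simp add: bpg)
    finally have "p' \<otimes> a' \<oplus> d = b" .
    from less.IH[OF lt bcb a' p' d this] obtain h v where h: "h \<in> corner b" and v: "v \<in> corner b"
      and hv: "(a' \<oplus> h \<otimes> d) \<otimes> v = b" "v \<otimes> (a' \<oplus> h \<otimes> d) = b" by blast
    note hc = cornerD[OF h] and vc = cornerD[OF v]
    define w where "w = a' \<oplus> h \<otimes> d"
    have w: "w \<in> corner b" unfolding w_def using clb a' h d by blast
    note wc = cornerD[OF w]
    have he: "x \<in> corner e" if "x \<in> corner b" for x
    proof -
      note xc = cornerD[OF that]
      have "e \<otimes> (b \<otimes> x) = b \<otimes> x" "(x \<otimes> b) \<otimes> e = x \<otimes> b"
        using xc(1) bc ec(1) by (simp_all add: m_assoc) (simp add: m_assoc[symmetric])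
      then show ?thesis using xc by (simp add: corner_def)
    qed
    note hE = he[OF h] and vE = he[OF v] and wE = he[OF w]
    \<comment> \<open>Two square-zero maps between \<open>b\<close> and \<open>g\<close>: the row
      operation \<open>e + N\<close> changes the entry \<open>a'\<close> into the unit
      \<open>w = a' + h d\<close>, and \<open>e - L\<close> then clears the entry
      \<open>g a b\<close>.\<close>
    define N where "N = h \<otimes> q \<otimes> g"
    define L where "L = g \<otimes> a \<otimes> b \<otimes> v"
    have N: "N \<in> corner e" unfolding N_def using cl(1) hE q g(1) by blast
    have L: "L \<in> corner e" unfolding L_def using cl(1) less.prems(2) g(1) b vE by blast
    note Nc = cornerD[OF N] and Lc = cornerD[OF L]
    have gh: "g \<otimes> h = \<zero>"
    proof -
      have "g \<otimes> (b \<otimes> h) = \<zero>" using gb gc(1) bc(1) hc(1) by (simp add: m_assoc[symmetric])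
      then show ?thesis using hc by simp
    qed
    have vg: "v \<otimes> g = \<zero>"
    proof -
      have "(v \<otimes> b) \<otimes> g = \<zero>" using bg gc(1) bc(1) vc(1) by (simp add: m_assoc)
      then show ?thesis using vc by simp
    qed
    have wg: "w \<otimes> g = \<zero>"
    proof -
      have "(w \<otimes> b) \<otimes> g = \<zero>" using bg gc(1) bc(1) wc(1) by (simp add: m_assoc)
      then show ?thesis using wc by simp
    qed
    have gw: "g \<otimes> w = \<zero>"
    proof -
      have "g \<otimes> (b \<otimes> w) = \<zero>" using gb gc(1) bc(1) wc(1) by (simp add: m_assoc[symmetric])
      then show ?thesis using wc by simp
    qed
    have gv: "g \<otimes> v = \<zero>"
    proof -
      have "g \<otimes> (b \<otimes> v) = \<zero>" using gb gc(1) bc(1) vc(1) by (simp add: m_assoc[symmetric])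
      then show ?thesis using vc by simp
    qed
    have NN: "N \<otimes> N = \<zero>"
    proof -
      have "N \<otimes> N = h \<otimes> q \<otimes> (g \<otimes> h) \<otimes> q \<otimes> g"
        unfolding N_def using hc(1) qc(1) gc(1) by (simp add: m_assoc)
      then show ?thesis using gh hc(1) qc(1) gc(1) by simp
    qed
    have LL: "L \<otimes> L = \<zero>"
    proof -
      have "L \<otimes> L = g \<otimes> a \<otimes> b \<otimes> (v \<otimes> g) \<otimes> a \<otimes> b \<otimes> v"
        unfolding L_def using gc(1) ac(1) bc(1) vc(1) by (simp add: m_assoc)
      then show ?thesis using vg gc(1) ac(1) bc(1) vc(1) by simp
    qed
    define U where "U = e \<oplus> N"
    define Ui where "Ui = e \<ominus> N"
    define V where "V = e \<ominus> L"
    define Vi where "Vi = e \<oplus> L"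
    have UVc: "U \<in> corner e" "Ui \<in> corner e" "V \<in> corner e" "Vi \<in> corner e"
      unfolding U_def Ui_def V_def Vi_def using cl less.prems(1) N L by blast+
    note Uc = cornerD[OF UVc(1)] and Uic = cornerD[OF UVc(2)] and Vc = cornerD[OF UVc(3)] and Vic = cornerD[OF UVc(4)]
    have inv: "U \<otimes> Ui = e" "Ui \<otimes> U = e" "V \<otimes> Vi = e" "Vi \<otimes> V = e"
      unfolding U_def Ui_def V_def Vi_def using ec Nc Lc NN LL
      by (intro square_zero_inverse; simp)+
    define T where "T = Ui \<otimes> Vi"
    define Ti where "Ti = V \<otimes> U"
    have T: "T \<in> corner e" "Ti \<in> corner e" unfolding T_def Ti_def using cl(1) UVc by blast+
    note Tc = cornerD[OF T(1)] and Tic = cornerD[OF T(2)]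
    have TT: "T \<otimes> Ti = e"
    proof -
      have "T \<otimes> Ti = Ui \<otimes> (Vi \<otimes> V) \<otimes> U" unfolding T_def Ti_def using Uc(1) Uic(1) Vc(1) Vic(1) by (simp add: m_assoc)
      then show ?thesis using inv Uic by simp
    qed
    have TiT: "Ti \<otimes> T = e"
    proof -
      have "Ti \<otimes> T = V \<otimes> (U \<otimes> Ui) \<otimes> Vi" unfolding T_def Ti_def using Uc(1) Uic(1) Vc(1) Vic(1) by (simp add: m_assoc)
      then show ?thesis using inv Vc by simp
    qed
    define r where "r = g \<otimes> a \<otimes> b"
    have rc: "r \<in> carrier R" unfolding r_def using gc(1) ac(1) bc(1) by simp
    have Uab: "U \<otimes> (a \<otimes> b) = w \<oplus> r"
    proof -
      have "a \<otimes> b = (b \<oplus> g) \<otimes> (a \<otimes> b)" unfolding bpg using ec ac bc by (simp add: m_assoc[symmetric])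
      also have "\<dots> = a' \<oplus> r" unfolding a'_def r_def using gc(1) ac(1) bc(1) by (simp add: l_distr m_assoc)
      finally have 1: "a \<otimes> b = a' \<oplus> r" .
      have 2: "N \<otimes> (a \<otimes> b) = h \<otimes> d" unfolding N_def d_def using gc(1) ac(1) bc(1) hc(1) qc(1) by (simp add: m_assoc)
      have "U \<otimes> (a \<otimes> b) = a \<otimes> b \<oplus> N \<otimes> (a \<otimes> b)"
        unfolding U_def using ec ac bc Nc by (simp add: l_distr m_assoc[symmetric])
      also have "\<dots> = (a' \<oplus> r) \<oplus> h \<otimes> d" unfolding 2 by (simp add: 1)
      also have "\<dots> = w \<oplus> r" unfolding w_def
        using cornerD(1)[OF a'] cornerD(1)[OF d] hc(1) rc by (simp add: a_ac)
      finally show ?thesis .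
    qed
    have vr: "v \<otimes> r = \<zero>" unfolding r_def using vg vc(1) gc(1) ac(1) bc(1) by (simp add: m_assoc[symmetric])
    have rb: "r \<otimes> b = r" unfolding r_def using bb gc(1) ac(1) bc(1) by (simp add: m_assoc)
    have Lr: "L = r \<otimes> v" unfolding L_def r_def ..
    have er: "e \<otimes> r = r" unfolding r_def using ec gc ac bc by (simp add: m_assoc[symmetric])
    have Tab: "Ti \<otimes> (a \<otimes> b) = w"
    proof -
      have "Ti \<otimes> (a \<otimes> b) = V \<otimes> (w \<oplus> r)" unfolding Ti_def using Uab Uc(1) Vc(1) ac(1) bc(1) by (simp add: m_assoc)
      also have "\<dots> = w \<oplus> \<ominus> (r \<otimes> (v \<otimes> w)) \<oplus> (r \<oplus> \<ominus> (r \<otimes> (v \<otimes> r)))"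
        unfolding V_def Lr using ec(1) er rc wc(1) vc(1) cornerD(2)[OF wE]
        by (simp add: minus_eq l_distr r_distr l_minus r_minus m_assoc)
      also have "\<dots> = w" using hv rb rc wc(1) unfolding w_def[symmetric] vr by (simp add: a_assoc l_neg)
      finally show ?thesis .
    qed
    \<comment> \<open>Because \<open>k c = g\<close>, the \<open>g\<close>-column of
      \<open>a + h2 c\<close> can be prescribed. The choice \<open>T g\<close> makes
      \<open>Ti\<close> carry the whole element to the block diagonal \<open>w + g\<close>.\<close>
    define h2 where "h2 = (T \<otimes> g \<ominus> a \<otimes> g) \<otimes> k"
    have h2: "h2 \<in> corner e" unfolding h2_def by (intro cl(1,3) T(1) g(1) k(1) less.prems(2))
    define X where "X = a \<oplus> h2 \<otimes> c"
    have "h2 \<otimes> c = T \<otimes> g \<ominus> a \<otimes> g"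
    proof -
      have "h2 \<otimes> c = (T \<otimes> g \<ominus> a \<otimes> g) \<otimes> g" unfolding h2_def using k(2) kc(1) cc(1) Tc(1) ac(1) gc(1) by (simp add: m_assoc)
      then show ?thesis using g(2) Tc(1) ac(1) gc(1) by (simp add: minus_eq l_distr l_minus m_assoc)
    qed
    then have X: "X = a \<otimes> b \<oplus> T \<otimes> g"
    proof -
      have "a = a \<otimes> b \<oplus> a \<otimes> g" using ac bpg bc(1) gc(1) by (metis r_distr)
      then show ?thesis unfolding X_def \<open>h2 \<otimes> c = _\<close>
        using add_cancel_middle[of "a \<otimes> b" "a \<otimes> g" "T \<otimes> g"] ac(1) bc(1) gc(1) Tc(1) by simp
    qed
    have Xc: "X \<in> carrier R" unfolding X using Tc(1) ac(1) bc(1) gc(1) by simp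
    have XT: "Ti \<otimes> X = w \<oplus> g"
    proof -
      have "Ti \<otimes> (T \<otimes> g) = g" using TiT gc Tc(1) Tic(1) by (simp add: m_assoc[symmetric])
      then show ?thesis unfolding X using Tab gc(1) Tc(1) Tic(1) ac(1) bc(1) by (simp add: r_distr)
    qed
    have XE: "X \<in> corner e" unfolding X_def by (intro cl(1,2) h2 less.prems)
    have wv: "(w \<oplus> g) \<otimes> (v \<oplus> g) = e" "(v \<oplus> g) \<otimes> (w \<oplus> g) = e"
      using hv wg vg gw gv g(2) bpg wc(1) vc(1) gc(1) bc(1) unfolding w_def[symmetric] by (simp_all add: l_distr r_distr)
    define u where "u = (v \<oplus> g) \<otimes> Ti"
    have u: "u \<in> corner e" unfolding u_def by (intro cl(1,2) T(2) vE g(1))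
    have uX: "u \<otimes> X = e" unfolding u_def using XT wv vc(1) gc(1) Tic(1) Xc by (simp add: m_assoc)
    have "X \<otimes> u = (T \<otimes> Ti) \<otimes> X \<otimes> u" using TT cornerD[OF XE] by simp
    also have "\<dots> = T \<otimes> ((Ti \<otimes> X) \<otimes> (v \<oplus> g)) \<otimes> Ti"
      unfolding u_def using vc(1) gc(1) Tic(1) Tc(1) Xc by (simp add: m_assoc)
    also have "\<dots> = e" unfolding XT wv using Tc TT by simp
    finally have "X \<otimes> u = e" .
    with uX show ?thesis using h2 u unfolding X_def by blast
  qed
qed

end

section \<open>Additive endomorphisms\<close>

typedef (overloaded) 'a endo = "{f :: 'a::ab_group_add \<Rightarrow> 'a. \<forall>x y. f (x + y) = f x + f y}"
  morphisms app Endo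
  by (rule exI[of _ id]) simp

setup_lifting type_definition_endo

text \<open>Not an instance of \<open>ring_1\<close>: that class requires
  \<open>0 \<noteq> 1\<close>, which fails for the endomorphisms of a trivial group.\<close>

instantiation endo :: (ab_group_add) "{ring, monoid_mult}"
begin
lift_definition zero_endo :: "'a endo" is "\<lambda>_. 0" by simp
lift_definition one_endo :: "'a endo" is "\<lambda>x. x" by simp
lift_definition plus_endo :: "'a endo \<Rightarrow> 'a endo \<Rightarrow> 'a endo" is "\<lambda>f g x. f x + g x" by (simp add: algebra_simps)
lift_definition minus_endo :: "'a endo \<Rightarrow> 'a endo \<Rightarrow> 'a endo" is "\<lambda>f g x. f x - g x" by (simp add: algebra_simps)
lift_definition uminus_endo :: "'a endo \<Rightarrow> 'a endo" is "\<lambda>f x. - f x" by (simp add: algebra_simps)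
lift_definition times_endo :: "'a endo \<Rightarrow> 'a endo \<Rightarrow> 'a endo" is "\<lambda>f g x. f (g x)" by simp
instance
  by standard (transfer; simp add: fun_eq_iff algebra_simps)+
end

lemma app_add [simp]: "app f (x + y) = app f x + app f y"
  by transfer simp

lemma app_zero [simp]: "app f 0 = 0"
  using app_add[of f 0 0] by simp

lemma app_minus [simp]: "app f (- x) = - app f x"
  using app_add[of f x "- x"] by (simp add: eq_neg_iff_add_eq_0 add.commute)

lemma app_diff [simp]: "app f (x - y) = app f x - app f y"
  using app_add[of f x "- y"] by simp

lemma app_sum: "app f (\<Sum>i\<in>I. x i) = (\<Sum>i\<in>I. app f (x i))"
  by (induction I rule: infinite_finite_induct) auto

lemma endo_app [simp]:
  "app 0 x = 0" "app 1 x = x" "app (f + g) x = app f x + app g x" "app (f - g) x = app f x - app g x"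
  "app (- f) x = - app f x" "app (f * g) x = app f (app g x)"
  by (transfer; simp)+

lemma app_sum_endo: "app (\<Sum>i\<in>I. f i) x = (\<Sum>i\<in>I. app (f i) x)"
  by (induction I rule: infinite_finite_induct) auto

lemma endo_eqI: "(\<And>x. app f x = app g x) \<Longrightarrow> f = g"
  by transfer auto

lemma app_Endo: "(\<And>x y. f (x + y) = f x + f y) \<Longrightarrow> app (Endo f) = f"
  by (simp add: Endo_inverse)

subsection \<open>Maximal ideals\<close>

lemma comm_idealD:
  assumes "comm_ideal I"
  shows "0 \<in> I" "\<And>a b. a \<in> I \<Longrightarrow> b \<in> I \<Longrightarrow> a + b \<in> I" "\<And>a r. a \<in> I \<Longrightarrow> r * a \<in> I" "\<And>a r. a \<in> I \<Longrightarrow> a * r \<in> I"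
    "\<And>a. a \<in> I \<Longrightarrow> - a \<in> I" "\<And>a b. a \<in> I \<Longrightarrow> b \<in> I \<Longrightarrow> a - b \<in> I"
proof -
  show 1: "0 \<in> I" "\<And>a b. a \<in> I \<Longrightarrow> b \<in> I \<Longrightarrow> a + b \<in> I" "\<And>a r. a \<in> I \<Longrightarrow> r * a \<in> I"
    using assms by (auto simp: comm_ideal_def)
  then show "\<And>a r. a \<in> I \<Longrightarrow> a * r \<in> I" by (simp add: mult.commute)
  show 2: "- a \<in> I" if "a \<in> I" for a using 1(3)[OF that, of "-1"] by simp
  show "a - b \<in> I" if "a \<in> I" "b \<in> I" for a b using 1(2)[OF that(1) 2[OF that(2)]] by simp
qed

lemma comm_ideal_sum:
  assumes "comm_ideal I" "\<And>k. k \<in> K \<Longrightarrow> f k \<in> I"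
  shows "(\<Sum>k\<in>K. f k) \<in> I"
  using assms(2) by (induction K rule: infinite_finite_induct) (auto intro: comm_idealD(1,2)[OF assms(1)])

text \<open>Primes rather than maximal ideals, since the zero ideal is used as well: linear algebra
  modulo a prime then covers the residue fields and the field of fractions at once.\<close>

definition prime_comm_ideal :: "'r::comm_ring_1 set \<Rightarrow> bool" where
  "prime_comm_ideal p \<longleftrightarrow> comm_ideal p \<and> 1 \<notin> p \<and> (\<forall>a b. a * b \<in> p \<longrightarrow> a \<in> p \<or> b \<in> p)"

lemma prime_zero_ideal: "prime_comm_ideal {0::'r::idom}"
  by (simp add: prime_comm_ideal_def comm_ideal_def)

text \<open>The ideal \<open>m + Rs\<close> properly contains \<open>m\<close>, hence is the whole
  ring.\<close>

lemma maximal_ideal_inverse: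
  assumes "maximal_ideal m" "s \<notin> m"
  shows "\<exists>t. 1 - t * s \<in> m"
proof -
  have m: "comm_ideal m" using assms(1) by (simp add: maximal_ideal_def)
  let ?J = "{x. \<exists>t. x - t * s \<in> m}"
  have "comm_ideal ?J" unfolding comm_ideal_def
  proof (intro conjI ballI allI)
    show "0 \<in> ?J" using comm_idealD(1)[OF m] by (auto intro: exI[of _ 0])
    show "a + b \<in> ?J" if ab: "a \<in> ?J" "b \<in> ?J" for a b
    proof -
      obtain t u where "a - t * s \<in> m" "b - u * s \<in> m" using ab by auto
      from comm_idealD(2)[OF m this] have "a + b - (t + u) * s \<in> m" by (simp add: algebra_simps)
      then show ?thesis by blast
    qed
    show "r * a \<in> ?J" if a: "a \<in> ?J" for a r
    proof -
      obtain t where "a - t * s \<in> m" using a by auto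
      from comm_idealD(3)[OF m this, of r] have "r * a - (r * t) * s \<in> m" by (simp add: algebra_simps)
      then show ?thesis by blast
    qed
  qed
  moreover have "m \<subseteq> ?J" by (auto intro: exI[of _ 0])
  moreover have "s \<in> ?J" using comm_idealD(1)[OF m] by (auto intro: exI[of _ 1])
  ultimately have "?J = UNIV" using assms unfolding maximal_ideal_def by blast
  then show ?thesis by blast
qed

lemma maximal_ideal_prime:
  assumes "maximal_ideal m"
  shows "prime_comm_ideal m"
proof -
  have m: "comm_ideal m" "m \<noteq> UNIV" using assms by (auto simp: maximal_ideal_def)
  have one: "1 \<notin> m" using m comm_idealD(3)[OF m(1), of 1] by auto
  have "b \<in> m" if "a * b \<in> m" "a \<notin> m" for a b
  proof -
    obtain t where "1 - t * a \<in> m" using maximal_ideal_inverse[OF assms \<open>a \<notin> m\<close>] by blast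
    from comm_idealD(2)[OF m(1) comm_idealD(4)[OF m(1) this, of b] comm_idealD(3)[OF m(1) that(1), of t]]
    show ?thesis by (simp add: algebra_simps)
  qed
  then show ?thesis using m one unfolding prime_comm_ideal_def by blast
qed

lemma prime_prod_notin:
  assumes "prime_comm_ideal p" "finite I" "\<And>i. i \<in> I \<Longrightarrow> f i \<notin> p"
  shows "(\<Prod>i\<in>I. f i) \<notin> p"
  using assms(2,3) by (induction I rule: finite_induct) (use assms(1) in \<open>auto simp: prime_comm_ideal_def\<close>)

lemma proper_ideal_in_maximal:
  assumes "comm_ideal I" "1 \<notin> (I :: 'r::comm_ring_1 set)"
  shows "\<exists>m. maximal_ideal m \<and> I \<subseteq> m"
proof -
  let ?P = "{J. comm_ideal J \<and> I \<subseteq> J \<and> 1 \<notin> J}"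
  have "\<exists>M\<in>?P. \<forall>X\<in>?P. M \<subseteq> X \<longrightarrow> X = M"
  proof (rule subset_Zorn_nonempty)
    show "?P \<noteq> {}" using assms by blast
    fix C assume C: "C \<noteq> {}" "subset.chain ?P C"
    have "comm_ideal (\<Union>C)" unfolding comm_ideal_def
    proof (intro conjI ballI allI)
      show "0 \<in> \<Union>C" using C by (auto simp: subset_chain_def comm_ideal_def)
      show "a + b \<in> \<Union>C" if ab: "a \<in> \<Union>C" "b \<in> \<Union>C" for a b
      proof -
        obtain X Y where XY: "X \<in> C" "Y \<in> C" "a \<in> X" "b \<in> Y" using ab by blast
        then have "X \<subseteq> Y \<or> Y \<subseteq> X" "comm_ideal X" "comm_ideal Y" using C by (auto simp: subset_chain_def)
        then show ?thesis using XY unfolding comm_ideal_def by blast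
      qed
      show "r * a \<in> \<Union>C" if "a \<in> \<Union>C" for a r
      proof -
        obtain X where "X \<in> C" "a \<in> X" using \<open>a \<in> \<Union>C\<close> by blast
        moreover from this have "comm_ideal X" using C by (auto simp: subset_chain_def)
        ultimately show ?thesis using comm_idealD(3)[of X a r] by blast
      qed
    qed
    then show "\<Union>C \<in> ?P" using C by (auto simp: subset_chain_def)
  qed
  then obtain m where "m \<in> ?P" and max: "\<forall>X\<in>?P. m \<subseteq> X \<longrightarrow> X = m" by (rule bexE)
  then have m: "comm_ideal m" "I \<subseteq> m" "1 \<notin> m" by auto
  have "maximal_ideal m" unfolding maximal_ideal_def
  proof (intro conjI allI impI)
    show "m \<noteq> UNIV" using m by blast
    fix J assume J: "comm_ideal J \<and> m \<subseteq> J"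
    show "J = m \<or> J = UNIV"
    proof (cases "1 \<in> J")
      case True
      then have "x \<in> J" for x using J comm_idealD(3)[of J 1 x] by simp
      then show ?thesis by blast
    next
      case False
      then have "J \<in> ?P" using J m(2) by auto
      then show ?thesis using max J by simp
    qed
  qed (rule m)
  then show ?thesis using m by blast
qed

text \<open>For each other ideal take an element of it outside \<open>m\<close>; the product works
  because \<open>m\<close> is prime. These products are the Chinese remainder coefficients for
  gluing local splittings.\<close>

lemma maximal_ideals_separating:
  assumes "finite S" "\<And>m. m \<in> S \<Longrightarrow> maximal_ideal m" "m \<in> S"
  shows "\<exists>c. c \<notin> m \<and> (\<forall>n\<in>S - {m}. c \<in> n)"
proof -
  have "\<exists>x. x \<in> n \<and> x \<notin> m" if "n \<in> S - {m}" for n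
    using assms(2)[of n] assms(2)[of m] that assms(3) unfolding maximal_ideal_def by blast
  then obtain x where x: "\<And>n. n \<in> S - {m} \<Longrightarrow> x n \<in> n \<and> x n \<notin> m" by metis
  have "(\<Prod>n\<in>S - {m}. x n) \<in> n" if "n \<in> S - {m}" for n
  proof -
    have n: "comm_ideal n" using assms(2)[of n] that by (auto simp: maximal_ideal_def)
    show ?thesis using prod.remove[OF _ that, of x] assms(1) comm_idealD(4)[OF n] x[OF that] by simp
  qed
  moreover have "(\<Prod>n\<in>S - {m}. x n) \<notin> m"
    by (rule prime_prod_notin[OF maximal_ideal_prime[OF assms(2)[OF assms(3)]]]) (use assms(1) x in blast)+
  ultimately show ?thesis by blast
qed

text \<open>Gaussian elimination over \<open>R/p\<close> without division, for more unknowns than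
  equations. With \<open>p = 0\<close> it yields linear dependence over the field of fractions, with
  a maximal ideal over the residue field.\<close>

lemma linear_system_nontrivial_mod_prime:
  fixes a :: "'i \<Rightarrow> 'j \<Rightarrow> 'r::comm_ring_1"
  assumes p: "prime_comm_ideal p" and "finite J" "finite K" "card J < card K"
  shows "\<exists>r. (\<exists>i\<in>K. r i \<notin> p) \<and> (\<forall>j\<in>J. (\<Sum>i\<in>K. r i * a i j) \<in> p)"
  using assms(2-4)
proof (induction J arbitrary: K a rule: finite_induct)
  case empty
  then have "K \<noteq> {}" by auto
  then show ?case using p by (intro exI[of _ "\<lambda>_. 1"]) (auto simp: prime_comm_ideal_def)
next
  case (insert j J)
  have pI: "comm_ideal p" and pp: "\<And>a b. a * b \<in> p \<Longrightarrow> a \<in> p \<or> b \<in> p"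
    using p by (auto simp: prime_comm_ideal_def)
  show ?case
  proof (cases "\<forall>i\<in>K. a i j \<in> p")
    case True
    obtain r where r: "\<exists>i\<in>K. r i \<notin> p" "\<forall>j\<in>J. (\<Sum>i\<in>K. r i * a i j) \<in> p"
      using insert.IH[of K a] insert.prems insert.hyps by auto
    have "(\<Sum>i\<in>K. r i * a i j) \<in> p" using True by (intro comm_ideal_sum[OF pI] comm_idealD(3)[OF pI]) auto
    then show ?thesis using r by blast
  next
    case False
    then obtain k where k: "k \<in> K" "a k j \<notin> p" by blast
    define t where "t = a k j"
    define K' where "K' = K - {k}"
    have K': "finite K'" "card J < card K'"
      using insert.prems insert.hyps k by (auto simp: K'_def)
    obtain r where r: "\<exists>i\<in>K'. r i \<notin> p" "\<forall>l\<in>J. (\<Sum>i\<in>K'. r i * (t * a i l - a i j * a k l)) \<in> p"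
      using insert.IH[OF K', of "\<lambda>i l. t * a i l - a i j * a k l"] by auto
    \<comment> \<open>The other unknowns are multiplied by the pivot \<open>t\<close> instead of
      dividing by it, and the pivot unknown makes equation \<open>j\<close> hold exactly. As
      \<open>t\<close> lies outside the prime \<open>p\<close>, the solution stays
      non-trivial.\<close>
    define r' where "r' i = (if i = k then - (\<Sum>i\<in>K'. r i * a i j) else t * r i)" for i
    have sum: "(\<Sum>i\<in>K. r' i * a i l) = (\<Sum>i\<in>K'. r i * (t * a i l - a i j * a k l))" for l
    proof -
      have "(\<Sum>i\<in>K. r' i * a i l) = r' k * a k l + (\<Sum>i\<in>K'. r' i * a i l)"
        unfolding K'_def using k insert.prems by (intro sum.remove) auto
      also have "(\<Sum>i\<in>K'. r' i * a i l) = (\<Sum>i\<in>K'. t * r i * a i l)"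
        by (intro sum.cong) (auto simp: r'_def K'_def)
      finally have "(\<Sum>i\<in>K. r' i * a i l) = - (\<Sum>i\<in>K'. r i * a i j) * a k l + (\<Sum>i\<in>K'. t * r i * a i l)"
        by (simp add: r'_def)
      also have "\<dots> = (\<Sum>i\<in>K'. t * r i * a i l) - (\<Sum>i\<in>K'. r i * a i j * a k l)"
        by (simp add: sum_distrib_right[symmetric])
      also have "\<dots> = (\<Sum>i\<in>K'. r i * (t * a i l - a i j * a k l))"
        unfolding sum_subtractf[symmetric] by (intro sum.cong refl) (simp add: algebra_simps)
      finally show ?thesis .
    qed
    have "(\<Sum>i\<in>K. r' i * a i j) = 0" unfolding sum by (simp add: t_def algebra_simps)
    then have "\<forall>l\<in>insert j J. (\<Sum>i\<in>K. r' i * a i l) \<in> p"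
      using r(2) comm_idealD(1)[OF pI] by (simp add: sum)
    moreover obtain i where i: "i \<in> K'" "r i \<notin> p" using r(1) by blast
    then have "r' i \<notin> p" using pp[of t "r i"] k(2) by (auto simp: r'_def K'_def t_def)
    then have "\<exists>i\<in>K. r' i \<notin> p" using i(1) by (auto simp: K'_def)
    ultimately show ?thesis by blast
  qed
qed

section \<open>Nakayama and local invertibility\<close>

locale algebra_module =
  fixes phi :: "'r::idom \<Rightarrow> 'l::ring_1" and act :: "'a::ab_group_add \<Rightarrow> 'l \<Rightarrow> 'a"
  assumes algebra: "R_algebra phi" and module_act: "rmodule act"
begin

lemma phi_simps: "phi 1 = 1" "phi (a + b) = phi a + phi b" "phi (a * b) = phi a * phi b"
  and phi_central: "phi a * x = x * phi a"
  using algebra unfolding R_algebra_def by blast+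

lemma act_simps [simp]:
  "act (x + y) a = act x a + act y a" "act x (a + b) = act x a + act x b"
  "act x 1 = x"
  using module_act by (auto simp: rmodule_def)

lemma act_mult: "act x (a * b) = act (act x a) b"
  using module_act by (auto simp: rmodule_def)

lemma act_zero [simp]: "act x 0 = 0" "act 0 a = 0"
  using act_simps(2)[of x 0 0] act_simps(1)[of 0 0 a] by simp_all

lemma act_minus [simp]: "act (- x) a = - act x a" "act x (- a) = - act x a"
  using act_simps(1)[of x "- x" a] act_simps(2)[of x a "- a"] by (simp_all add: eq_neg_iff_add_eq_0 add.commute)

lemma act_diff [simp]: "act (x - y) a = act x a - act y a" "act x (a - b) = act x a - act x b"
  using act_simps(1)[of x "- y" a] act_simps(2)[of x a "- b"] by simp_all

lemma act_sum_left: "act (\<Sum>i\<in>I. x i) a = (\<Sum>i\<in>I. act (x i) a)"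
  by (induction I rule: infinite_finite_induct) auto

lemma act_sum_right: "act x (\<Sum>i\<in>I. a i) = (\<Sum>i\<in>I. act x (a i))"
  by (induction I rule: infinite_finite_induct) auto

definition smul :: "'r \<Rightarrow> 'a \<Rightarrow> 'a" (infixr "\<cdot>" 75) where "r \<cdot> x = act x (phi r)"

sublocale R: module smul
proof
  show "smul a (smul b x) = smul (a * b) x" for a b x
    by (simp add: smul_def act_mult[symmetric] phi_simps(3)[symmetric] mult.commute)
qed (simp_all add: smul_def phi_simps)

lemma smul_act: "r \<cdot> act x a = act (r \<cdot> x) a"
  unfolding smul_def act_mult[symmetric] phi_central[of r a] ..

lemma act_phi_mult: "act x (phi r * a) = r \<cdot> act x a"
  by (simp add: smul_act) (simp add: smul_def act_mult)

end

locale torsion_free_module = algebra_module phi act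
  for phi :: "'r::idom \<Rightarrow> 'l::ring_1" and act :: "'a::ab_group_add \<Rightarrow> 'l \<Rightarrow> 'a" +
  assumes torsion_free: "r \<noteq> 0 \<Longrightarrow> act x (phi r) = 0 \<Longrightarrow> x = 0"
begin

lemma smul_cancel: "r \<noteq> 0 \<Longrightarrow> r \<cdot> x = r \<cdot> y \<Longrightarrow> x = y"
  using torsion_free[of r "x - y"] by (simp add: smul_def)

lemma smul_eq_0: "r \<noteq> 0 \<Longrightarrow> r \<cdot> x = 0 \<Longrightarrow> x = 0"
  using torsion_free[of r x] by (simp add: smul_def)

definition lin :: "'a endo \<Rightarrow> bool" where
  "lin f \<longleftrightarrow> (\<forall>x a. app f (act x a) = act (app f x) a)"

lemma linD: "lin f \<Longrightarrow> app f (act x a) = act (app f x) a"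
  by (simp add: lin_def)

lemma lin_smul: "lin f \<Longrightarrow> app f (r \<cdot> x) = r \<cdot> app f x"
  by (simp add: smul_def linD)

text \<open>Scalars as elements of the endomorphism ring. They are linear because \<open>phi\<close>
  is central and commute with all linear maps, so they can serve as denominators in local and
  generic identities.\<close>

lift_definition sc :: "'r \<Rightarrow> 'a endo" is "\<lambda>r x. act x (phi r)" by simp

lemma app_sc [simp]: "app (sc r) x = r \<cdot> x"
  by (simp add: sc.rep_eq smul_def)

lemma lin_closed [simp, intro]:
  "lin 0" "lin 1" "lin (sc r)" "lin f \<Longrightarrow> lin g \<Longrightarrow> lin (f + g)" "lin f \<Longrightarrow> lin g \<Longrightarrow> lin (f - g)"
  "lin f \<Longrightarrow> lin g \<Longrightarrow> lin (f * g)"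
  by (simp_all add: lin_def smul_act)

lemma lin_sum: "(\<And>i. i \<in> I \<Longrightarrow> lin (f i)) \<Longrightarrow> lin (\<Sum>i\<in>I. f i)"
  by (induction I rule: infinite_finite_induct) auto

lemma lin_power [simp, intro]: "lin f \<Longrightarrow> lin (f ^ n)"
  by (induction n) auto

lemma sc_simps: "sc 0 = 0" "sc 1 = 1" "sc (r + s) = sc r + sc s" "sc (r - s) = sc r - sc s" "sc (r * s) = sc r * sc s"
  by (rule endo_eqI; simp add: R.scale_left_distrib R.scale_left_diff_distrib)+

lemma sc_comm: "lin f \<Longrightarrow> f * sc r = sc r * f" "lin f \<Longrightarrow> f * (sc r * g) = sc r * (f * g)"
  by (rule endo_eqI; simp add: lin_smul)+

text \<open>Finite generation over the base ring and not over the algebra: Nakayama and the counting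
  of linear relations take place there. The generators are fixed by \<open>e\<close>, hence lie in
  its image.\<close>

definition fgen :: "'a endo \<Rightarrow> bool" where
  "fgen e \<longleftrightarrow> (\<exists>G. finite G \<and> (\<forall>g\<in>G. app e g = g) \<and> (\<forall>x. \<exists>c. app e x = (\<Sum>g\<in>G. c g \<cdot> g)))"

text \<open>The product of the ideal \<open>m\<close> with the image of \<open>e\<close>, defined
  without a choice of generators. A map with values in it is zero on the fibre at
  \<open>m\<close>.\<close>

inductive_set mpart :: "'r set \<Rightarrow> 'a endo \<Rightarrow> 'a set" for m e where
  mpart_zero: "0 \<in> mpart m e"
| mpart_step: "r \<in> m \<Longrightarrow> y \<in> mpart m e \<Longrightarrow> r \<cdot> app e x + y \<in> mpart m e"

lemma mpart_add: "x \<in> mpart m e \<Longrightarrow> y \<in> mpart m e \<Longrightarrow> x + y \<in> mpart m e"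
  by (induction rule: mpart.induct) (auto simp: add.assoc intro: mpart_step)

lemma mpart_base: "r \<in> m \<Longrightarrow> r \<cdot> app e x \<in> mpart m e"
  using mpart_step[OF _ mpart_zero, of r m e x] by simp

lemma mpart_app:
  assumes "x \<in> mpart m e" "lin f" "e * f = f" "f * e = f"
  shows "app f x \<in> mpart m e"
  using assms(1)
proof (induction rule: mpart.induct)
  case (mpart_step r y x)
  have "app f (r \<cdot> app e x) = r \<cdot> app f (app e x)" by (rule lin_smul[OF assms(2)])
  also have "\<dots> = r \<cdot> app (e * f) x" using assms(3,4) by (metis endo_app(6))
  finally show ?case using mpart.mpart_step[OF mpart_step(1,3)] by simp
qed (simp add: mpart_zero)

lemma mpart_smul: "x \<in> mpart m e \<Longrightarrow> lin e \<Longrightarrow> r \<cdot> x \<in> mpart m e"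
proof (induction rule: mpart.induct)
  case (mpart_step s y x)
  have "r \<cdot> s \<cdot> app e x = s \<cdot> app e (r \<cdot> x)"
    using mpart_step by (simp add: lin_smul mult.commute)
  then show ?case using mpart_step mpart.mpart_step[of s m "r \<cdot> y" e "r \<cdot> x"] by (simp add: R.scale_right_distrib)
qed (simp add: mpart_zero)

lemma mpart_diff:
  assumes "lin e" "x \<in> mpart m e" "y \<in> mpart m e"
  shows "x - y \<in> mpart m e"
  using mpart_add[OF assms(2) mpart_smul[OF assms(3,1), of "-1"]] by simp

lemma mpart_sum: "(\<And>i. i \<in> I \<Longrightarrow> x i \<in> mpart m e) \<Longrightarrow> (\<Sum>i\<in>I. x i) \<in> mpart m e"
  by (induction I rule: infinite_finite_induct) (auto intro: mpart_zero mpart_add)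

lemma mpart_coeffs:
  assumes "y \<in> mpart m e" "comm_ideal m" "finite G" "\<And>x. \<exists>c. app e x = (\<Sum>g\<in>G. c g \<cdot> g)"
  shows "\<exists>c. (\<forall>g. c g \<in> m) \<and> y = (\<Sum>g\<in>G. c g \<cdot> g)"
  using assms(1)
proof (induction rule: mpart.induct)
  case mpart_zero
  show ?case using comm_idealD(1)[OF assms(2)] by (intro exI[of _ "\<lambda>_. 0"]) simp
next
  case (mpart_step r y x)
  obtain c where c: "\<forall>g. c g \<in> m" "y = (\<Sum>g\<in>G. c g \<cdot> g)" using mpart_step by blast
  obtain d where d: "app e x = (\<Sum>g\<in>G. d g \<cdot> g)" using assms(4) by blast
  have "r \<cdot> app e x + y = (\<Sum>g\<in>G. (r * d g + c g) \<cdot> g)"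
    unfolding c(2) d by (simp add: R.scale_sum_right R.scale_left_distrib sum.distrib)
  moreover have "\<forall>g. r * d g + c g \<in> m"
    using mpart_step(1) c(1) comm_idealD(2,4)[OF assms(2)] by blast
  ultimately show ?case by (intro exI[of _ "\<lambda>g. r * d g + c g"]) blast
qed

text \<open>Nakayama's lemma with denominators. A multiple of each generator lies in
  \<open>Y\<close> modulo combinations with coefficients in \<open>p\<close>; the generators are
  eliminated one at a time, since the multiplier \<open>s - c x\<close> of the eliminated one stays
  outside \<open>p\<close>.\<close>

lemma nakayama:
  assumes p: "prime_comm_ideal p" and "finite G"
    and Y: "\<And>x y. x \<in> Y \<Longrightarrow> y \<in> Y \<Longrightarrow> x + y \<in> Y" "\<And>r x. x \<in> Y \<Longrightarrow> r \<cdot> x \<in> Y"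
    and gen: "\<And>g. g \<in> G \<Longrightarrow> \<exists>s c. s \<notin> p \<and> (\<forall>h. c h \<in> p) \<and> s \<cdot> g - (\<Sum>h\<in>G. c h \<cdot> h) \<in> Y"
  shows "\<exists>s. s \<notin> p \<and> (\<forall>g\<in>G. s \<cdot> g \<in> Y)"
  using assms(2) gen
proof (induction G rule: finite_induct)
  case empty
  then show ?case using p by (auto simp: prime_comm_ideal_def)
next
  case (insert x G)
  have pI: "comm_ideal p" and pp: "\<And>a b. a \<notin> p \<Longrightarrow> b \<notin> p \<Longrightarrow> a * b \<notin> p"
    using p by (auto simp: prime_comm_ideal_def)
  obtain s c where sc: "s \<notin> p" "\<And>h. c h \<in> p" "s \<cdot> x - (\<Sum>h\<in>insert x G. c h \<cdot> h) \<in> Y"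
    using insert.prems[of x] by blast
  define s' where "s' = s - c x"
  have s': "s' \<notin> p" using sc comm_idealD(2)[OF pI, of s' "c x"] by (auto simp: s'_def)
  define y where "y = s' \<cdot> x - (\<Sum>h\<in>G. c h \<cdot> h)"
  have y: "y \<in> Y" using sc(3) insert.hyps unfolding y_def s'_def by (simp add: R.scale_left_diff_distrib algebra_simps)
  have "\<exists>t d. t \<notin> p \<and> (\<forall>h. d h \<in> p) \<and> t \<cdot> g - (\<Sum>h\<in>G. d h \<cdot> h) \<in> Y" if g: "g \<in> G" for g
  proof -
    obtain t d where td: "t \<notin> p" "\<And>h. d h \<in> p" "t \<cdot> g - (\<Sum>h\<in>insert x G. d h \<cdot> h) \<in> Y"
      using insert.prems[of g] g by blast
    \<comment> \<open>The summand \<open>d x \<cdot> y\<close> cancels the occurrence of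
      \<open>x\<close>, which leaves a relation among the elements of \<open>G\<close>
      alone.\<close>
    have "s' \<cdot> (t \<cdot> g - (\<Sum>h\<in>insert x G. d h \<cdot> h)) + d x \<cdot> y \<in> Y" using Y td(3) y by blast
    also have "s' \<cdot> (t \<cdot> g - (\<Sum>h\<in>insert x G. d h \<cdot> h)) + d x \<cdot> y =
       (s' * t) \<cdot> g - (\<Sum>h\<in>G. (d x * c h + s' * d h) \<cdot> h)"
      unfolding y_def using insert.hyps
      by (simp add: R.scale_sum_right R.scale_right_diff_distrib R.scale_right_distrib R.scale_left_distrib
          sum.distrib mult.commute algebra_simps)
    finally show ?thesis using pp[OF s' td(1)] sc(2) td(2) comm_idealD(2,3)[OF pI]
      by (intro exI[of _ "s' * t"] exI[of _ "\<lambda>h. d x * c h + s' * d h"]) blast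
  qed
  then obtain t where t: "t \<notin> p" "\<And>g. g \<in> G \<Longrightarrow> t \<cdot> g \<in> Y" using insert.IH by blast
  have "(\<Sum>h\<in>G. c h \<cdot> t \<cdot> h) + t \<cdot> y \<in> Y"
  proof -
    have "(\<Sum>h\<in>F. c h \<cdot> t \<cdot> h) + t \<cdot> y \<in> Y" if "F \<subseteq> G" for F
      using finite_subset[OF that insert.hyps(1)] that
    proof (induction F rule: finite_induct)
      case empty
      then show ?case using Y(2)[OF y] by simp
    next
      case (insert a F)
      then show ?case using Y(1)[OF Y(2)[OF t(2)[of a], of "c a"] insert.IH] by (simp add: add.assoc)
    qed
    then show ?thesis by blast
  qed
  also have "(\<Sum>h\<in>G. c h \<cdot> t \<cdot> h) + t \<cdot> y = (t * s') \<cdot> x"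
    unfolding y_def by (simp add: R.scale_right_diff_distrib R.scale_sum_right mult.commute)
  finally have "(t * s') \<cdot> x \<in> Y" .
  moreover have "(t * s') \<cdot> g \<in> Y" if "g \<in> G" for g using Y(2)[OF t(2)[OF that], of s'] by (simp add: mult.commute)
  ultimately show ?case using pp[OF t(1) s'] by blast
qed

text \<open>Iterated preimages of a nonzero kernel vector would be linearly independent.\<close>

lemma injective_if_almost_surjective:
  assumes fg: "fgen e" and lw: "lin w" "e * w = w"
    and s: "s \<noteq> 0" "\<And>x. \<exists>z. app e z = z \<and> s \<cdot> app e x = app w z" and x: "app e x = x" "app w x = 0"
  shows "x = 0"
proof -
  obtain G where G: "finite G" "\<And>g. g \<in> G \<Longrightarrow> app e g = g" "\<And>x. \<exists>c. app e x = (\<Sum>g\<in>G. c g \<cdot> g)"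
    using fg unfolding fgen_def by blast
  obtain z where z: "\<And>y. app e (z y) = z y" "\<And>y. s \<cdot> app e y = app w (z y)" using s(2) by metis
  define X where "X n = (z ^^ n) x" for n
  have eX: "app e (X n) = X n" for n unfolding X_def by (cases n) (auto simp: x(1) z(1))
  have wX: "app w (X (Suc n)) = s \<cdot> X n" for n using z(2)[of "X n"] eX[of n] by (simp add: X_def)
  have wk: "app (w ^ k) (X (k + j)) = s ^ k \<cdot> X j" for k j
  proof (induction k arbitrary: j)
    case (Suc k)
    have "app (w ^ Suc k) (X (Suc k + j)) = app (w ^ k) (app w (X (Suc (k + j))))" by (simp add: power_Suc2 del: power_Suc)
    also have "\<dots> = s \<cdot> s ^ k \<cdot> X j" using wX Suc lw(1) by (simp add: lin_smul)
    finally show ?case by simp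
  qed simp
  have "\<forall>n. \<exists>c. X n = (\<Sum>g\<in>G. c g \<cdot> g)" using G(3)[of "X n" for n] eX by simp
  then obtain a where a: "\<And>n. X n = (\<Sum>g\<in>G. a n g \<cdot> g)" by (elim choice[THEN exE]) blast
  \<comment> \<open>One vector more than there are generators forces a relation. For its last index
    \<open>n\<close>, the map \<open>w ^ n\<close> kills the earlier terms and leaves a non-zero
    scalar times \<open>x\<close>.\<close>
  obtain r where r: "\<exists>i\<in>{..card G}. r i \<noteq> 0" "\<And>g. g \<in> G \<Longrightarrow> (\<Sum>i\<le>card G. r i * a i g) = 0"
    using linear_system_nontrivial_mod_prime[OF prime_zero_ideal G(1), of "{..card G}" a] by auto
  have zero: "(\<Sum>i\<le>card G. r i \<cdot> X i) = 0"
  proof -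
    have "(\<Sum>i\<le>card G. r i \<cdot> X i) = (\<Sum>i\<le>card G. \<Sum>g\<in>G. (r i * a i g) \<cdot> g)"
      by (simp add: a R.scale_sum_right)
    also have "\<dots> = (\<Sum>g\<in>G. (\<Sum>i\<le>card G. r i * a i g) \<cdot> g)"
      by (subst sum.swap) (simp add: R.scale_sum_left)
    finally show ?thesis using r(2) by simp
  qed
  define n where "n = Max {i \<in> {..card G}. r i \<noteq> 0}"
  have "n \<in> {i \<in> {..card G}. r i \<noteq> 0}" unfolding n_def using r(1) by (intro Max_in) auto
  then have n: "n \<le> card G" "r n \<noteq> 0" by auto
  have big: "r i = 0" if "i > n" "i \<le> card G" for i
    using that Max_ge[of "{i \<in> {..card G}. r i \<noteq> 0}" i] unfolding n_def by fastforce
  have "app (w ^ n) (r i \<cdot> X i) = (if i = n then r n \<cdot> s ^ n \<cdot> x else 0)" if "i \<le> card G" for i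
  proof (cases "i < n")
    case True
    then obtain k where k: "n = Suc k + i" by (metis add.commute less_imp_Suc_add add_Suc_right)
    have "app (w ^ n) (X i) = app (w ^ Suc k) (app (w ^ i) (X (i + 0)))" unfolding k power_add by simp
    also have "\<dots> = app (w ^ Suc k) (s ^ i \<cdot> x)" unfolding wk by (simp add: X_def)
    also have "\<dots> = s ^ i \<cdot> app (w ^ k) (app w x)" by (subst lin_smul) (use lw(1) in \<open>auto simp: power_Suc2 simp del: power_Suc\<close>)
    finally show ?thesis using True x(2) lw(1) by (simp add: lin_smul)
  next
    case False
    show ?thesis
    proof (cases "i = n")
      case True
      then show ?thesis using wk[of n 0] lw(1) by (simp add: lin_smul X_def)
    next
      case False
      with \<open>\<not> i < n\<close> show ?thesis using big[of i] that by simp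
    qed
  qed
  then have "app (w ^ n) (\<Sum>i\<le>card G. r i \<cdot> X i) = (\<Sum>i\<le>card G. if i = n then r n \<cdot> s ^ n \<cdot> x else 0)"
    unfolding app_sum by (intro sum.cong) auto
  then have "r n \<cdot> s ^ n \<cdot> x = 0" using zero n(1) by simp
  then show ?thesis using smul_eq_0 n(2) s(1) by (metis power_not_zero)
qed

text \<open>Nakayama yields one \<open>t\<close> outside \<open>m\<close> that multiplies the image
  of \<open>e\<close> into that of \<open>w\<close>. Then \<open>w\<close> is injective on the image
  of \<open>e\<close> by \<open>injective_if_almost_surjective\<close>, so preimages of
  \<open>t x\<close> are unique and form a linear map.\<close>

lemma local_inverse:
  assumes m: "prime_comm_ideal m" and e: "lin e" "e * e = e" "fgen e" and w: "lin w" "e * w = w" "w * e = w"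
    and u: "u \<notin> m" "\<And>x. \<exists>z. u \<cdot> app e x - app w z \<in> mpart m e"
  shows "\<exists>t g. t \<notin> m \<and> lin g \<and> e * g = g \<and> g * e = g \<and> w * g = sc t * e \<and> g * w = sc t * e"
proof -
  have mI: "comm_ideal m" using m by (simp add: prime_comm_ideal_def)
  obtain G where G: "finite G" "\<And>g. g \<in> G \<Longrightarrow> app e g = g" "\<And>x. \<exists>c. app e x = (\<Sum>g\<in>G. c g \<cdot> g)"
    using e(3) unfolding fgen_def by blast
  let ?Y = "range (app w)"
  have "\<exists>s. s \<notin> m \<and> (\<forall>g\<in>G. s \<cdot> g \<in> ?Y)"
  proof (rule nakayama[OF m G(1)])
    show "x + y \<in> ?Y" if "x \<in> ?Y" "y \<in> ?Y" for x y
      using that by (auto simp: app_add[symmetric] simp del: app_add)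
    show "r \<cdot> x \<in> ?Y" if "x \<in> ?Y" for r x using that by (auto simp: lin_smul[OF w(1), symmetric])
    fix g assume g: "g \<in> G"
    obtain z where "u \<cdot> g - app w z \<in> mpart m e" using u(2)[of g] G(2)[OF g] by auto
    from mpart_coeffs[OF this mI G(1,3)] obtain c where "\<forall>g. c g \<in> m" "u \<cdot> g - app w z = (\<Sum>h\<in>G. c h \<cdot> h)" by blast
    moreover from this have "u \<cdot> g - (\<Sum>h\<in>G. c h \<cdot> h) = app w z" by (simp add: algebra_simps)
    ultimately show "\<exists>s c. s \<notin> m \<and> (\<forall>h. c h \<in> m) \<and> s \<cdot> g - (\<Sum>h\<in>G. c h \<cdot> h) \<in> ?Y" using u(1) by blast
  qed
  then obtain t where t: "t \<notin> m" "\<And>g. g \<in> G \<Longrightarrow> \<exists>y. t \<cdot> g = app w y" by blast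
  then obtain y where y: "\<And>g. g \<in> G \<Longrightarrow> t \<cdot> g = app w (y g)" by metis
  have ex: "\<exists>z. app e z = z \<and> t \<cdot> app e x = app w z" for x
  proof -
    obtain c where c: "app e x = (\<Sum>g\<in>G. c g \<cdot> g)" using G(3) by blast
    define z where "z = (\<Sum>g\<in>G. c g \<cdot> y g)"
    have "t \<cdot> app e x = (\<Sum>g\<in>G. c g \<cdot> t \<cdot> g)" unfolding c by (simp add: R.scale_sum_right mult.commute)
    also have "\<dots> = app w z" unfolding z_def app_sum using y by (intro sum.cong) (auto simp: lin_smul[OF w(1)])
    also have "\<dots> = app w (app e z)" using w(3) by (metis endo_app(6))
    finally show ?thesis using e(2) by (metis endo_app(6))
  qed
  have t0: "t \<noteq> 0" using t(1) comm_idealD(1)[OF mI] by auto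
  have inj: "z = z'" if "app e z = z" "app e z' = z'" "app w z = app w z'" for z z'
    using injective_if_almost_surjective[OF e(3) w(1,2) t0 ex, of "z - z'"] that by simp
  obtain g where g: "\<And>x. app e (g x) = g x" "\<And>x. t \<cdot> app e x = app w (g x)" using ex by metis
  have g_add: "g (x + y) = g x + g y" for x y
    by (rule inj) (simp_all add: g(1) g(2)[symmetric] R.scale_right_distrib)
  define h where "h = Endo g"
  have h: "app h = g" unfolding h_def using g_add by (rule app_Endo)
  have eh: "e * h = h" by (rule endo_eqI) (simp add: h g(1))
  have wh: "w * h = sc t * e" by (rule endo_eqI) (simp add: h g(2))
  have "g (act x a) = act (g x) a" for x a
  proof (rule inj)
    show "app e (g (act x a)) = g (act x a)" "app e (act (g x) a) = act (g x) a"
      using e(1) g(1) by (simp_all add: linD)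
    show "app w (g (act x a)) = app w (act (g x) a)"
      using g(2)[symmetric] e(1) w(1) by (simp add: linD smul_act)
  qed
  then have "lin h" unfolding lin_def h by blast
  moreover have "h * e = h"
  proof (rule endo_eqI)
    fix x
    have "app w (g (app e x)) = app w (g x)" using g(2)[symmetric] e(2) by (metis endo_app(6))
    then show "app (h * e) x = app h x" using inj[OF g(1) g(1)] by (simp add: h)
  qed
  moreover have "h * w = sc t * e"
  proof (rule endo_eqI)
    fix x
    have "app w (g (app w x)) = app w (t \<cdot> app e x)"
    proof -
      have "app w (g (app w x)) = t \<cdot> app (e * w) x" by (simp add: g(2)[symmetric])
      also have "\<dots> = app w (t \<cdot> app e x)" using w by (metis endo_app(6) lin_smul)
      finally show ?thesis .
    qed
    moreover have "app e (t \<cdot> app e x) = t \<cdot> app e x" using e by (metis endo_app(6) lin_smul)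
    ultimately have "g (app w x) = t \<cdot> app e x" using inj g(1) by blast
    then show "app (h * w) x = app (sc t * e) x" by (simp add: h)
  qed
  ultimately show ?thesis using t(1) eh wh by blast
qed

end

section \<open>Residual endomorphism rings\<close>

context torsion_free_module
begin

text \<open>The corner at \<open>e\<close> of the ring of linear maps, now as a carrier-based ring:
  the form in which it can be divided by an ideal and \<open>corner_stable_range_one\<close>
  applies.\<close>

definition endo_ring :: "'a endo \<Rightarrow> 'a endo ring" where
  "endo_ring e = \<lparr>carrier = {f. lin f \<and> e * f = f \<and> f * e = f}, mult = (*), one = e, zero = 0, add = (+)\<rparr>"

lemma endo_ring_simps [simp]:
  "carrier (endo_ring e) = {f. lin f \<and> e * f = f \<and> f * e = f}"
  "mult (endo_ring e) = (*)" "one (endo_ring e) = e" "zero (endo_ring e) = 0" "add (endo_ring e) = (+)"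
  by (simp_all add: endo_ring_def)

lemma endo_ring_ring:
  assumes "lin e" "e * e = e"
  shows "ring (endo_ring e)"
proof (rule ringI)
  show "abelian_group (endo_ring e)"
  proof (rule abelian_groupI)
    fix x assume "x \<in> carrier (endo_ring e)"
    then show "\<exists>y\<in>carrier (endo_ring e). y \<oplus>\<^bsub>endo_ring e\<^esub> x = \<zero>\<^bsub>endo_ring e\<^esub>"
      using lin_closed(1) lin_closed(5)[of 0 x] by (intro bexI[of _ "- x"]) auto
  qed (auto simp: algebra_simps)
  show "monoid (endo_ring e)"
    by (rule monoidI) (use assms in \<open>auto simp: mult.assoc\<close>, simp add: mult.assoc[symmetric])
qed (auto simp: algebra_simps)

lemma endo_ring_minus:
  assumes "lin e" "e * e = e" "f \<in> carrier (endo_ring e)" "g \<in> carrier (endo_ring e)"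
  shows "f \<ominus>\<^bsub>endo_ring e\<^esub> g = f - g"
proof -
  interpret ring "endo_ring e" by (rule endo_ring_ring[OF assms(1,2)])
  have "- g \<in> carrier (endo_ring e)" using assms(4) lin_closed(1) lin_closed(5)[of 0 g] by auto
  then have "\<ominus>\<^bsub>endo_ring e\<^esub> g = - g" using assms(4) by (intro minus_equality) auto
  then show ?thesis by (simp add: a_minus_def)
qed

definition residual_ideal :: "'r set \<Rightarrow> 'a endo \<Rightarrow> 'a endo set" where
  "residual_ideal m e = {f \<in> carrier (endo_ring e). \<forall>x. app f x \<in> mpart m e}"

lemma residual_ideal_ideal:
  assumes "lin e" "e * e = e"
  shows "ideal (residual_ideal m e) (endo_ring e)"
proof -
  interpret ring "endo_ring e" by (rule endo_ring_ring[OF assms])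
  show ?thesis
  proof (rule idealI)
    show "subgroup (residual_ideal m e) (add_monoid (endo_ring e))"
    proof (rule group.subgroupI)
      show "Group.group (add_monoid (endo_ring e))" by (rule a_group)
      show "residual_ideal m e \<subseteq> carrier (add_monoid (endo_ring e))" by (auto simp: residual_ideal_def)
      have "0 \<in> residual_ideal m e" by (auto simp: residual_ideal_def mpart_zero)
      then show "residual_ideal m e \<noteq> {}" by blast
      fix f g assume f: "f \<in> residual_ideal m e"
      have nf: "\<zero>\<^bsub>endo_ring e\<^esub> \<ominus>\<^bsub>endo_ring e\<^esub> f = 0 - f"
        using endo_ring_minus[OF assms, of 0 f] f by (auto simp: residual_ideal_def)
      have "inv\<^bsub>add_monoid (endo_ring e)\<^esub> f = \<ominus>\<^bsub>endo_ring e\<^esub> f" by (simp add: a_inv_def)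
      also have "\<dots> = - f" using nf f minus_eq l_zero a_inv_closed unfolding residual_ideal_def
        by (metis (no_types, lifting) diff_0 mem_Collect_eq)
      finally have eq: "inv\<^bsub>add_monoid (endo_ring e)\<^esub> f = - f" .
      show "inv\<^bsub>add_monoid (endo_ring e)\<^esub> f \<in> residual_ideal m e"
        unfolding eq using f lin_closed(5)[of 0 f] mpart_diff[OF assms(1) mpart_zero, of _ m] by (auto simp: residual_ideal_def)
      assume "g \<in> residual_ideal m e"
      then show "f \<otimes>\<^bsub>add_monoid (endo_ring e)\<^esub> g \<in> residual_ideal m e"
        using f by (auto simp: residual_ideal_def distrib_left distrib_right intro: mpart_add)
    qed
    fix f g assume "f \<in> residual_ideal m e" "g \<in> carrier (endo_ring e)"
    then show "g \<otimes>\<^bsub>endo_ring e\<^esub> f \<in> residual_ideal m e" "f \<otimes>\<^bsub>endo_ring e\<^esub> g \<in> residual_ideal m e"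
      by (auto simp: residual_ideal_def mult.assoc intro: mpart_app) (auto simp: mult.assoc[symmetric])
  qed (rule local.ring_axioms)
qed

text \<open>A weak Cayley-Hamilton argument: the powers \<open>c^0, ..., c^N\<close> act as matrices
  with \<open>N = card (G \<times> G)\<close> entries, so a non-trivial combination of them vanishes
  modulo \<open>m\<close>. Dividing by its lowest coefficient outside \<open>m\<close> expresses
  \<open>c^k\<close> by higher powers, and \<open>s\<close> is the polynomial in \<open>c\<close>
  obtained in this way.\<close>

lemma mod_strongly_pi_regular:
  assumes m: "maximal_ideal m" and e: "lin e" "e * e = e" "fgen e" and c: "c \<in> carrier (endo_ring e)"
  shows "\<exists>n. \<exists>s\<in>carrier (endo_ring e). c * s = s * c \<and> c ^ Suc n - c ^ Suc n * c * s \<in> residual_ideal m e"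
proof -
  obtain G where G: "finite G" "\<And>g. g \<in> G \<Longrightarrow> app e g = g" "\<And>x. \<exists>c. app e x = (\<Sum>g\<in>G. c g \<cdot> g)"
    using e(3) unfolding fgen_def by blast
  have c: "lin c" "e * c = c" "c * e = c" using c by auto
  have ce: "e * c ^ i = c ^ i * e" for i
  proof (induction i)
    case (Suc i)
    have "c ^ Suc i * e = c * (e * c ^ i)" using Suc by (simp add: mult.assoc)
    also have "\<dots> = e * c ^ Suc i" using c by (simp add: mult.assoc[symmetric])
    finally show ?case by simp
  qed simp
  have cpe: "app e (app (c ^ i) (app e x)) = app (c ^ i) (app e x)" for i x
    using ce[of i] e(2) by (metis endo_app(6))
  define N where "N = card (G \<times> G)"
  have "\<forall>i g. \<exists>d. app (c ^ i) (app e g) = (\<Sum>h\<in>G. d h \<cdot> h)" using G(3) cpe by metis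
  then obtain a where a: "\<And>i g. app (c ^ i) (app e g) = (\<Sum>h\<in>G. a i g h \<cdot> h)" by metis
  obtain r where r: "\<exists>i\<le>N. r i \<notin> m" "\<And>g h. g \<in> G \<Longrightarrow> h \<in> G \<Longrightarrow> (\<Sum>i\<le>N. r i * a i g h) \<in> m"
    using linear_system_nontrivial_mod_prime[OF maximal_ideal_prime[OF m], of "G \<times> G" "{..N}" "\<lambda>i (g, h). a i g h"] G(1)
    unfolding N_def by auto
  have rel: "(\<Sum>i\<le>N. r i \<cdot> app (c ^ i) (app e x)) \<in> mpart m e" for x
  proof -
    obtain d where d: "app e x = (\<Sum>g\<in>G. d g \<cdot> g)" using G(3) by blast
    have "(\<Sum>i\<le>N. r i \<cdot> app (c ^ i) (app e x)) = (\<Sum>i\<le>N. \<Sum>g\<in>G. r i \<cdot> d g \<cdot> app (c ^ i) (app e g))"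
      unfolding d using c(1) G(2) by (simp add: app_sum lin_smul R.scale_sum_right)
    also have "\<dots> = (\<Sum>g\<in>G. \<Sum>i\<le>N. d g \<cdot> r i \<cdot> app (c ^ i) (app e g))"
      by (subst sum.swap) (simp add: mult.commute)
    also have "\<dots> = (\<Sum>g\<in>G. d g \<cdot> (\<Sum>i\<le>N. \<Sum>h\<in>G. (r i * a i g h) \<cdot> h))"
      unfolding a by (simp add: R.scale_sum_right)
    also have "\<dots> = (\<Sum>g\<in>G. d g \<cdot> (\<Sum>h\<in>G. (\<Sum>i\<le>N. r i * a i g h) \<cdot> app e h))"
      by (subst sum.swap) (simp add: R.scale_sum_left G(2))
    also have "\<dots> \<in> mpart m e" using r(2) e(1) by (intro mpart_sum mpart_smul mpart_base)
    finally show ?thesis .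
  qed
  define k where "k = (LEAST i. r i \<notin> m)"
  obtain i0 where i0: "i0 \<le> N" "r i0 \<notin> m" using r(1) by blast
  have k: "r k \<notin> m" "k \<le> N" and less_k: "\<And>i. i < k \<Longrightarrow> r i \<in> m"
    unfolding k_def using i0 LeastI[of "\<lambda>i. r i \<notin> m" i0] Least_le[of "\<lambda>i. r i \<notin> m" i0] not_less_Least by fastforce+
  obtain t where t: "1 - t * r k \<in> m" using maximal_ideal_inverse[OF m k(1)] by blast
  \<comment> \<open>Modulo \<open>m\<close> the relation starts with \<open>r k c^k\<close>, and
    \<open>t (r k) = 1\<close>. Solving for \<open>c^k\<close> gives \<open>c^k = c^(k+1) s\<close>
    on the image of \<open>e\<close>, with \<open>s = - s0 e\<close>.\<close>
  define s0 where "s0 = (\<Sum>i\<in>{k<..N}. sc (t * r i) * c ^ (i - k - 1))"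
  define s where "s = 0 - s0 * e"
  have ls0: "lin s0" unfolding s0_def using c(1) by (intro lin_sum lin_closed lin_power)
  have ls: "lin s" unfolding s_def using e(1) ls0 by (intro lin_closed)
  have es0: "e * s0 = s0 * e" unfolding s0_def sum_distrib_left sum_distrib_right
    by (intro sum.cong refl) (simp add: sc_comm e(1) ce mult.assoc)
  have s0c: "s0 * c = c * s0" unfolding s0_def sum_distrib_left sum_distrib_right
    by (intro sum.cong refl) (simp add: sc_comm c(1) power_commutes mult.assoc)
  have sE: "s \<in> carrier (endo_ring e)"
  proof -
    have "e * s = s" unfolding s_def using es0 e(2) by (simp add: mult.assoc[symmetric]) (simp add: mult.assoc e(2))
    moreover have "s * e = s" unfolding s_def using e(2) by (simp add: mult.assoc)
    ultimately show ?thesis using ls by simp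
  qed
  have cs: "c * s = s * c"
  proof -
    have "c * (s0 * e) = s0 * (c * e)" using s0c by (simp add: mult.assoc[symmetric])
    also have "\<dots> = (s0 * e) * c" using c by (simp add: mult.assoc)
    finally show ?thesis unfolding s_def by simp
  qed
  have key: "app (c ^ k * e - c ^ k * c * s) x \<in> mpart m e" for x
  proof -
    define z where "z i = app (c ^ i) (app e x)" for i
    have ez: "app e (z i) = z i" for i unfolding z_def by (rule cpe)
    have "c ^ k * c * s = 0 - (\<Sum>i\<in>{k<..N}. sc (t * r i) * c ^ i * e)"
    proof -
      have "c ^ k * c * (sc (t * r i) * c ^ (i - k - 1)) = sc (t * r i) * c ^ i" if "i \<in> {k<..N}" for i
      proof -
        have "c ^ k * c * c ^ (i - k - 1) = c ^ (k + 1 + (i - k - 1))" by (simp add: power_add power_commutes mult.assoc del: add_diff_inverse_nat)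
        also have "k + 1 + (i - k - 1) = i" using that by auto
        finally show ?thesis using c(1) by (simp add: sc_comm mult.assoc)
      qed
      then have "c ^ k * c * s0 = (\<Sum>i\<in>{k<..N}. sc (t * r i) * c ^ i)"
        unfolding s0_def sum_distrib_left by (intro sum.cong) auto
      then have "c ^ k * c * s = 0 - (\<Sum>i\<in>{k<..N}. sc (t * r i) * c ^ i) * e"
        unfolding s_def by (simp add: right_diff_distrib mult.assoc[symmetric])
      then show ?thesis by (simp add: sum_distrib_right)
    qed
    then have "app (c ^ k * e - c ^ k * c * s) x = z k + (\<Sum>i\<in>{k<..N}. (t * r i) \<cdot> z i)"
      by (simp add: app_sum_endo z_def)
    also have "(\<Sum>i\<in>{k<..N}. (t * r i) \<cdot> z i) = t \<cdot> (\<Sum>i\<le>N. r i \<cdot> z i) - t \<cdot> (\<Sum>i<k. r i \<cdot> z i) - (t * r k) \<cdot> z k"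
    proof -
      have "{..N} = {..<k} \<union> {k} \<union> {k<..N}" using k(2) by auto
      then have "(\<Sum>i\<le>N. r i \<cdot> z i) = (\<Sum>i\<in>{..<k} \<union> {k} \<union> {k<..N}. r i \<cdot> z i)" by simp
      also have "\<dots> = (\<Sum>i\<in>{..<k} \<union> {k}. r i \<cdot> z i) + (\<Sum>i\<in>{k<..N}. r i \<cdot> z i)"
        by (rule sum.union_disjoint) auto
      also have "(\<Sum>i\<in>{..<k} \<union> {k}. r i \<cdot> z i) = (\<Sum>i<k. r i \<cdot> z i) + r k \<cdot> z k" by simp
      finally show ?thesis by (simp add: R.scale_right_distrib R.scale_sum_right)
    qed
    also have "z k + (t \<cdot> (\<Sum>i\<le>N. r i \<cdot> z i) - t \<cdot> (\<Sum>i<k. r i \<cdot> z i) - (t * r k) \<cdot> z k)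
       = (1 - t * r k) \<cdot> app e (z k) + t \<cdot> (\<Sum>i\<le>N. r i \<cdot> z i) - t \<cdot> (\<Sum>i<k. r i \<cdot> app e (z i))"
      by (simp add: R.scale_left_diff_distrib ez)
    also have "\<dots> \<in> mpart m e"
    proof -
      have "(\<Sum>i<k. r i \<cdot> app e (z i)) \<in> mpart m e" using less_k by (intro mpart_sum mpart_base) auto
      then show ?thesis
        by (intro mpart_diff[OF e(1)] mpart_add mpart_base[OF t] mpart_smul[OF _ e(1)] rel[of x, folded z_def])
    qed
    finally show ?thesis .
  qed
  have eck: "e * c ^ Suc k = c ^ Suc k" "c ^ Suc k * e = c ^ Suc k"
    using ce[of "Suc k"] c by (simp_all add: mult.assoc[symmetric])
  \<comment> \<open>A further factor \<open>c\<close> makes the exponent positive: for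
    \<open>k = 0\<close> the power \<open>c ^ k\<close> is the identity of the whole module, which
    need not lie in the corner.\<close>
  have "app (c ^ Suc k - c ^ Suc k * c * s) x \<in> mpart m e" for x
  proof -
    have "c * (c ^ k * e - c ^ k * c * s) = c ^ Suc k - c ^ Suc k * c * s"
      using eck(2) by (simp add: right_diff_distrib mult.assoc[symmetric])
    then show ?thesis using mpart_app[OF key c(1,2,3), of x] by (metis endo_app(6))
  qed
  moreover have "c ^ Suc k - c ^ Suc k * c * s \<in> carrier (endo_ring e)"
  proof -
    define C where "C = c ^ Suc k"
    have C: "lin C" "e * C = C" "C * e = C" unfolding C_def using eck lin_power[OF c(1)] by blast+
    have "e * (C * c * s) = C * c * s" using C by (simp add: mult.assoc[symmetric])
    moreover have "C * c * s * e = C * c * s" using sE by (simp add: mult.assoc)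
    ultimately show ?thesis using C ls c(1) unfolding C_def[symmetric]
      by (simp add: right_diff_distrib left_diff_distrib)
  qed
  ultimately show ?thesis using sE cs unfolding residual_ideal_def by blast
qed

text \<open>The residual algebra of an endomorphism ring at a maximal ideal of the base ring acts faithfully on a
  finite-dimensional vector space, so it is strongly pi-regular and has no infinite descending chain of
  idempotents.\<close>

lemma residual_stable_range_one:
  assumes m: "maximal_ideal m" and e: "lin e" "e * e = e" "fgen e"
    and E: "a \<in> carrier (endo_ring e)" "p \<in> carrier (endo_ring e)" "c \<in> carrier (endo_ring e)"
    and pac: "p * a + c - e \<in> residual_ideal m e"
  shows "\<exists>h\<in>carrier (endo_ring e). \<exists>u\<in>carrier (endo_ring e). (a + h * c) * u - e \<in> residual_ideal m e"
proof -
  define E where "E = endo_ring e"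
  define I where "I = residual_ideal m e"
  define Q where "Q = E Quot I"
  define cl where "cl f = I +>\<^bsub>E\<^esub> f" for f
  interpret E: ring E unfolding E_def by (rule endo_ring_ring[OF e(1,2)])
  interpret I: ideal I E unfolding I_def E_def by (rule residual_ideal_ideal[OF e(1,2)])
  interpret Q: ring Q unfolding Q_def by (rule I.quotient_is_ring)
  interpret h: ring_hom_ring E Q cl unfolding Q_def cl_def[abs_def] by (rule I.rcos_ring_hom_ring)
  have surj: "\<exists>f\<in>carrier E. F = cl f" if "F \<in> carrier Q" for F
    using that unfolding Q_def cl_def by (auto simp: FactRing_def A_RCOSETS_defs a_r_coset_def)
  have E_simps: "mult E = (*)" "add E = (+)" "one E = e" "zero E = 0" by (simp_all add: E_def)
  have E_minus: "f \<ominus>\<^bsub>E\<^esub> g = f - g" if "f \<in> carrier E" "g \<in> carrier E" for f g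
    using endo_ring_minus[OF e(1,2)] that unfolding E_def by blast
  have eq: "cl f = cl g \<longleftrightarrow> f - g \<in> I" if "f \<in> carrier E" "g \<in> carrier E" for f g
    using E.quotient_eq_iff_same_a_r_cos[OF I.ideal_axioms that] E_minus[OF that] unfolding cl_def by simp
  have cl_mult: "cl (f * g) = cl f \<otimes>\<^bsub>Q\<^esub> cl g" if "f \<in> carrier E" "g \<in> carrier E" for f g
    using h.hom_mult[OF that] by (simp add: E_simps)
  have cl_pow: "cl (f ^ Suc n) = cl f [^]\<^bsub>Q\<^esub> Suc n \<and> f ^ Suc n \<in> carrier E" if f: "f \<in> carrier E" for f n
  proof (induction n)
    case 0
    then show ?case using f by simp
  next
    case (Suc n)
    have "f ^ Suc (Suc n) = f ^ Suc n * f" by (rule power_Suc2)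
    moreover have "f ^ Suc n * f \<in> carrier E" using E.m_closed[OF conjunct2[OF Suc] f] by (simp add: E_simps)
    ultimately show ?case using cl_mult[OF conjunct2[OF Suc] f] Suc by simp
  qed
  have spr: "Q.strongly_pi_regular" unfolding Q.strongly_pi_regular_def
  proof
    fix C assume "C \<in> carrier Q"
    then obtain c where c: "c \<in> carrier E" "C = cl c" using surj by blast
    obtain n s where s: "s \<in> carrier E" "c * s = s * c" "c ^ Suc n - c ^ Suc n * c * s \<in> I"
      using mod_strongly_pi_regular[OF m e, of c] c(1) unfolding E_def I_def by blast
    have C1: "c ^ Suc n \<in> carrier E" using cl_pow[OF c(1)] by blast
    have C2: "c ^ Suc n * c \<in> carrier E" using E.m_closed[OF C1 c(1)] by (simp add: E_simps)
    have C3: "c ^ Suc n * c * s \<in> carrier E" using E.m_closed[OF C2 s(1)] by (simp add: E_simps)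
    have "C [^]\<^bsub>Q\<^esub> Suc n = cl (c ^ Suc n * c * s)"
      using eq[OF C1 C3] s(3) cl_pow[OF c(1), of n] c(2) by simp
    also have "\<dots> = C [^]\<^bsub>Q\<^esub> Suc n \<otimes>\<^bsub>Q\<^esub> C \<otimes>\<^bsub>Q\<^esub> cl s"
      using cl_mult[OF C2 s(1)] cl_mult[OF C1 c(1)] cl_pow[OF c(1), of n] c(2) by simp
    finally have "C [^]\<^bsub>Q\<^esub> Suc n = C [^]\<^bsub>Q\<^esub> Suc n \<otimes>\<^bsub>Q\<^esub> C \<otimes>\<^bsub>Q\<^esub> cl s" .
    moreover have "C \<otimes>\<^bsub>Q\<^esub> cl s = cl s \<otimes>\<^bsub>Q\<^esub> C"
      using cl_mult[OF c(1) s(1)] cl_mult[OF s(1) c(1)] s(2) c(2) by simp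
    ultimately show "\<exists>n. \<exists>s\<in>carrier Q. C \<otimes>\<^bsub>Q\<^esub> s = s \<otimes>\<^bsub>Q\<^esub> C \<and>
        C [^]\<^bsub>Q\<^esub> Suc n = C [^]\<^bsub>Q\<^esub> Suc n \<otimes>\<^bsub>Q\<^esub> C \<otimes>\<^bsub>Q\<^esub> s"
      using h.hom_closed[OF s(1)] by blast
  qed
  have wf: "wf Q.corner_idempotents"
  proof (rule ccontr)
    assume "\<not> wf Q.corner_idempotents"
    then obtain F where F: "\<And>n. (F (Suc n), F n) \<in> Q.corner_idempotents"
      unfolding wf_iff_no_infinite_down_chain by blast
    have Fc: "F (Suc n) \<in> Q.corner (F n)" "F (Suc n) \<in> Q.corner (F (Suc n))" "F (Suc n) \<noteq> F n" for n
      using F[of n] by (auto simp: Q.corner_idempotents_def)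
    \<comment> \<open>Shifted by one because \<open>F 0\<close> occurs only as an upper bound and is
      not known to be idempotent.\<close>
    define H where "H n = F (Suc n)" for n
    have HC: "H n \<in> carrier Q" for n using Q.cornerD(1)[OF Fc(1)] by (simp add: H_def)
    have Hle: "H (n + k) \<in> Q.corner (H n)" for n k
    proof (induction k)
      case 0
      show ?case using Fc(2)[of n] by (simp add: H_def)
    next
      case (Suc k)
      note 1 = Q.cornerD[OF Suc]
      note 2 = Q.cornerD[OF Fc(1)[of "Suc (n + k)"], folded H_def]
      have "H n \<otimes>\<^bsub>Q\<^esub> (H (n + k) \<otimes>\<^bsub>Q\<^esub> H (Suc (n + k))) = H (n + k) \<otimes>\<^bsub>Q\<^esub> H (Suc (n + k))"
        using 1 HC by (simp add: Q.m_assoc[symmetric])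
      moreover have "(H (Suc (n + k)) \<otimes>\<^bsub>Q\<^esub> H (n + k)) \<otimes>\<^bsub>Q\<^esub> H n = H (Suc (n + k)) \<otimes>\<^bsub>Q\<^esub> H (n + k)"
        using 1 HC by (simp add: Q.m_assoc)
      ultimately show ?case using 2 HC by (simp add: Q.corner_def)
    qed
    have Hmult: "H i \<otimes>\<^bsub>Q\<^esub> H j = H (max i j)" for i j
      using Q.cornerD(2)[OF Hle[of i "j - i"]] Q.cornerD(3)[OF Hle[of j "i - j"]] by (cases "i \<le> j") (auto simp: max_def)
    obtain f where f: "\<And>n. f n \<in> carrier E" "\<And>n. H n = cl (f n)" using surj[OF HC] by metis
    \<comment> \<open>Modulo the ideal these are non-zero orthogonal idempotents. Vectors
      \<open>y n\<close> in their images, outside the maximal part, would be linearly independent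
      over the residue field, against the finite number of generators.\<close>
    define d where "d n = f n - f (Suc n)" for n
    have dE: "d n \<in> carrier E" for n unfolding d_def using E.minus_closed[OF f(1) f(1)] E_minus[OF f(1) f(1)] by metis
    have ff: "f i * f j \<in> carrier E" for i j using E.m_closed[OF f(1)[of i] f(1)[of j]] by (simp add: E_simps)
    have ffI: "f i * f j - f (max i j) \<in> I" for i j
      using eq[OF ff f(1)] cl_mult[OF f(1) f(1)] Hmult[of i j] f(2) by metis
    have I_add: "x + y \<in> I" "x - y \<in> I" if "x \<in> I" "y \<in> I" for x y
      using that mpart_add[of _ m e] mpart_diff[OF e(1), of _ m] unfolding I_def residual_ideal_def
      by (auto simp: distrib_left distrib_right right_diff_distrib left_diff_distrib)
    have dd: "d i * d j - (if i = j then d i else 0) \<in> I" for i j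
    proof -
      have "d i * d j - (if i = j then d i else 0) =
         (f i * f j - f (max i j)) - (f i * f (Suc j) - f (max i (Suc j)))
         - ((f (Suc i) * f j - f (max (Suc i) j)) - (f (Suc i) * f (Suc j) - f (max (Suc i) (Suc j))))"
        unfolding d_def by (cases i j rule: linorder_cases) (auto simp: algebra_simps max_def, metis Suc_leI le_antisym)
      also have "\<dots> \<in> I" by (intro I_add ffI)
      finally show ?thesis .
    qed
    have dI: "d n \<notin> I" for n
    proof
      assume "d n \<in> I"
      then have "H n = H (Suc n)" using eq[OF f(1) f(1)] f(2) by (simp add: d_def)
      then show False using Fc(3)[of "Suc n"] by (simp add: H_def)
    qed
    have appI: "app x z \<in> mpart m e" if "x \<in> I" for x z using that by (simp add: I_def residual_ideal_def)
    have "\<exists>v. app (d n) v \<notin> mpart m e" for n using dI[of n] dE[of n] unfolding I_def residual_ideal_def E_def by blast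
    then obtain v where v: "\<And>n. app (d n) (v n) \<notin> mpart m e" by metis
    define y where "y n = app (d n) (v n)" for n
    have dlin: "lin (d n)" "e * d n = d n" "d n * e = d n" for n using dE[of n] by (auto simp: E_def)
    have ey: "app e (y n) = y n" for n unfolding y_def using dlin(2)[of n] by (metis endo_app(6))
    obtain G where G: "finite G" "\<And>g. g \<in> G \<Longrightarrow> app e g = g" "\<And>x. \<exists>c. app e x = (\<Sum>g\<in>G. c g \<cdot> g)"
      using e(3) unfolding fgen_def by blast
    have "\<forall>n. \<exists>c. y n = (\<Sum>g\<in>G. c g \<cdot> g)" using G(3)[of "y n" for n] ey by simp
    then obtain b where b: "\<And>n. y n = (\<Sum>g\<in>G. b n g \<cdot> g)" by (elim choice[THEN exE]) blast
    define K where "K = {..card G}"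
    obtain r where r: "\<exists>i\<in>K. r i \<notin> m" "\<And>g. g \<in> G \<Longrightarrow> (\<Sum>i\<in>K. r i * b i g) \<in> m"
      using linear_system_nontrivial_mod_prime[OF maximal_ideal_prime[OF m] G(1), of K b] unfolding K_def by auto
    have "(\<Sum>i\<in>K. r i \<cdot> y i) = (\<Sum>i\<in>K. \<Sum>g\<in>G. (r i * b i g) \<cdot> g)"
      unfolding b by (simp add: R.scale_sum_right)
    also have "\<dots> = (\<Sum>g\<in>G. (\<Sum>i\<in>K. r i * b i g) \<cdot> app e g)"
      by (subst sum.swap) (simp add: R.scale_sum_left G(2))
    also have "\<dots> \<in> mpart m e" using r(2) by (intro mpart_sum mpart_base)
    finally have rel: "(\<Sum>i\<in>K. r i \<cdot> y i) \<in> mpart m e" .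
    obtain k where k: "k \<in> K" "r k \<notin> m" using r(1) by blast
    have dy: "app (d k) (y i) - (if k = i then y i else 0) \<in> mpart m e" for i
      using appI[OF dd[of k i], of "v i"] by (auto simp: y_def split: if_splits)
    have "(\<Sum>i\<in>K. r i \<cdot> (app (d k) (y i) - (if k = i then y i else 0))) \<in> mpart m e"
      using dy e(1) by (intro mpart_sum mpart_smul)
    also have "(\<Sum>i\<in>K. r i \<cdot> (app (d k) (y i) - (if k = i then y i else 0))) = app (d k) (\<Sum>i\<in>K. r i \<cdot> y i) - r k \<cdot> y k"
    proof -
      have "(\<Sum>i\<in>K. r i \<cdot> (if k = i then y i else 0)) = (\<Sum>i\<in>K. if k = i then r k \<cdot> y k else 0)"
        by (intro sum.cong) auto
      also have "\<dots> = r k \<cdot> y k" using k(1) by (simp add: K_def)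
      finally show ?thesis by (simp add: app_sum lin_smul dlin(1) R.scale_right_diff_distrib sum_subtractf)
    qed
    finally have 1: "app (d k) (\<Sum>i\<in>K. r i \<cdot> y i) - r k \<cdot> y k \<in> mpart m e" .
    have "app (d k) (\<Sum>i\<in>K. r i \<cdot> y i) \<in> mpart m e" by (rule mpart_app[OF rel dlin])
    from mpart_diff[OF e(1) this 1] have 2: "r k \<cdot> y k \<in> mpart m e" by simp
    obtain t where t: "1 - t * r k \<in> m" using maximal_ideal_inverse[OF m k(2)] by blast
    have "(1 - t * r k) \<cdot> app e (y k) + t \<cdot> r k \<cdot> y k \<in> mpart m e"
      by (rule mpart_add[OF mpart_base[OF t] mpart_smul[OF 2 e(1)]])
    then have "y k \<in> mpart m e" by (simp add: ey R.scale_left_diff_distrib)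
    then show False using v[of k] by (simp add: y_def)
  qed
  have aE: "a \<in> carrier E" "p \<in> carrier E" "c \<in> carrier E" using E unfolding E_def by blast+
  have paE: "p * a \<in> carrier E" using E.m_closed[OF aE(2,1)] by (simp add: E_simps)
  have pacE: "p * a + c \<in> carrier E" using E.a_closed[OF paE aE(3)] by (simp add: E_simps)
  have eE: "e \<in> carrier E" using E.one_closed by (simp add: E_simps)
  have "cl (p * a + c) = cl e" using eq[OF pacE eE] pac by (simp add: I_def)
  moreover have "cl (p * a + c) = cl p \<otimes>\<^bsub>Q\<^esub> cl a \<oplus>\<^bsub>Q\<^esub> cl c"
    using h.hom_add[OF paE aE(3)] cl_mult[OF aE(2,1)] by (simp add: E_simps)
  moreover have one: "cl e = \<one>\<^bsub>Q\<^esub>" using h.hom_one by (simp add: E_simps)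
  ultimately have pac': "cl p \<otimes>\<^bsub>Q\<^esub> cl a \<oplus>\<^bsub>Q\<^esub> cl c = \<one>\<^bsub>Q\<^esub>" by simp
  have cor: "cl x \<in> Q.corner \<one>\<^bsub>Q\<^esub>" if "x \<in> carrier E" for x
    using h.hom_closed[OF that] by (simp add: Q.corner_def)
  have "\<one>\<^bsub>Q\<^esub> \<in> Q.corner \<one>\<^bsub>Q\<^esub>" using cor[OF eE] one by simp
  from Q.corner_stable_range_one[OF spr wf this cor[OF aE(1)] cor[OF aE(2)] cor[OF aE(3)] pac']
  obtain H U where HU: "H \<in> carrier Q" "U \<in> carrier Q" "(cl a \<oplus>\<^bsub>Q\<^esub> H \<otimes>\<^bsub>Q\<^esub> cl c) \<otimes>\<^bsub>Q\<^esub> U = \<one>\<^bsub>Q\<^esub>"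
    using Q.cornerD(1) by blast
  obtain h u where hu: "h \<in> carrier E" "H = cl h" "u \<in> carrier E" "U = cl u" using surj HU(1,2) by metis
  have hc: "h * c \<in> carrier E" using E.m_closed[OF hu(1) aE(3)] by (simp add: E_simps)
  have ahc: "a + h * c \<in> carrier E" using E.a_closed[OF aE(1) hc] by (simp add: E_simps)
  have ahcu: "(a + h * c) * u \<in> carrier E" using E.m_closed[OF ahc hu(3)] by (simp add: E_simps)
  have "cl ((a + h * c) * u) = (cl a \<oplus>\<^bsub>Q\<^esub> cl (h * c)) \<otimes>\<^bsub>Q\<^esub> cl u"
    using cl_mult[OF ahc hu(3)] h.hom_add[OF aE(1) hc] by (simp add: E_simps)
  then have "cl ((a + h * c) * u) = cl e" using HU(3) hu cl_mult[OF hu(1) aE(3)] one by simp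
  then have "(a + h * c) * u - e \<in> I" using eq[OF ahcu eE] by blast
  then show ?thesis using hu(1,3) unfolding E_def I_def by blast
qed

text \<open>An inverse of \<open>s\<close> modulo \<open>m\<close> turns the relation into one in
  the residual algebra. Stable range one there makes \<open>a + h c\<close> surjective modulo
  \<open>m\<close>, and \<open>local_inverse\<close> lifts this to invertibility up to a
  scalar.\<close>

lemma local_stable_range_one:
  assumes m: "maximal_ideal m" and e: "lin e" "e * e = e" "fgen e"
    and E: "a \<in> carrier (endo_ring e)" "p \<in> carrier (endo_ring e)" "c \<in> carrier (endo_ring e)"
    and pac: "p * a + c = sc s * e" "s \<notin> m"
  shows "\<exists>h g t. h \<in> carrier (endo_ring e) \<and> g \<in> carrier (endo_ring e) \<and> t \<notin> m \<and>
    (a + h * c) * g = sc t * e \<and> g * (a + h * c) = sc t * e"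
proof -
  obtain s' where s': "1 - s' * s \<in> m" using maximal_ideal_inverse[OF m pac(2)] by blast
  have E': "lin a" "e * a = a" "a * e = a" "lin p" "e * p = p" "p * e = p" "lin c" "e * c = c" "c * e = c" using E by auto
  have S: "sc s' * x \<in> carrier (endo_ring e)" if "x \<in> carrier (endo_ring e)" for x
    using that e(1) by (auto simp: sc_comm mult.assoc)
  have "(sc s' * p) * a + sc s' * c - e = sc (s' * s - 1) * e"
    using pac(1) by (simp add: sc_simps mult.assoc distrib_left[symmetric] left_diff_distrib)
  moreover have "sc (s' * s - 1) * e \<in> residual_ideal m e"
  proof -
    have "s' * s - 1 \<in> m" using comm_idealD(5)[of m, OF _ s'] m by (simp add: maximal_ideal_def)
    then show ?thesis unfolding residual_ideal_def using e(1,2)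
      by (auto simp: sc_comm mult.assoc intro: mpart_base)
  qed
  ultimately obtain h u where hu: "h \<in> carrier (endo_ring e)" "u \<in> carrier (endo_ring e)"
      "(a + h * (sc s' * c)) * u - e \<in> residual_ideal m e"
    using residual_stable_range_one[OF m e E(1) S[OF E(2)] S[OF E(3)]] by metis
  define h' where "h' = sc s' * h"
  have h': "h' \<in> carrier (endo_ring e)" unfolding h'_def by (rule S[OF hu(1)])
  define w where "w = a + h' * c"
  have w_eq: "a + h * (sc s' * c) = w" unfolding w_def h'_def using hu(1) by (simp add: sc_comm mult.assoc)
  have w: "lin w" "e * w = w" "w * e = w"
    using h' E' unfolding w_def by (auto simp: distrib_left distrib_right mult.assoc) (simp add: mult.assoc[symmetric])
  have "\<exists>z. 1 \<cdot> app e x - app w z \<in> mpart m e" for x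
  proof -
    have "app (w * u - e) x \<in> mpart m e" using hu(3) unfolding w_eq residual_ideal_def by blast
    from mpart_smul[OF this e(1), of "-1"] show ?thesis by (intro exI[of _ "app u x"]) simp
  qed
  moreover have "1 \<notin> m" using maximal_ideal_prime[OF m] by (simp add: prime_comm_ideal_def)
  ultimately obtain t g where "t \<notin> m" "lin g" "e * g = g" "g * e = g" "w * g = sc t * e" "g * w = sc t * e"
    using local_inverse[OF maximal_ideal_prime[OF m] e w] by blast
  then show ?thesis using h' unfolding w_def by (intro exI[of _ h'] exI[of _ g] exI[of _ t]) auto
qed

end

section \<open>Cancellation and gluing\<close>

lemma assoc_rule: "x * y = z \<Longrightarrow> x * (y * w) = z * (w :: 'a::semigroup_mult)"
  by (simp add: mult.assoc[symmetric])

context torsion_free_module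
begin

text \<open>For idempotents \<open>e\<close> and \<open>d\<close>: at \<open>m\<close> the image of
  \<open>e\<close> is isomorphic to a direct summand of that of \<open>d\<close>, where
  \<open>f\<close> is the inclusion and \<open>g\<close> becomes a retraction once \<open>t\<close>
  is inverted.\<close>

definition local_summand :: "'r set \<Rightarrow> 'a endo \<Rightarrow> 'a endo \<Rightarrow> bool" where
  "local_summand m e d \<longleftrightarrow> (\<exists>f g t. lin f \<and> lin g \<and> t \<notin> m \<and> d * f = f \<and> f * e = f \<and> e * g = g \<and> g * d = g \<and>
     g * f = sc t * e)"

lemma local_summand_mono:
  assumes "local_summand m e d" "d * d' = d" "d' * d = d"
  shows "local_summand m e d'"
proof -
  obtain f g t where fg: "lin f" "lin g" "t \<notin> m" "d * f = f" "f * e = f" "e * g = g" "g * d = g" "g * f = sc t * e"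
    using assms(1) unfolding local_summand_def by blast
  have "d' * f = f" using assms(3) fg(4) by (metis mult.assoc)
  moreover have "g * d' = g" using assms(2) fg(7) by (metis mult.assoc)
  ultimately show ?thesis unfolding local_summand_def using fg by blast
qed

text \<open>The map w is the part of the (sheared) second inclusion that stays in e; a shear by stable range one makes
  it locally invertible, and then the Schur complement K of w splits off the complement of f.\<close>

lemma local_cancellation:
  assumes m: "maximal_ideal m" and e: "lin e" "e * e = e" "fgen e" and d: "lin d" "d * d = d" "e * d = 0" "d * e = 0"
    and y: "lin y" "y * y = y" and fp: "lin f" "lin p" "y * f = f" "f * e = f" "e * p = p" "p * y = p" "p * f = e"
    and loc: "local_summand m y (e + d)"
  shows "local_summand m (y - f * p) d"
proof -
  obtain \<alpha> \<beta> s where ab: "lin \<alpha>" "lin \<beta>" "s \<notin> m" "(e + d) * \<alpha> = \<alpha>" "\<alpha> * y = \<alpha>" "y * \<beta> = \<beta>" "\<beta> * (e + d) = \<beta>"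
      "\<beta> * \<alpha> = sc s * y"
    using loc unfolding local_summand_def by blast
  \<comment> \<open>The second inclusion is restricted along \<open>f\<close>: \<open>a\<close> is
    the part that lands in \<open>e\<close>, and \<open>c\<close> collects what passes through
    \<open>d\<close>. The relation \<open>q a + c = s e\<close> is the input for stable range
    one.\<close>
  define a where "a = e * \<alpha> * f"
  define q where "q = p * \<beta> * e"
  define c where "c = p * \<beta> * d * \<alpha> * f"
  have aqc: "a \<in> carrier (endo_ring e)" "q \<in> carrier (endo_ring e)" "c \<in> carrier (endo_ring e)"
    unfolding a_def q_def c_def using e d fp ab by (auto simp: mult.assoc assoc_rule[OF e(2)] assoc_rule[OF fp(5)])
  have "q * a + c = p * (\<beta> * (e + d)) * \<alpha> * f"
    unfolding q_def a_def c_def by (simp add: mult.assoc assoc_rule[OF e(2)] distrib_left distrib_right)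
  also have "\<dots> = p * (\<beta> * \<alpha>) * f" by (simp add: ab(7) mult.assoc)
  also have "\<dots> = sc s * e" by (simp add: ab(8) fp sc_comm mult.assoc)
  finally obtain h g t where hg: "h \<in> carrier (endo_ring e)" "g \<in> carrier (endo_ring e)" "t \<notin> m"
      "(a + h * c) * g = sc t * e" "g * (a + h * c) = sc t * e"
    using local_stable_range_one[OF m e aqc _ ab(3)] by blast
  have h: "lin h" "e * h = h" "h * e = h" and g: "lin g" "e * g = g" "g * e = g" using hg by auto
  \<comment> \<open>The shear \<open>1 + X\<close> adds the image of the \<open>d\<close>-component
    to the \<open>e\<close>-component and thereby replaces \<open>a\<close> by
    \<open>a + h c\<close>. Its inverse is \<open>1 - X\<close>, because \<open>X\<close> maps
    \<open>d\<close> into \<open>e\<close>.\<close>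
  define X where "X = h * p * \<beta> * d"
  have lX: "lin X" unfolding X_def using h fp ab d by (intro lin_closed)
  have dh: "d * h = 0" using d(4) h(2) by (metis mult.assoc mult_zero_left)
  have XX: "X * X = 0" unfolding X_def by (simp add: mult.assoc assoc_rule[OF dh])
  have eX: "e * X = X" unfolding X_def by (simp add: mult.assoc[symmetric] h)
  have dX: "d * X = 0" unfolding X_def by (simp add: mult.assoc[symmetric] dh)
  define \<alpha>' where "\<alpha>' = (1 + X) * \<alpha>"
  define \<beta>' where "\<beta>' = \<beta> * (1 - X)"
  have l: "lin \<alpha>'" "lin \<beta>'" unfolding \<alpha>'_def \<beta>'_def using lX ab by (auto intro: lin_closed)
  have ba: "\<beta>' * \<alpha>' = sc s * y"
  proof -
    have "(1 - X) * (1 + X) = 1" by (simp add: algebra_simps XX)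
    then have "\<beta>' * \<alpha>' = \<beta> * \<alpha>" unfolding \<alpha>'_def \<beta>'_def by (simp add: mult.assoc assoc_rule)
    then show ?thesis by (simp add: ab)
  qed
  have ea': "e * \<alpha>' = e * \<alpha> + X * \<alpha>" and da': "d * \<alpha>' = d * \<alpha>"
    unfolding \<alpha>'_def by (simp_all add: distrib_left distrib_right mult.assoc[symmetric] eX dX)
  have eda': "\<alpha>' = e * \<alpha>' + d * \<alpha>'"
  proof -
    have "\<alpha>' = \<alpha> + X * \<alpha>" unfolding \<alpha>'_def by (simp add: distrib_right)
    also have "\<alpha> = e * \<alpha> + d * \<alpha>" using ab(4) by (simp add: distrib_right)
    finally show ?thesis unfolding ea' da' by (metis ab(4) add.assoc add.commute distrib_right)
  qed
  have w: "e * \<alpha>' * f = a + h * c" unfolding ea' a_def c_def X_def by (simp add: distrib_right mult.assoc)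
  \<comment> \<open>As \<open>g\<close> inverts \<open>e \<alpha>' f\<close> up to \<open>t\<close>,
    the \<open>e\<close>-component cancels and \<open>K\<close> lands in \<open>d\<close>. The
    correction term begins with \<open>\<alpha>' f\<close>, which \<open>z \<beta>'\<close> sends to
    a multiple of \<open>z f = 0\<close>.\<close>
  define K where "K = sc t * \<alpha>' - \<alpha>' * f * g * e * \<alpha>'"
  have lK: "lin K" unfolding K_def using l e fp g by (intro lin_closed)
  have "e * K = sc t * (e * \<alpha>') - (e * \<alpha>' * f) * g * e * \<alpha>'"
    unfolding K_def using e(1) by (simp add: right_diff_distrib sc_comm mult.assoc)
  also have "\<dots> = 0" unfolding w hg(4) using e by (simp add: mult.assoc assoc_rule[OF e(2)])
  finally have eK: "e * K = 0" .
  have "(e + d) * K = sc t * ((e + d) * \<alpha>') - ((e + d) * \<alpha>') * f * g * e * \<alpha>'"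
    unfolding K_def using e(1) d(1) lin_closed(4)[OF e(1) d(1)] by (simp add: right_diff_distrib sc_comm mult.assoc)
  also have "(e + d) * \<alpha>' = \<alpha>'" using eda' by (simp add: distrib_right)
  finally have "(e + d) * K = K" unfolding K_def[symmetric] .
  then have dK: "d * K = K" using eK by (simp add: distrib_right)
  define z where "z = y - f * p"
  have lz: "lin z" unfolding z_def using y fp by (intro lin_closed)
  have fpfp: "f * (p * (f * p)) = f * p" using fp by (simp add: assoc_rule[OF fp(7)] mult.assoc[symmetric])
  have zz: "z * z = z" and zy: "z * y = z" and zf: "z * f = 0"
    unfolding z_def using y fp by (simp_all add: left_diff_distrib right_diff_distrib mult.assoc fpfp assoc_rule[OF fp(3)])
  have "z * \<beta>' * K = sc t * z * (\<beta>' * \<alpha>') - z * (\<beta>' * \<alpha>') * f * g * e * \<alpha>'"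
    unfolding K_def using lz l by (simp add: right_diff_distrib sc_comm mult.assoc)
  also have "\<dots> = sc t * (sc s * z)"
  proof -
    have "z * (sc s * y) = sc s * z" using sc_comm(2)[OF lz] zy by simp
    then show ?thesis unfolding ba by (simp add: mult.assoc assoc_rule[OF zf])
  qed
  finally have zK: "z * \<beta>' * K = sc (t * s) * z" by (simp add: sc_simps mult.assoc)
  have "(z * \<beta>' * d) * (d * K * z) = z * \<beta>' * K * z" using d(2) dK by (simp add: mult.assoc assoc_rule[OF d(2)] assoc_rule[OF dK])
  then have "(z * \<beta>' * d) * (d * K * z) = sc (t * s) * z" unfolding zK by (simp add: mult.assoc zz)
  moreover have "t * s \<notin> m" using maximal_ideal_prime[OF m] hg(3) ab(3) by (auto simp: prime_comm_ideal_def)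
  ultimately show ?thesis unfolding local_summand_def z_def[symmetric]
    using lz l lK d zz
    by (intro exI[of _ "d * K * z"] exI[of _ "z * \<beta>' * d"] exI[of _ "t * s"])
       (auto simp: mult.assoc assoc_rule[OF d(2)] assoc_rule[OF zz])
qed

text \<open>In the sum of the maps \<open>k m F m\<close> the coefficient \<open>k m\<close> is a
  unit at \<open>m\<close> and the other ones lie in \<open>m\<close>. So \<open>G m * f\<close> is
  a unit multiple of \<open>c\<close> modulo \<open>m\<close>, and \<open>local_inverse\<close>
  makes it invertible at \<open>m\<close>.\<close>

lemma simultaneous_local_splitting:
  assumes S: "finite S" "\<And>m. m \<in> S \<Longrightarrow> maximal_ideal m" and c: "lin c" "c * c = c" "fgen c" and d: "lin d"
    and loc: "\<And>m. m \<in> S \<Longrightarrow> local_summand m c d"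
  shows "\<exists>f. lin f \<and> d * f = f \<and> f * c = f \<and>
    (\<forall>m\<in>S. \<exists>t g. t \<notin> m \<and> lin g \<and> c * g = g \<and> g * d = g \<and> g * f = sc t * c)"
proof -
  obtain F G s where FG: "\<And>m. m \<in> S \<Longrightarrow> lin (F m) \<and> lin (G m) \<and> s m \<notin> m \<and> d * F m = F m \<and> F m * c = F m \<and>
      c * G m = G m \<and> G m * d = G m \<and> G m * F m = sc (s m) * c"
    using loc unfolding local_summand_def by metis
  obtain k where k: "\<And>m. m \<in> S \<Longrightarrow> k m \<notin> m \<and> (\<forall>n\<in>S - {m}. k m \<in> n)"
    using maximal_ideals_separating[OF S] by metis
  define f where "f = (\<Sum>m\<in>S. sc (k m) * F m)"
  have f: "lin f" "d * f = f" "f * c = f" unfolding f_def sum_distrib_left sum_distrib_right using FG d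
    by (auto intro!: lin_sum lin_closed sum.cong simp: sc_comm mult.assoc)
  have "\<exists>t g. t \<notin> m \<and> lin g \<and> c * g = g \<and> g * d = g \<and> g * f = sc t * c" if m: "m \<in> S" for m
  proof -
    note mm = S(2)[OF m]
    note G = FG[OF m]
    define w where "w = G m * f"
    have w: "lin w" "c * w = w" "w * c = w" unfolding w_def using G f
      by (auto simp: mult.assoc) (simp add: mult.assoc[symmetric])
    define u where "u = k m * s m"
    have u: "u \<notin> m" using maximal_ideal_prime[OF mm] k[OF m] G by (auto simp: u_def prime_comm_ideal_def)
    define v where "v = (\<Sum>n\<in>S - {m}. sc (k n) * (G m * F n))"
    have weq: "w = sc u * c + v"
    proof -
      have "w = (\<Sum>n\<in>S. sc (k n) * (G m * F n))"
        unfolding w_def f_def sum_distrib_left using G by (simp add: sc_comm)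
      also have "\<dots> = sc (k m) * (G m * F m) + v" unfolding v_def using S(1) m by (rule sum.remove)
      also have "sc (k m) * (G m * F m) = sc u * c" using G by (simp add: u_def sc_simps mult.assoc)
      finally show ?thesis .
    qed
    have vI: "app v x \<in> mpart m c" for x
    proof -
      have "k n \<cdot> app (G m) (app (F n) x) = k n \<cdot> app c (app (G m) (app (F n) x))" for n
        using G by (metis endo_app(6))
      moreover have "k n \<in> m" if "n \<in> S - {m}" for n using k[of n] that m by blast
      ultimately show ?thesis unfolding v_def app_sum_endo by (intro mpart_sum) (auto intro: mpart_base)
    qed
    have "\<exists>z. u \<cdot> app c x - app w z \<in> mpart m c" for x
    proof (intro exI)
      have "u \<cdot> app c x - app w x = (-1) \<cdot> app v x" unfolding weq by simp
      also have "\<dots> \<in> mpart m c" by (rule mpart_smul[OF vI c(1)])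
      finally show "u \<cdot> app c x - app w x \<in> mpart m c" .
    qed
    from local_inverse[OF maximal_ideal_prime[OF mm] c w u this]
    obtain t g where tg: "t \<notin> m" "lin g" "c * g = g" "g * w = sc t * c" by blast
    then show ?thesis using G unfolding w_def
      by (intro exI[of _ t] exI[of _ "g * G m"]) (auto simp: mult.assoc assoc_rule[OF tg(3)])
  qed
  then show ?thesis using f by blast
qed

text \<open>The projections of a direct sum onto its partial sums, seen abstractly. The start at 0
  supplies the first map of the back-and-forth; strict growth says that every summand is non-zero,
  which is the source of room for generic splittings.\<close>

definition filtration :: "(nat \<Rightarrow> 'a endo) \<Rightarrow> bool" where
  "filtration P \<longleftrightarrow> P 0 = 0 \<and> (\<forall>i. lin (P i) \<and> fgen (P i) \<and> P i \<noteq> P (Suc i)) \<and> (\<forall>i j. P i * P j = P (min i j))"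

lemma filtrationD:
  assumes "filtration P"
  shows "P 0 = 0" "lin (P i)" "fgen (P i)" "P i \<noteq> P (Suc i)" "P i * P j = P (min i j)"
    "i \<le> j \<Longrightarrow> P i * P j = P i" "i \<le> j \<Longrightarrow> P j * P i = P i"
  using assms by (auto simp: filtration_def min_absorb1 min_absorb2)

lemma fgen_sub:
  assumes "fgen e" "lin d" "d * e = d" "e * d = d" "d * d = d"
  shows "fgen d"
proof -
  obtain G where G: "finite G" "\<And>x. \<exists>c. app e x = (\<Sum>g\<in>G. c g \<cdot> g)"
    using assms(1) unfolding fgen_def by blast
  have dd: "app d (app d x) = app d x" for x using assms(5) by (metis endo_app(6))
  have "\<exists>c. app d x = (\<Sum>h\<in>app d ` G. c h \<cdot> h)" for x
  proof -
    obtain c where c: "app e (app d x) = (\<Sum>g\<in>G. c g \<cdot> g)" using G(2) by blast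
    have "app d x = app d (app e (app d x))" using assms(4) dd by (metis endo_app(6))
    also have "\<dots> = (\<Sum>g\<in>G. c g \<cdot> app d g)" unfolding c by (simp add: app_sum lin_smul[OF assms(2)])
    also have "\<dots> = (\<Sum>h\<in>app d ` G. \<Sum>g\<in>{g \<in> G. app d g = h}. c g \<cdot> app d g)"
      by (rule sum.image_gen[OF G(1)])
    also have "\<dots> = (\<Sum>h\<in>app d ` G. (\<Sum>g\<in>{g \<in> G. app d g = h}. c g) \<cdot> h)"
      by (intro sum.cong) (auto simp: R.scale_sum_left)
    finally show ?thesis by (intro exI[of _ "\<lambda>h. \<Sum>g\<in>{g \<in> G. app d g = h}. c g"])
  qed
  then show ?thesis unfolding fgen_def using G(1) dd by (intro exI[of _ "app d ` G"]) auto
qed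

text \<open>A tail is again a filtration, so complements can be split into it by the statements
  about arbitrary filtrations.\<close>

lemma filtration_tail:
  assumes "filtration P"
  shows "filtration (\<lambda>i. P (k + i) - P k)"
proof -
  note P = filtrationD[OF assms]
  have mult: "(P (k + i) - P k) * (P (k + j) - P k) = P (k + min i j) - P k" for i j
    by (simp add: left_diff_distrib right_diff_distrib P(5)) (simp add: min_def)
  have "fgen (P (k + i) - P k)" for i
  proof (rule fgen_sub[OF P(3)[of "k + i"]])
    show "lin (P (k + i) - P k)" using P(2) by (intro lin_closed)
    show "(P (k + i) - P k) * (P (k + i) - P k) = P (k + i) - P k" using mult[of i i] by simp
  qed (simp_all add: left_diff_distrib right_diff_distrib P(5))
  then show ?thesis unfolding filtration_def using P(2,4) mult by auto
qed

end

text \<open>Isolates the consequence of the simple artinian hypothesis that the gluing uses: beyond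
  any stage \<open>n\<close> of any filtration, \<open>c\<close> splits off up to a non-zero scalar.
  By finite character only finitely many maximal ideals contain that scalar.\<close>

locale generically_split_module = torsion_free_module phi act
  for phi :: "'r::idom \<Rightarrow> 'l::ring_1" and act :: "'a::ab_group_add \<Rightarrow> 'l \<Rightarrow> 'a" +
  assumes fin_char: "finite_character TYPE('r)"
    and generic_splitting: "lin c \<Longrightarrow> c * c = c \<Longrightarrow> fgen c \<Longrightarrow> filtration D \<Longrightarrow>
      \<exists>n'>n. \<exists>f g s. s \<noteq> 0 \<and> lin f \<and> lin g \<and> (D n' - D n) * f = f \<and> f * c = f \<and> c * g = g \<and>
        g * (D n' - D n) = g \<and> g * f = sc s * c"
begin

text \<open>The scalars up to which the combined map \<open>h\<close> has a retraction form an ideal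
  \<open>J\<close>. For every maximal ideal, either the generic or a local retraction provides an
  element of \<open>J\<close> outside it, whence \<open>1 \<in> J\<close>.\<close>

lemma local_to_global_splitting:
  assumes c: "lin c" "c * c = c" "fgen c" and D: "filtration D"
    and loc: "\<And>m. maximal_ideal m \<Longrightarrow> \<exists>k. local_summand m c (D k)"
  shows "\<exists>k f g. lin f \<and> lin g \<and> D k * f = f \<and> f * c = f \<and> c * g = g \<and> g * D k = g \<and> g * f = c"
proof -
  note Dp = filtrationD[OF D]
  have bad: "finite {m. maximal_ideal m \<and> s \<in> m}" if "s \<noteq> 0" for s :: 'r
    using fin_char that unfolding finite_character_def by blast
  \<comment> \<open>A uniform stage: one generic splitting serves all maximal ideals that avoid its
    scalar, and for the finitely many others the maximum of their stages exists.\<close>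
  obtain n where n: "\<And>m. maximal_ideal m \<Longrightarrow> local_summand m c (D n)"
  proof -
    obtain n0 f g s where s: "s \<noteq> 0" "lin f" "lin g" "D n0 * f = f" "f * c = f" "c * g = g" "g * D n0 = g" "g * f = sc s * c"
      using generic_splitting[OF c D, of 0] Dp(1) by auto
    define S where "S = {m. maximal_ideal m \<and> s \<in> m}"
    obtain k where k: "\<And>m. maximal_ideal m \<Longrightarrow> local_summand m c (D (k m))" using loc by metis
    define n where "n = Max (insert n0 (k ` S))"
    have fin: "finite (insert n0 (k ` S))" using bad[OF s(1)] by (simp add: S_def)
    have "local_summand m c (D n)" if m: "maximal_ideal m" for m
    proof (cases "m \<in> S")
      case True
      then have "k m \<le> n" unfolding n_def using Max_ge[OF fin] by blast
      then show ?thesis using local_summand_mono[OF k[OF m]] Dp(6,7) by blast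
    next
      case False
      then have "local_summand m c (D n0)" unfolding local_summand_def S_def using s m by blast
      moreover have "n0 \<le> n" unfolding n_def using Max_ge[OF fin] by blast
      ultimately show ?thesis using local_summand_mono Dp(6,7) by blast
    qed
    then show ?thesis using that by blast
  qed
  \<comment> \<open>This second generic splitting lies beyond stage \<open>n\<close>, orthogonally
    to \<open>D n\<close>. So \<open>g0\<close> kills \<open>f1\<close>, the retractions of
    \<open>f1\<close> kill \<open>f0\<close>, and the two maps can be added without
    interference.\<close>
  obtain n' f0 g0 s where n': "n' > n" and s: "s \<noteq> 0" and f0: "lin f0" "lin g0" "(D n' - D n) * f0 = f0" "f0 * c = f0"
      "c * g0 = g0" "g0 * (D n' - D n) = g0" "g0 * f0 = sc s * c"
    using generic_splitting[OF c D] by metis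
  define S where "S = {m. maximal_ideal m \<and> s \<in> m}"
  obtain f1 where f1: "lin f1" "D n * f1 = f1" "f1 * c = f1"
    and f1S: "\<And>m. m \<in> S \<Longrightarrow> \<exists>t g. t \<notin> m \<and> lin g \<and> c * g = g \<and> g * D n = g \<and> g * f1 = sc t * c"
    using simultaneous_local_splitting[OF _ _ c Dp(2)[of n], of S] bad[OF s] n unfolding S_def by blast
  have DD: "D n' * D n = D n" "D n * D n' = D n" "D n * D n = D n" "D n' * D n' = D n'" using Dp(6,7) n' by auto
  have D0: "(D n' - D n) * D n = 0" "D n * (D n' - D n) = 0" "D n' * (D n' - D n) = D n' - D n" "(D n' - D n) * D n' = D n' - D n"
    by (simp_all add: left_diff_distrib right_diff_distrib DD)
  define h where "h = f1 + f0"
  have "D n' * f0 = f0" using D0(3) f0(3) by (metis mult.assoc)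
  moreover have "D n' * f1 = f1" using DD(1) f1(2) by (metis mult.assoc)
  ultimately have h: "lin h" "D n' * h = h" "h * c = h" unfolding h_def using f0 f1 by (auto simp: distrib_left distrib_right)
  define J where "J = {r. \<exists>g. lin g \<and> c * g = g \<and> g * D n' = g \<and> g * h = sc r * c}"
  have JI: "comm_ideal J" unfolding comm_ideal_def
  proof (intro conjI ballI allI)
    show "0 \<in> J" unfolding J_def mem_Collect_eq by (rule exI[of _ 0]) (simp add: sc_simps)
    show "a + b \<in> J" if ab: "a \<in> J" "b \<in> J" for a b
    proof -
      obtain g g' where "lin g" "c * g = g" "g * D n' = g" "g * h = sc a * c" "lin g'" "c * g' = g'" "g' * D n' = g'" "g' * h = sc b * c"
        using ab unfolding J_def by blast
      then have "lin (g + g')" "c * (g + g') = g + g'" "(g + g') * D n' = g + g'" "(g + g') * h = sc (a + b) * c"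
        by (auto simp: sc_simps distrib_left distrib_right)
      then show ?thesis unfolding J_def by blast
    qed
    show "r * a \<in> J" if a: "a \<in> J" for a r
    proof -
      obtain g where "lin g" "c * g = g" "g * D n' = g" "g * h = sc a * c"
        using a unfolding J_def by blast
      then have "lin (sc r * g)" "c * (sc r * g) = sc r * g" "sc r * g * D n' = sc r * g" "sc r * g * h = sc (r * a) * c"
        by (simp_all add: sc_comm(2)[OF c(1)] mult.assoc) (simp add: sc_simps mult.assoc)
      then show ?thesis unfolding J_def by blast
    qed
  qed
  have "\<exists>t\<in>J. t \<notin> m" if m: "maximal_ideal m" for m
  proof (cases "m \<in> S")
    case False
    have "g0 * f1 = 0" using f0(6) f1(2) D0(1) by (metis mult.assoc mult_zero_left mult_zero_right)
    then have "g0 * h = sc s * c" unfolding h_def using f0 by (simp add: distrib_left)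
    moreover have "g0 * D n' = g0" using D0(4) f0(6) by (metis mult.assoc)
    ultimately have "s \<in> J" unfolding J_def using f0 by blast
    then show ?thesis using False m unfolding S_def by blast
  next
    case True
    obtain t g where tg: "t \<notin> m" "lin g" "c * g = g" "g * D n = g" "g * f1 = sc t * c" using f1S[OF True] by blast
    have "g * f0 = 0" using tg(4) f0(3) D0(2) by (metis mult.assoc mult_zero_left mult_zero_right)
    then have "g * h = sc t * c" unfolding h_def using tg by (simp add: distrib_left)
    moreover have "g * D n' = g" using DD(2) tg(4) by (metis mult.assoc)
    ultimately have "t \<in> J" unfolding J_def using tg by blast
    then show ?thesis using tg by blast
  qed
  then have "1 \<in> J" using proper_ideal_in_maximal[OF JI] by blast
  then obtain g where "lin g" "c * g = g" "g * D n' = g" "g * h = c" unfolding J_def by (auto simp: sc_simps)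
  then show ?thesis using h by blast
qed

text \<open>The new map \<open>g = p + h\<close> undoes \<open>f\<close> on its image by
  \<open>p\<close> and sends the complement \<open>c = Q l - f p\<close> into the tail by
  \<open>h\<close>; its retraction is \<open>q = f + h'\<close>. The mixed products vanish because
  \<open>P k\<close> is orthogonal to the tail.\<close>

lemma extend_splitting:
  assumes P: "filtration P" and Q: "filtration Q"
    and loc: "\<And>m l. maximal_ideal m \<Longrightarrow> \<exists>k. local_summand m (Q l) (P k)"
    and fp: "lin f" "lin p" "Q l * f = f" "f * P k = f" "P k * p = p" "p * Q l = p" "p * f = P k"
  shows "\<exists>n g q. n > k \<and> lin g \<and> lin q \<and> P n * g = g \<and> g * Q l = g \<and> Q l * q = q \<and> q * P n = q \<and> q * g = Q l \<and> g * f = P k"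
proof -
  note Pp = filtrationD[OF P] and Qp = filtrationD[OF Q]
  have PP: "P i * P i = P i" "Q i * Q i = Q i" for i using Pp(6) Qp(6) by auto
  define D where "D i = P (k + i) - P k" for i
  have D: "filtration D" unfolding D_def by (rule filtration_tail[OF P])
  note Dp = filtrationD[OF D]
  have PD: "P k * D i = 0" "D i * P k = 0" "P k + D i = P (k + i)" for i
    unfolding D_def by (simp_all add: left_diff_distrib right_diff_distrib Pp(5))
  define c where "c = Q l - f * p"
  have fpfp: "f * (p * (f * p)) = f * p" using fp by (simp add: assoc_rule[OF fp(7)] mult.assoc[symmetric])
  have c: "lin c" "c * c = c" unfolding c_def using fp Qp(2)
    by (auto simp: left_diff_distrib right_diff_distrib mult.assoc fpfp PP assoc_rule[OF fp(3)])
  have cQ: "c * Q l = c" "Q l * c = c" unfolding c_def using fp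
    by (auto simp: left_diff_distrib right_diff_distrib mult.assoc PP assoc_rule[OF fp(3)])
  have fgc: "fgen c" by (rule fgen_sub[OF Qp(3) c(1) cQ c(2)])
  have "\<exists>i. local_summand m c (D i)" if m: "maximal_ideal m" for m
  proof -
    obtain k' where k': "local_summand m (Q l) (P k')" using loc[OF m] by blast
    have "local_summand m (Q l) (P (k + k'))" by (rule local_summand_mono[OF k']) (auto simp: Pp(6,7))
    then have "local_summand m (Q l) (P k + D k')" unfolding PD .
    from local_cancellation[OF m Pp(2) PP(1) Pp(3) Dp(2) _ PD(1,2) Qp(2) PP(2) fp this] Dp(6)
    show ?thesis unfolding c_def by blast
  qed
  from local_to_global_splitting[OF c fgc D this]
  obtain i h h' where h: "lin h" "lin h'" "D i * h = h" "h * c = h" "c * h' = h'" "h' * D i = h'" "h' * h = c" by blast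
  \<comment> \<open>One step beyond \<open>i\<close>, so that \<open>n > k\<close> even when
    \<open>i = 0\<close>.\<close>
  define i' where "i' = Suc i"
  have DD: "D i' * D i = D i" "D i * D i' = D i" unfolding i'_def using Dp(6,7) by auto
  define n where "n = k + i'"
  have Dh: "D i' * h = h" "h' * D i' = h'" using DD h by (metis mult.assoc)+
  have fh: "f * h = 0" using fp(4) h(3) PD(1) by (metis mult.assoc mult_zero_left mult_zero_right)
  have hp: "h' * p = 0" using fp(5) h(6) PD(2) by (metis mult.assoc mult_zero_left mult_zero_right)
  have cf: "c * f = 0" unfolding c_def using fp by (simp add: left_diff_distrib mult.assoc)
  have hf: "h * f = 0" using h(4) cf by (metis mult.assoc mult_zero_right)
  have Pn: "P n * P k = P k" "P k * P n = P k" "P n * D i' = D i'" "D i' * P n = D i'"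
    unfolding n_def D_def by (simp_all add: left_diff_distrib right_diff_distrib Pp(5))
  define g where "g = p + h"
  define q where "q = f + h'"
  have "P n * p = p" "P n * h = h" "f * P n = f" "h' * P n = h'" using Pn fp Dh by (metis mult.assoc)+
  moreover have "h * Q l = h" "Q l * h' = h'" using cQ h by (metis mult.assoc)+
  ultimately have "P n * g = g" "g * Q l = g" "Q l * q = q" "q * P n = q" "lin g" "lin q"
    unfolding g_def q_def using fp h by (auto simp: distrib_left distrib_right)
  moreover have "q * g = Q l" unfolding g_def q_def by (simp add: distrib_left distrib_right fh hp h(7)) (simp add: c_def)
  moreover have "g * f = P k" unfolding g_def by (simp add: distrib_right fp hf)
  moreover have "n > k" by (simp add: n_def i'_def)
  ultimately show ?thesis by blast
qed

theorem filtered_isomorphism: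
  assumes P: "filtration P" and Q: "filtration Q"
    and locQP: "\<And>m l. maximal_ideal m \<Longrightarrow> \<exists>k. local_summand m (Q l) (P k)"
    and locPQ: "\<And>m l. maximal_ideal m \<Longrightarrow> \<exists>k. local_summand m (P l) (Q k)"
  shows "\<exists>F. bij_betw F {x. \<exists>k. app (P k) x = x} {x. \<exists>k. app (Q k) x = x} \<and>
    (\<forall>x\<in>{x. \<exists>k. app (P k) x = x}. \<forall>y\<in>{x. \<exists>k. app (P k) x = x}. F (x + y) = F x + F y) \<and>
    (\<forall>x\<in>{x. \<exists>k. app (P k) x = x}. \<forall>a. F (act x a) = act (F x) a)"
proof -
  note Pp = filtrationD[OF P] and Qp = filtrationD[OF Q]
  define St where "St = (\<lambda>(k, l, f, p). lin f \<and> lin p \<and> Q l * f = f \<and> f * P k = f \<and> P k * p = p \<and> p * Q l = p \<and> p * f = P k)"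
  \<comment> \<open>The condition \<open>f' * P k = f\<close> makes successive maps agree and yields
    the limit; \<open>f' * g = Q l\<close> says that \<open>f'\<close> reaches all of stage
    \<open>l\<close> and yields surjectivity. Injectivity comes from \<open>p * f = P k\<close> in
    \<open>St\<close>.\<close>
  define Tr where "Tr = (\<lambda>(k, l, f, p :: 'a endo) (k', l', f', p' :: 'a endo). k < k' \<and> l < l' \<and> f' * P k = f \<and>
    (\<exists>g. P k' * g = g \<and> f' * g = Q l))"
  have step: "\<exists>s'. St s' \<and> Tr s s'" if "St s" for s
  proof -
    obtain k l f p where s: "s = (k, l, f, p)" by (cases s)
    have fp: "lin f" "lin p" "Q l * f = f" "f * P k = f" "P k * p = p" "p * Q l = p" "p * f = P k"
      using that unfolding s St_def by auto
    obtain k' g q where g: "k' > k" "lin g" "lin q" "P k' * g = g" "g * Q l = g" "Q l * q = q" "q * P k' = q" "q * g = Q l" "g * f = P k"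
      using extend_splitting[OF P Q locQP fp] by blast
    \<comment> \<open>The same extension with \<open>P\<close> and \<open>Q\<close> exchanged,
      applied to \<open>g\<close>. It continues \<open>f\<close>, since
      \<open>f' P k = f' g f = Q l f = f\<close>.\<close>
    obtain l' f' p' where f': "l' > l" "lin f'" "lin p'" "Q l' * f' = f'" "f' * P k' = f'" "P k' * p' = p'" "p' * Q l' = p'"
        "p' * f' = P k'" "f' * g = Q l"
      using extend_splitting[OF Q P locPQ g(2-8)] by blast
    have "f' * P k = f" using g(9) f'(9) fp(3) by (metis mult.assoc)
    then have "Tr s (k', l', f', p')" unfolding s Tr_def using g f' by auto
    moreover have "St (k', l', f', p')" unfolding St_def using f' by auto
    ultimately show ?thesis by blast
  qed
  have "St (0, 0, 0, 0)" unfolding St_def using Pp(1) Qp(1) by auto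
  then obtain s where s: "\<And>n. St (s n)" "\<And>n. Tr (s n) (s (Suc n))"
    using dependent_nat_choice[of "\<lambda>_. St" "\<lambda>_. Tr"] step by metis
  define k where "k n = fst (s n)" for n
  define l where "l n = fst (snd (s n))" for n
  define f where "f n = fst (snd (snd (s n)))" for n
  define p where "p n = snd (snd (snd (s n)))" for n
  have sn: "s n = (k n, l n, f n, p n)" for n by (simp add: k_def l_def f_def p_def)
  have St: "lin (f n)" "Q (l n) * f n = f n" "p n * f n = P (k n)" for n
    using s(1)[of n] unfolding sn St_def by auto
  have Tr: "k n < k (Suc n)" "l n < l (Suc n)" "f (Suc n) * P (k n) = f n"
      "\<exists>g. P (k (Suc n)) * g = g \<and> f (Suc n) * g = Q (l n)" for n
    using s(2)[of n] unfolding sn Tr_def by auto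
  have mk: "strict_mono k" "strict_mono l" using Tr by (auto simp: strict_mono_Suc_iff)
  have fk: "f (n + j) * P (k n) = f n" for n j
  proof (induction j)
    case 0
    show ?case using s(1)[of n] unfolding sn St_def by auto
  next
    case (Suc j)
    have "k n \<le> k (n + j)" using mk(1) by (simp add: strict_mono_less_eq)
    then have "f (n + Suc j) * P (k n) = f (n + Suc j) * (P (k (n + j)) * P (k n))" by (simp add: Pp(7))
    also have "\<dots> = f (n + j) * P (k n)" using Tr(3)[of "n + j"] by (simp add: mult.assoc[symmetric])
    finally show ?case using Suc by simp
  qed
  let ?X = "{x. \<exists>k. app (P k) x = x}" and ?Y = "{x. \<exists>k. app (Q k) x = x}"
  have up: "app (P j) x = x" if "app (P i) x = x" "i \<le> j" for i j x using Pp(7)[OF that(2)] that(1) by (metis endo_app(6))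
  have upQ: "app (Q j) x = x" if "app (Q i) x = x" "i \<le> j" for i j x using Qp(7)[OF that(2)] that(1) by (metis endo_app(6))
  have ge: "n \<le> k n" "n \<le> l n" for n using mk by (simp_all add: strict_mono_imp_increasing)
  have ex: "\<exists>n. app (P (k n)) x = x" if "x \<in> ?X" for x using that up ge(1) by blast
  \<comment> \<open>Any stage containing \<open>x\<close> may be chosen, because
    \<open>f (n + j)\<close> restricts to \<open>f n\<close>.\<close>
  define N where "N x = (SOME n. app (P (k n)) x = x)" for x
  define F where "F x = app (f (N x)) x" for x
  have F: "F x = app (f n) x" if "app (P (k n)) x = x" for x n
  proof -
    have N: "app (P (k (N x))) x = x" unfolding N_def using that by (rule someI)
    have "app (f i) x = app (f j) x" if "app (P (k i)) x = x" "i \<le> j" for i j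
      using fk[of i "j - i"] that by (metis endo_app(6) le_add_diff_inverse)
    then show ?thesis unfolding F_def using N that by (metis nle_le)
  qed
  have common: "\<exists>n. app (P (k n)) x = x \<and> app (P (k n)) y = y" if "x \<in> ?X" "y \<in> ?X" for x y
  proof -
    obtain i j where "app (P (k i)) x = x" "app (P (k j)) y = y" using ex \<open>x \<in> ?X\<close> \<open>y \<in> ?X\<close> by blast
    then show ?thesis using up[of "k i" x "k (max i j)"] up[of "k j" y "k (max i j)"] mk(1)
      by (intro exI[of _ "max i j"]) (simp add: strict_mono_less_eq)
  qed
  have "inj_on F ?X"
  proof (rule inj_onI)
    fix x y assume xy: "x \<in> ?X" "y \<in> ?X" "F x = F y"
    obtain n where n: "app (P (k n)) x = x" "app (P (k n)) y = y" using common[OF xy(1,2)] by blast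
    then have "app (p n) (app (f n) x) = app (p n) (app (f n) y)" using xy(3) F by metis
    then show "x = y" using St(3)[of n] n by (metis endo_app(6))
  qed
  moreover have "F ` ?X = ?Y"
  proof
    show "F ` ?X \<subseteq> ?Y"
    proof
      fix y assume "y \<in> F ` ?X"
      then obtain x n where "app (P (k n)) x = x" "y = F x" using ex by blast
      then have "y = app (f n) x" using F by simp
      then have "app (Q (l n)) y = y" using St(2)[of n] by (metis endo_app(6))
      then show "y \<in> ?Y" by blast
    qed
    show "?Y \<subseteq> F ` ?X"
    proof
      fix y assume "y \<in> ?Y"
      then obtain i where "app (Q i) y = y" by blast
      then have y: "app (Q (l i)) y = y" using upQ ge(2) by blast
      obtain g where g: "P (k (Suc i)) * g = g" "f (Suc i) * g = Q (l i)" using Tr(4) by blast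
      have 1: "app (P (k (Suc i))) (app g y) = app g y" using g(1) by (metis endo_app(6))
      moreover from this have "F (app g y) = y" using F[OF 1] g(2) y by (metis endo_app(6))
      ultimately show "y \<in> F ` ?X" by (metis (mono_tags, lifting) image_eqI mem_Collect_eq)
    qed
  qed
  moreover have "F (x + y) = F x + F y" if xy: "x \<in> ?X" "y \<in> ?X" for x y
  proof -
    obtain n where n: "app (P (k n)) x = x" "app (P (k n)) y = y" using common[OF xy] by blast
    then have "app (P (k n)) (x + y) = x + y" by simp
    then show ?thesis using F[OF n(1)] F[OF n(2)] F[of n "x + y"] by simp
  qed
  moreover have "F (act x a) = act (F x) a" if x: "x \<in> ?X" for x a
  proof -
    obtain n where n: "app (P (k n)) x = x" using ex[OF x] by blast
    then have "app (P (k n)) (act x a) = act x a" by (simp add: linD[OF Pp(2)])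
    then show ?thesis using F n St(1) by (simp add: linD)
  qed
  ultimately show ?thesis unfolding bij_betw_def by (intro exI[of _ F]) blast
qed

end

section \<open>Generic splitting\<close>

context algebra_module
begin

text \<open>The kernel of the map from the algebra to its generic localization. The algebra may have
  torsion, so an equation in the generic algebra is written as torsion of a difference.\<close>

definition torsion :: "'l \<Rightarrow> bool" where
  "torsion x \<longleftrightarrow> (\<exists>r. r \<noteq> 0 \<and> phi r * x = 0)"

end

text \<open>The element e generates a minimal right ideal of the generic algebra, up to denominators; then every finitely
  generated torsion-free module is generically a direct sum of copies of this right ideal.\<close>

locale minimal_element_module = torsion_free_module phi act
  for phi :: "'r::idom \<Rightarrow> 'l::ring_1" and act :: "'a::ab_group_add \<Rightarrow> 'l \<Rightarrow> 'a" +
  fixes e :: 'l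
  assumes minimal: "\<not> torsion (e * x) \<Longrightarrow> \<exists>y r. r \<noteq> 0 \<and> torsion (e * x * y - phi r * e)"
    and full: "\<exists>r n a b. r \<noteq> 0 \<and> phi r = (\<Sum>i<(n::nat). a i * e * b i)"
begin

text \<open>Torsion-freeness of the module: generic identities in the algebra become exact
  identities on vectors.\<close>

lemma act_torsion:
  assumes "torsion x"
  shows "act v x = 0"
proof -
  obtain r where "r \<noteq> 0" "phi r * x = 0" using assms by (auto simp: torsion_def)
  then show ?thesis using smul_eq_0[of r "act v x"] act_phi_mult[of v r x] by simp
qed

definition rspan :: "'a set \<Rightarrow> 'a set" where
  "rspan B = {v. \<exists>x. v = (\<Sum>b\<in>B. act b (x b))}"

lemma rspan_add: "v \<in> rspan B \<Longrightarrow> w \<in> rspan B \<Longrightarrow> v + w \<in> rspan B"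
proof -
  assume "v \<in> rspan B" "w \<in> rspan B"
  then obtain x y where "v = (\<Sum>b\<in>B. act b (x b))" "w = (\<Sum>b\<in>B. act b (y b))" unfolding rspan_def by blast
  then have "v + w = (\<Sum>b\<in>B. act b (x b + y b))" by (simp add: sum.distrib)
  then show ?thesis unfolding rspan_def mem_Collect_eq by (rule exI[of _ "\<lambda>b. x b + y b"])
qed

lemma rspan_zero: "0 \<in> rspan B"
  unfolding rspan_def mem_Collect_eq by (rule exI[of _ "\<lambda>_. 0"]) simp

lemma rspan_act: "v \<in> rspan B \<Longrightarrow> act v a \<in> rspan B"
proof -
  assume "v \<in> rspan B"
  then obtain x where "v = (\<Sum>b\<in>B. act b (x b))" unfolding rspan_def by blast
  then have "act v a = (\<Sum>b\<in>B. act b (x b * a))" by (simp add: act_sum_left act_mult)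
  then show ?thesis unfolding rspan_def mem_Collect_eq by (rule exI[of _ "\<lambda>b. x b * a"])
qed

lemma rspan_smul: "v \<in> rspan B \<Longrightarrow> r \<cdot> v \<in> rspan B"
  unfolding smul_def by (rule rspan_act)

lemma rspan_base: "finite B \<Longrightarrow> b \<in> B \<Longrightarrow> b \<in> rspan B"
proof -
  assume "finite B" "b \<in> B"
  then have "b = (\<Sum>c\<in>B. act c (if c = b then 1 else 0))"
    using sum.delta'[of B b "\<lambda>c. c"] by (simp add: if_distrib[of "act _"] cong: if_cong)
  then show ?thesis unfolding rspan_def mem_Collect_eq by (rule exI[of _ "\<lambda>c. if c = b then 1 else 0"])
qed

lemma rspan_sum: "(\<And>i. i \<in> I \<Longrightarrow> v i \<in> rspan B) \<Longrightarrow> (\<Sum>i\<in>I. v i) \<in> rspan B"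
  by (induction I rule: infinite_finite_induct) (auto intro: rspan_add rspan_zero)

definition generating :: "'a endo \<Rightarrow> 'a set \<Rightarrow> bool" where
  "generating c B \<longleftrightarrow> finite B \<and> (\<forall>b\<in>B. app c b = b \<and> (\<exists>d. b = act d e)) \<and>
     (\<exists>r. r \<noteq> 0 \<and> (\<forall>y. r \<cdot> app c y \<in> rspan B))"

text \<open>Writing the scalar \<open>r\<close> as the sum of the \<open>a i e b i\<close> gives
  \<open>r g\<close> as the sum of the \<open>(g a i e) b i\<close> for each generator
  \<open>g\<close>, so the vectors \<open>g a i e\<close> span up to \<open>r\<close>.\<close>

lemma generating_exists:
  assumes c: "lin c" "fgen c"
  shows "\<exists>B. generating c B"
proof -
  obtain G where G: "finite G" "\<And>g. g \<in> G \<Longrightarrow> app c g = g" "\<And>x. \<exists>k. app c x = (\<Sum>g\<in>G. k g \<cdot> g)"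
    using c(2) unfolding fgen_def by blast
  obtain r n a b where r: "r \<noteq> 0" "phi r = (\<Sum>i<(n::nat). a i * e * b i)" using full by blast
  define B where "B = (\<lambda>(g, i). act (act g (a i)) e) ` (G \<times> {..<n})"
  have fB: "finite B" unfolding B_def using G(1) by simp
  have "r \<cdot> app c y \<in> rspan B" for y
  proof -
    obtain k where k: "app c y = (\<Sum>g\<in>G. k g \<cdot> g)" using G(3) by blast
    have "r \<cdot> g \<in> rspan B" if "g \<in> G" for g
    proof -
      have "r \<cdot> g = (\<Sum>i<n. act (act (act g (a i)) e) (b i))"
        unfolding smul_def r(2) by (simp add: act_sum_right act_mult)
      also have "\<dots> \<in> rspan B"
        by (intro rspan_sum rspan_act rspan_base[OF fB]) (use that in \<open>auto simp: B_def\<close>)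
      finally show ?thesis .
    qed
    then have "(\<Sum>g\<in>G. k g \<cdot> r \<cdot> g) \<in> rspan B" by (intro rspan_sum) (blast intro: rspan_smul)
    then show ?thesis unfolding k by (simp add: R.scale_sum_right mult.commute)
  qed
  then have "generating c B" unfolding generating_def using fB r(1) G(2) c(1) by (auto simp: B_def linD)
  then show ?thesis ..
qed

text \<open>A generic decomposition into copies of the minimal right ideal. Independence concerns
  \<open>e * x b\<close> and not \<open>x b\<close>, because \<open>b = act d e\<close> makes
  \<open>act b (x b)\<close> depend on \<open>e * x b\<close> alone.\<close>

definition generic_basis :: "'a endo \<Rightarrow> 'a set \<Rightarrow> 'r \<Rightarrow> bool" where
  "generic_basis c B r \<longleftrightarrow> finite B \<and> r \<noteq> 0 \<and> (\<forall>b\<in>B. app c b = b \<and> (\<exists>d. b = act d e)) \<and>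
    (\<forall>y. r \<cdot> app c y \<in> rspan B) \<and> (\<forall>x. (\<Sum>b\<in>B. act b (x b)) = 0 \<longrightarrow> (\<forall>b\<in>B. torsion (e * x b)))"

lemma generic_basisD:
  assumes "generic_basis c B r"
  shows "finite B" "r \<noteq> 0" "\<And>b. b \<in> B \<Longrightarrow> app c b = b" "\<And>b. b \<in> B \<Longrightarrow> \<exists>d. b = act d e"
    "\<And>y. r \<cdot> app c y \<in> rspan B" "\<And>x b. (\<Sum>b\<in>B. act b (x b)) = 0 \<Longrightarrow> b \<in> B \<Longrightarrow> torsion (e * x b)"
  using assms unfolding generic_basis_def by blast+

text \<open>A generating set of least size is independent: if \<open>e * x b\<close> is not torsion
  in a relation, minimality of \<open>e\<close> turns the term of \<open>b\<close> into
  \<open>s \<cdot> b\<close>, and \<open>b\<close> becomes redundant up to a scalar.\<close>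

lemma generic_basis_exists:
  assumes c: "lin c" "fgen c"
  shows "\<exists>B r. generic_basis c B r"
proof -
  obtain B where B: "generating c B" and min: "\<And>B'. generating c B' \<Longrightarrow> card B \<le> card B'"
    using ex_has_least_nat[of "generating c" _ card] generating_exists[OF c] by metis
  obtain r where fB: "finite B" and bB: "\<And>b. b \<in> B \<Longrightarrow> app c b = b" "\<And>b. b \<in> B \<Longrightarrow> \<exists>d. b = act d e"
    and r: "r \<noteq> 0" "\<And>y. r \<cdot> app c y \<in> rspan B"
    using B unfolding generating_def by blast
  have "torsion (e * x b)" if sum0: "(\<Sum>b\<in>B. act b (x b)) = 0" and b: "b \<in> B" for x b
  proof (rule ccontr)
    assume "\<not> torsion (e * x b)"
    then obtain y s where s: "s \<noteq> 0" "torsion (e * x b * y - phi s * e)" using minimal by blast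
    obtain d where d: "b = act d e" using bB(2) b by blast
    have "act b (x b * y) - s \<cdot> b = act d (e * x b * y - phi s * e)"
      using act_phi_mult[of d s e] by (simp add: d act_mult)
    then have sb: "s \<cdot> b = act b (x b * y)" using act_torsion[OF s(2)] by simp
    let ?B = "B - {b}"
    have fB': "finite ?B" using fB by simp
    have "act (\<Sum>b\<in>B. act b (x b)) y = act b (x b * y) + (\<Sum>b'\<in>?B. act b' (x b' * y))"
      unfolding act_sum_left act_mult[symmetric] using fB b by (rule sum.remove)
    then have "s \<cdot> b = (\<Sum>b'\<in>?B. act b' (- (x b' * y)))" using sum0 sb by (simp add: sum_negf eq_neg_iff_add_eq_0)
    then have sb': "s \<cdot> b \<in> rspan ?B" unfolding rspan_def mem_Collect_eq by (rule exI[of _ "\<lambda>b'. - (x b' * y)"])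
    have "(s * r) \<cdot> app c y \<in> rspan ?B" for y
    proof -
      obtain z where "r \<cdot> app c y = (\<Sum>b\<in>B. act b (z b))" using r(2)[of y] unfolding rspan_def by blast
      then have "r \<cdot> app c y = act b (z b) + (\<Sum>b\<in>?B. act b (z b))" using sum.remove[OF fB b, of "\<lambda>b. act b (z b)"] by simp
      then have "(s * r) \<cdot> app c y = s \<cdot> (act b (z b) + (\<Sum>b\<in>?B. act b (z b)))" by (metis R.scale_scale)
      also have "\<dots> = act (s \<cdot> b) (z b) + s \<cdot> (\<Sum>b\<in>?B. act b (z b))" by (simp add: R.scale_right_distrib smul_act)
      also have "\<dots> \<in> rspan ?B"
        by (rule rspan_add[OF rspan_act[OF sb'] rspan_smul]) (auto simp: rspan_def)
      finally show ?thesis .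
    qed
    moreover have "s * r \<noteq> 0" using s(1) r(1) by simp
    ultimately have "generating c ?B" unfolding generating_def using fB' bB by blast
    from min[OF this] show False using fB b by (metis card_Diff1_less not_le)
  qed
  then have "generic_basis c B r" unfolding generic_basis_def using fB r bB by blast
  then show ?thesis by blast
qed

text \<open>Coordinates exist after multiplication by \<open>r\<close> and are unique up to torsion
  after multiplication by \<open>e\<close> from the left. Hence images of the form
  \<open>act (\<gamma> b) e\<close> can be prescribed, and the choice of coordinates does not
  matter.\<close>

lemma generic_basis_map:
  assumes c: "lin c" "c * c = c" and gb: "generic_basis c B r"
  shows "\<exists>f. lin f \<and> f * c = f \<and>
    (\<forall>y x. r \<cdot> app c y = (\<Sum>b\<in>B. act b (x b)) \<longrightarrow> app f y = (\<Sum>b\<in>B. act (\<gamma> b) (e * x b)))"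
proof -
  note B = generic_basisD[OF gb]
  have "\<forall>y. \<exists>x. r \<cdot> app c y = (\<Sum>b\<in>B. act b (x b))" using B(5) unfolding rspan_def by blast
  then obtain X where X: "\<And>y. r \<cdot> app c y = (\<Sum>b\<in>B. act b (X y b))" by metis
  define F where "F y = (\<Sum>b\<in>B. act (\<gamma> b) (e * X y b))" for y
  have F: "F y = (\<Sum>b\<in>B. act (\<gamma> b) (e * x b))" if "r \<cdot> app c y = (\<Sum>b\<in>B. act b (x b))" for y x
  proof -
    have "(\<Sum>b\<in>B. act b (X y b - x b)) = 0" using X[of y] that by (simp add: sum_subtractf)
    from B(6)[OF this] have "act (\<gamma> b) (e * X y b) = act (\<gamma> b) (e * x b)" if "b \<in> B" for b
      using act_torsion[of "e * (X y b - x b)" "\<gamma> b"] that by (simp add: right_diff_distrib)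
    then show ?thesis unfolding F_def by simp
  qed
  have add: "F (y + z) = F y + F z" for y z
  proof -
    have "r \<cdot> app c (y + z) = (\<Sum>b\<in>B. act b (X y b + X z b))"
      using X[of y] X[of z] by (simp add: R.scale_right_distrib sum.distrib)
    then have "F (y + z) = (\<Sum>b\<in>B. act (\<gamma> b) (e * (X y b + X z b)))" by (rule F)
    then show ?thesis by (simp add: F_def distrib_left sum.distrib)
  qed
  have fa: "F (act y a) = act (F y) a" for y a
  proof -
    have "r \<cdot> app c (act y a) = (\<Sum>b\<in>B. act b (X y b * a))"
      using X[of y] by (simp add: linD[OF c(1)] smul_act act_sum_left act_mult)
    then have "F (act y a) = (\<Sum>b\<in>B. act (\<gamma> b) (e * (X y b * a)))" by (rule F)
    then show ?thesis by (simp add: F_def act_sum_left act_mult)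
  qed
  have Fc: "F (app c y) = F y" for y
    using F[of "app c y" "X y"] X[of y] c(2) unfolding F_def by (metis endo_app(6))
  have appF: "app (Endo F) = F" using add by (rule app_Endo)
  have "lin (Endo F)" unfolding lin_def appF using fa by blast
  moreover have "Endo F * c = Endo F" by (rule endo_eqI) (simp add: appF Fc)
  ultimately show ?thesis using F by (intro exI[of _ "Endo F"]) (simp add: appF)
qed

text \<open>The vector \<open>b\<close> generates a generic copy of the minimal right ideal on which
  maps to arbitrary targets \<open>act \<gamma> e\<close> are induced, up to \<open>r\<close>, by
  endomorphisms of the whole module.\<close>

definition generic_copy :: "'a endo \<Rightarrow> 'a \<Rightarrow> 'a \<Rightarrow> 'r \<Rightarrow> bool" where
  "generic_copy d b v r \<longleftrightarrow> r \<noteq> 0 \<and> app d b = b \<and> b = act v e \<and>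
    (\<forall>\<gamma>. \<exists>f. lin f \<and> (\<forall>x. app f (act b x) = r \<cdot> act \<gamma> (e * x)))"

text \<open>Any member of a generic basis serves, with \<open>\<gamma>\<close> prescribed on it and
  0 on the others; the basis is non-empty because \<open>d \<noteq> 0\<close> and the module is
  torsion-free.\<close>

lemma nonzero_generic_summand:
  assumes d: "lin d" "d * d = d" "fgen d" "d \<noteq> 0"
  shows "\<exists>b v r. generic_copy d b v r"
proof -
  obtain B r where gb: "generic_basis d B r" using generic_basis_exists[OF d(1,3)] by blast
  note B = generic_basisD[OF gb]
  have "B \<noteq> {}"
  proof
    assume "B = {}"
    then have "app d y = 0" for y using B(5)[of y] smul_eq_0[OF B(2), of "app d y"] by (simp add: rspan_def)
    then show False using d(4) endo_eqI[of d 0] by simp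
  qed
  then obtain b where b: "b \<in> B" by blast
  obtain v where v: "b = act v e" using B(4)[OF b] by blast
  have "\<exists>f. lin f \<and> (\<forall>x. app f (act b x) = r \<cdot> act \<gamma> (e * x))" for \<gamma>
  proof -
    obtain f where f: "lin f" "\<And>y x. r \<cdot> app d y = (\<Sum>c\<in>B. act c (x c)) \<Longrightarrow>
        app f y = (\<Sum>c\<in>B. act (if c = b then \<gamma> else 0) (e * x c))"
      using generic_basis_map[OF d(1,2) gb, of "\<lambda>c. if c = b then \<gamma> else 0"] by blast
    have "app f (act b x) = r \<cdot> act \<gamma> (e * x)" for x
    proof -
      define z where "z c = (if c = b then phi r * x else 0)" for c
      have "(\<Sum>c\<in>B. act c (z c)) = (\<Sum>c\<in>B. if c = b then act b (phi r * x) else 0)"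
        unfolding z_def by (intro sum.cong) auto
      also have "\<dots> = r \<cdot> app d (act b x)" using B(1,3) b by (simp add: linD[OF d(1)] act_phi_mult)
      finally have "app f (act b x) = (\<Sum>c\<in>B. act (if c = b then \<gamma> else 0) (e * z c))" using f(2) by simp
      also have "\<dots> = (\<Sum>c\<in>B. if c = b then act \<gamma> (e * (phi r * x)) else 0)"
        unfolding z_def by (intro sum.cong) auto
      also have "\<dots> = act \<gamma> (phi r * (e * x))" using B(1) b phi_central[of r e] by (simp add: mult.assoc[symmetric])
      finally show ?thesis by (simp only: act_phi_mult)
    qed
    then show ?thesis using f(1) by blast
  qed
  then have "generic_copy d b v r" unfolding generic_copy_def using B(2,3) b v by blast
  then show ?thesis by blast
qed

text \<open>Only the number of copies counts: the image of \<open>c\<close> is generically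
  \<open>card B\<close> copies of one minimal right ideal, and each difference of successive stages,
  being non-zero, contains at least one. The bijection \<open>idx\<close> matches basis vectors with
  consecutive differences.\<close>

lemma generic_splitting_of_filtration:
  assumes c: "lin c" "c * c = c" "fgen c" and D: "filtration D"
  shows "\<exists>n'>n. \<exists>f g s. s \<noteq> 0 \<and> lin f \<and> lin g \<and> (D n' - D n) * f = f \<and> f * c = f \<and> c * g = g \<and>
        g * (D n' - D n) = g \<and> g * f = sc s * c"
proof -
  note Dp = filtrationD[OF D]
  obtain B r where gb: "generic_basis c B r" using generic_basis_exists[OF c(1,3)] by blast
  note B = generic_basisD[OF gb]
  obtain v where v: "\<And>b. b \<in> B \<Longrightarrow> b = act (v b) e" using B(4) by metis
  obtain idx where "bij_betw idx B {0..<card B}" using ex_bij_betw_finite_nat[OF B(1)] by blast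
  then have idx: "inj_on idx B" "\<And>b. b \<in> B \<Longrightarrow> idx b < card B" by (auto simp: bij_betw_def)
  define E where "E j = D (n + Suc j) - D (n + j)" for j
  have EE: "E i * E j = (if i = j then E i else 0)" for i j
  proof (cases i j rule: linorder_cases)
    case less
    then show ?thesis by (simp add: E_def left_diff_distrib right_diff_distrib Dp(5) min_def)
  next
    case equal
    then show ?thesis by (simp add: E_def left_diff_distrib right_diff_distrib Dp(5))
  next
    case greater
    then show ?thesis
      by (cases "i = Suc j") (simp_all add: E_def left_diff_distrib right_diff_distrib Dp(5) min_def)
  qed
  have lE: "lin (E j)" for j unfolding E_def using Dp(2) by (intro lin_closed)
  have "fgen (E j)" for j
    by (rule fgen_sub[OF Dp(3)[of "n + Suc j"] lE])
       (simp add: E_def left_diff_distrib right_diff_distrib Dp(5), simp add: E_def left_diff_distrib right_diff_distrib Dp(5), simp add: EE)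
  moreover have "E j \<noteq> 0" for j using Dp(4)[of "n + j"] by (simp add: E_def)
  ultimately have "\<exists>b v r. generic_copy (E j) b v r" for j
    using nonzero_generic_summand[OF lE] EE[of j j] by auto
  then obtain w u s where "\<And>j. generic_copy (E j) (w j) (u j) (s j)" by metis
  then have w: "\<And>j. s j \<noteq> 0" "\<And>j. app (E j) (w j) = w j" "\<And>j. w j = act (u j) e"
      "\<And>j \<gamma>. \<exists>f. lin f \<and> (\<forall>x. app f (act (w j) x) = s j \<cdot> act \<gamma> (e * x))"
    unfolding generic_copy_def by blast+
  have "\<forall>b. \<exists>f. lin f \<and> (\<forall>x. app f (act (w (idx b)) x) = s (idx b) \<cdot> act (v b) (e * x))" using w(4) by blast
  \<comment> \<open>The way back: \<open>\<phi> b\<close> sends the copy generated by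
    \<open>w (idx b)\<close> to the one generated by \<open>b\<close>, up to
    \<open>s (idx b)\<close>.\<close>
  then obtain \<phi> where \<phi>: "\<And>b. lin (\<phi> b)" "\<And>b x. app (\<phi> b) (act (w (idx b)) x) = s (idx b) \<cdot> act (v b) (e * x)"
    by (elim choice[THEN exE]) blast
  obtain f where f: "lin f" "f * c = f"
    and fval: "\<And>y x. r \<cdot> app c y = (\<Sum>b\<in>B. act b (x b)) \<Longrightarrow> app f y = (\<Sum>b\<in>B. act (u (idx b)) (e * x b))"
    using generic_basis_map[OF c(1,2) gb, of "\<lambda>b. u (idx b)"] by blast
  \<comment> \<open>The first \<open>card B\<close> differences suffice; the additional one keeps
    \<open>n' > n\<close> when \<open>B\<close> is empty.\<close>
  define n' where "n' = n + Suc (card B)"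
  define \<Delta> where "\<Delta> = D n' - D n"
  have lD: "lin \<Delta>" unfolding \<Delta>_def using Dp(2) by (intro lin_closed)
  have DD: "\<Delta> * \<Delta> = \<Delta>" unfolding \<Delta>_def n'_def by (simp add: left_diff_distrib right_diff_distrib Dp(5) min_def)
  have DE: "\<Delta> * E j = E j" if "j < card B" for j
    unfolding \<Delta>_def n'_def E_def using that by (simp add: left_diff_distrib right_diff_distrib Dp(5) min_def)
  \<comment> \<open>The copies come with different scalars; the cofactors \<open>\<rho>' b\<close>
    bring them to the common multiple \<open>\<rho>\<close>.\<close>
  define \<rho> where "\<rho> = (\<Prod>b\<in>B. s (idx b))"
  define \<rho>' where "\<rho>' b = (\<Prod>b\<in>B - {b}. s (idx b))" for b
  have \<rho>: "\<rho>' b * s (idx b) = \<rho>" if "b \<in> B" for b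
    using prod.remove[OF B(1) that, of "\<lambda>b. s (idx b)"] by (simp add: \<rho>_def \<rho>'_def mult.commute)
  define g where "g = (\<Sum>b\<in>B. sc (\<rho>' b) * (\<phi> b * E (idx b)))"
  have lg: "lin g" unfolding g_def using \<phi>(1) lE by (intro lin_sum lin_closed)
  have Df: "\<Delta> * f = f"
  proof (rule endo_eqI)
    fix y
    obtain x where x: "r \<cdot> app c y = (\<Sum>b\<in>B. act b (x b))" using B(5)[of y] unfolding rspan_def by blast
    have "app \<Delta> (act (u (idx b)) (e * x b)) = act (u (idx b)) (e * x b)" if "b \<in> B" for b
    proof -
      have "app \<Delta> (w (idx b)) = w (idx b)" using DE[OF idx(2)[OF that]] w(2) by (metis endo_app(6))
      then show ?thesis using w(3)[of "idx b"] by (simp add: act_mult linD[OF lD])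
    qed
    then show "app (\<Delta> * f) y = app f y" by (simp add: fval[OF x] app_sum)
  qed
  have gf: "g * f = sc (\<rho> * r) * c"
  proof (rule endo_eqI)
    fix y
    obtain x where x: "r \<cdot> app c y = (\<Sum>b\<in>B. act b (x b))" using B(5)[of y] unfolding rspan_def by blast
    have E_f: "app (E (idx b)) (app f y) = act (w (idx b)) (x b)" if b: "b \<in> B" for b
    proof -
      have "app (E (idx b)) (act (u (idx b')) (e * x b')) = (if b' = b then act (w (idx b)) (x b) else 0)" if b': "b' \<in> B" for b'
      proof -
        have "app (E (idx b)) (w (idx b')) = app (E (idx b) * E (idx b')) (w (idx b'))" by (simp add: w(2))
        also have "\<dots> = (if b' = b then w (idx b) else 0)"
          using EE[of "idx b" "idx b'"] w(2)[of "idx b"] inj_onD[OF idx(1), of b b'] b b' by auto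
        finally show ?thesis using w(3)[of "idx b'"] by (simp add: act_mult linD[OF lE])
      qed
      then have "app (E (idx b)) (app f y) = (\<Sum>b'\<in>B. if b' = b then act (w (idx b)) (x b) else 0)"
        unfolding fval[OF x] app_sum by (intro sum.cong) auto
      then show ?thesis using B(1) b by simp
    qed
    have "app (g * f) y = (\<Sum>b\<in>B. \<rho>' b \<cdot> app (\<phi> b) (app (E (idx b)) (app f y)))"
      unfolding g_def by (simp add: app_sum_endo)
    also have "\<dots> = (\<Sum>b\<in>B. \<rho> \<cdot> act b (x b))"
    proof (intro sum.cong refl)
      fix b assume b: "b \<in> B"
      have "\<rho>' b \<cdot> app (\<phi> b) (app (E (idx b)) (app f y)) = \<rho>' b \<cdot> s (idx b) \<cdot> act (v b) (e * x b)"
        unfolding E_f[OF b] \<phi>(2) ..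
      also have "\<dots> = \<rho> \<cdot> act (act (v b) e) (x b)" using \<rho>[OF b] by (simp add: act_mult)
      finally show "\<rho>' b \<cdot> app (\<phi> b) (app (E (idx b)) (app f y)) = \<rho> \<cdot> act b (x b)" using v[OF b] by simp
    qed
    also have "\<dots> = \<rho> \<cdot> r \<cdot> app c y" unfolding x by (simp add: R.scale_sum_right)
    finally show "app (g * f) y = app (sc (\<rho> * r) * c) y" by simp
  qed
  \<comment> \<open>Composing \<open>g\<close> with \<open>c\<close> and \<open>\<Delta>\<close>
    enforces the required source and target and does not change the product with
    \<open>f\<close>.\<close>
  have "(c * g * \<Delta>) * f = sc (\<rho> * r) * c"
    using sc_comm(2)[OF c(1)] by (simp add: mult.assoc Df gf c(2))
  moreover have "\<rho> * r \<noteq> 0" using B(1,2) w(1) by (simp add: \<rho>_def)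
  moreover have "n' > n" by (simp add: n'_def)
  ultimately show ?thesis using f lg lD c Df DD unfolding \<Delta>_def
    by (intro exI[of _ n'] conjI exI[of _ f] exI[of _ "c * g * (D n' - D n)"] exI[of _ "\<rho> * r"])
       (auto simp: mult.assoc assoc_rule[OF c(2)])
qed

end

section \<open>Localization\<close>

definition multiplicative_set :: "'r::comm_ring_1 set \<Rightarrow> bool" where
  "multiplicative_set S \<longleftrightarrow> 1 \<in> S \<and> (\<forall>s\<in>S. \<forall>t\<in>S. s * t \<in> S)"

lemma simple_artinianD:
  assumes "simple_artinian C p q z u"
  shows "\<not> (\<exists>I :: nat \<Rightarrow> 'a set. \<forall>n. right_ideal_in C p q z (I n) \<and> I (Suc n) \<subset> I n)"
    "twosided_ideal_in C p q z I \<Longrightarrow> I = {z} \<or> I = C" "z \<noteq> u"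
  using assms by (simp_all add: simple_artinian_def)

context algebra_module
begin

abbreviation cls :: "'r set \<Rightarrow> 'a \<Rightarrow> 'r \<Rightarrow> ('a \<times> 'r) set" where
  "cls S x s \<equiv> loc_class phi act S UNIV (x, s)"

abbreviation alg_cls :: "'r set \<Rightarrow> 'l \<Rightarrow> 'r \<Rightarrow> ('l \<times> 'r) set" where
  "alg_cls S x s \<equiv> loc_class phi (*) S UNIV (x, s)"

lemma loc_rel_iff:
  "((x, s), (y, t)) \<in> loc_rel phi act S UNIV \<longleftrightarrow> s \<in> S \<and> t \<in> S \<and> (\<exists>u\<in>S. (t * u) \<cdot> x = (s * u) \<cdot> y)"
  by (auto simp: loc_rel_def smul_def)

lemma loc_rel_equiv:
  assumes "multiplicative_set S"
  shows "equiv (UNIV \<times> S) (loc_rel phi act S UNIV)"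
proof (rule equivI)
  have S: "1 \<in> S" "\<And>s t. s \<in> S \<Longrightarrow> t \<in> S \<Longrightarrow> s * t \<in> S" using assms by (auto simp: multiplicative_set_def)
  show "loc_rel phi act S UNIV \<subseteq> (UNIV \<times> S) \<times> (UNIV \<times> S)" by (auto simp: loc_rel_def)
  show "refl_on (UNIV \<times> S) (loc_rel phi act S UNIV)" using S(1) by (auto simp: refl_on_def loc_rel_iff)
  show "sym (loc_rel phi act S UNIV)" by (rule symI) (auto simp: loc_rel_iff, metis)
  show "trans (loc_rel phi act S UNIV)"
  proof (rule transI, clarify)
    fix x s y t z r assume "((x, s), (y, t)) \<in> loc_rel phi act S UNIV" "((y, t), (z, r)) \<in> loc_rel phi act S UNIV"
    then obtain u v where uv: "s \<in> S" "t \<in> S" "r \<in> S" "u \<in> S" "v \<in> S" "(t * u) \<cdot> x = (s * u) \<cdot> y" "(r * v) \<cdot> y = (t * v) \<cdot> z"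
      by (auto simp: loc_rel_iff)
    have "(r * (t * u * v)) \<cdot> x = (r * v) \<cdot> (t * u) \<cdot> x" by (simp add: ac_simps)
    also have "\<dots> = (s * u) \<cdot> (r * v) \<cdot> y" unfolding uv(6) by (simp add: ac_simps)
    also have "\<dots> = (s * (t * u * v)) \<cdot> z" unfolding uv(7) by (simp add: ac_simps)
    finally show "((x, s), (z, r)) \<in> loc_rel phi act S UNIV"
      using uv S(2) unfolding loc_rel_iff by blast
  qed
qed

lemma cls_eq_iff:
  assumes "multiplicative_set S" "s \<in> S" "t \<in> S"
  shows "cls S x s = cls S y t \<longleftrightarrow> (\<exists>u\<in>S. (t * u) \<cdot> x = (s * u) \<cdot> y)"
  using eq_equiv_class_iff[OF loc_rel_equiv[OF assms(1)], of "(x, s)" "(y, t)"] assms(2,3)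
  by (auto simp: loc_class_def loc_rel_iff)

lemma loc_carrier_iff: "c \<in> loc_carrier phi act S UNIV \<longleftrightarrow> (\<exists>x. \<exists>s\<in>S. c = cls S x s)"
  by (auto simp: loc_carrier_def quotient_def loc_class_def)

lemma mem_cls_iff:
  "(y, t) \<in> cls S x s \<longleftrightarrow> s \<in> S \<and> t \<in> S \<and> (\<exists>u\<in>S. (t * u) \<cdot> x = (s * u) \<cdot> y)"
  by (simp add: loc_class_def loc_rel_iff)

lemma cls_self: "multiplicative_set S \<Longrightarrow> s \<in> S \<Longrightarrow> (x, s) \<in> cls S x s"
  unfolding loc_class_def using equiv_class_self[OF loc_rel_equiv] by blast

text \<open>Sums and products of fractions are defined as unions over all pairs of representatives;
  once the result is independent of these, the union is a single class.\<close>

lemma UN2_constant: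
  assumes "a \<in> A" "b \<in> B" "\<And>x s y t. (x, s) \<in> A \<Longrightarrow> (y, t) \<in> B \<Longrightarrow> f x s y t = c"
  shows "(\<Union>(x, s)\<in>A. \<Union>(y, t)\<in>B. f x s y t) = c"
proof -
  have "(case p of (x, s) \<Rightarrow> \<Union>(y, t)\<in>B. f x s y t) = c" if "p \<in> A" for p
  proof -
    have "(\<Union>q\<in>B. case q of (y, t) \<Rightarrow> f (fst p) (snd p) y t) = (\<Union>q\<in>B. c)"
      using assms(3)[of "fst p" "snd p"] that by (intro SUP_cong) auto
    then show ?thesis using assms(2) by (auto simp: case_prod_unfold)
  qed
  then have "(\<Union>p\<in>A. case p of (x, s) \<Rightarrow> \<Union>(y, t)\<in>B. f x s y t) = (\<Union>p\<in>A. c)" by (intro SUP_cong) auto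
  then show ?thesis using assms(1) by auto
qed

lemma loc_add_cls:
  assumes S: "multiplicative_set S" and "s \<in> S" "t \<in> S"
  shows "loc_add phi act S UNIV (cls S x s) (cls S y t) = cls S (t \<cdot> x + s \<cdot> y) (s * t)"
  unfolding loc_add_def
proof (rule UN2_constant[OF cls_self[OF S assms(2), of x] cls_self[OF S assms(3), of y]])
  have Sm: "\<And>s t. s \<in> S \<Longrightarrow> t \<in> S \<Longrightarrow> s * t \<in> S" using S by (auto simp: multiplicative_set_def)
  fix x' s' y' t' assume "(x', s') \<in> cls S x s" "(y', t') \<in> cls S y t"
  then obtain u v where p: "s' \<in> S" "u \<in> S" "(s' * u) \<cdot> x = (s * u) \<cdot> x'"
    and q: "t' \<in> S" "v \<in> S" "(t' * v) \<cdot> y = (t * v) \<cdot> y'" unfolding mem_cls_iff by blast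
  have "((s' * t') * (u * v)) \<cdot> (t \<cdot> x + s \<cdot> y) = (t * t' * v) \<cdot> (s' * u) \<cdot> x + (s * s' * u) \<cdot> (t' * v) \<cdot> y"
    by (simp add: R.scale_right_distrib ac_simps)
  also have "\<dots> = ((s * t) * (u * v)) \<cdot> (t' \<cdot> x' + s' \<cdot> y')"
    unfolding p(3) q(3) by (simp add: R.scale_right_distrib ac_simps)
  finally have "\<exists>w\<in>S. ((s' * t') * w) \<cdot> (t \<cdot> x + s \<cdot> y) = ((s * t) * w) \<cdot> (t' \<cdot> x' + s' \<cdot> y')"
    using Sm[OF p(2) q(2)] by blast
  then have "cls S (t \<cdot> x + s \<cdot> y) (s * t) = cls S (t' \<cdot> x' + s' \<cdot> y') (s' * t')"
    using cls_eq_iff[OF S] Sm assms(2,3) p(1) q(1) by blast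
  then show "cls S (act x' (phi t') + act y' (phi s')) (s' * t') = cls S (t \<cdot> x + s \<cdot> y) (s * t)"
    by (simp add: smul_def)
qed

end

text \<open>The algebra as a right module over itself, so that the facts about fractions of vectors
  also describe the localized algebra.\<close>

lemma (in algebra_module) regular_algebra_module: "algebra_module phi (*)"
proof
  show "R_algebra phi" by (rule algebra)
  show "rmodule ((*) :: 'l \<Rightarrow> 'l \<Rightarrow> 'l)" by (simp add: rmodule_def algebra_simps)
qed

context algebra_module
begin

lemma loc_smult_cls:
  assumes S: "multiplicative_set S" and "s \<in> S" "t \<in> S"
  shows "loc_smult phi act S UNIV (cls S x s) (alg_cls S a t) = cls S (act x a) (s * t)"
proof -
  interpret L: algebra_module phi "(*)" by (rule regular_algebra_module)
  have Sm: "\<And>s t. s \<in> S \<Longrightarrow> t \<in> S \<Longrightarrow> s * t \<in> S" using S by (auto simp: multiplicative_set_def)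
  show ?thesis unfolding loc_smult_def
  proof (rule UN2_constant[OF cls_self[OF S assms(2), of x] L.cls_self[OF S assms(3), of a]])
    fix x' s' a' t' assume "(x', s') \<in> cls S x s" "(a', t') \<in> alg_cls S a t"
    then obtain u v where p: "s' \<in> S" "u \<in> S" "(s' * u) \<cdot> x = (s * u) \<cdot> x'"
      and q: "t' \<in> S" "v \<in> S" "L.smul (t' * v) a = L.smul (t * v) a'" unfolding mem_cls_iff L.mem_cls_iff by blast
    have q': "phi (t' * v) * a = phi (t * v) * a'" using q(3) by (simp add: L.smul_def phi_central)
    have "((s' * t') * (u * v)) \<cdot> act x a = act ((s' * u) \<cdot> x) (phi (t' * v) * a)"
      by (simp add: act_phi_mult smul_act ac_simps)
    also have "\<dots> = ((s * t) * (u * v)) \<cdot> act x' a'"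
      unfolding p(3) q' by (simp add: act_phi_mult smul_act ac_simps)
    finally have "\<exists>w\<in>S. ((s' * t') * w) \<cdot> act x a = ((s * t) * w) \<cdot> act x' a'"
      using Sm[OF p(2) q(2)] by blast
    then have "cls S (act x a) (s * t) = cls S (act x' a') (s' * t')"
      using cls_eq_iff[OF S] Sm assms(2,3) p(1) q(1) by blast
    then show "cls S (act x' a') (s' * t') = cls S (act x a) (s * t)" ..
  qed
qed

section \<open>A minimal right ideal of the generic algebra and the two-sided ideal it
  generates\<close>

inductive_set ideal_span :: "'l \<Rightarrow> 'l set" for e where
  ideal_span_zero: "0 \<in> ideal_span e"
| ideal_span_step: "w \<in> ideal_span e \<Longrightarrow> w + a * e * b \<in> ideal_span e"

lemma ideal_span_add: "v \<in> ideal_span e \<Longrightarrow> w \<in> ideal_span e \<Longrightarrow> w + v \<in> ideal_span e"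
  by (induction rule: ideal_span.induct) (auto simp: add.assoc[symmetric] intro: ideal_span_step)

lemma ideal_span_mult: "w \<in> ideal_span e \<Longrightarrow> a * w \<in> ideal_span e" "w \<in> ideal_span e \<Longrightarrow> w * a \<in> ideal_span e"
proof -
  show "a * w \<in> ideal_span e" if "w \<in> ideal_span e" using that
  proof (induction rule: ideal_span.induct)
    case (ideal_span_step w c b)
    then show ?case using ideal_span.ideal_span_step[of "a * w" e "a * c" b] by (simp add: distrib_left mult.assoc)
  qed (simp add: ideal_span_zero)
  show "w * a \<in> ideal_span e" if "w \<in> ideal_span e" using that
  proof (induction rule: ideal_span.induct)
    case (ideal_span_step w c b)
    then show ?case using ideal_span.ideal_span_step[of "w * a" e c "b * a"] by (simp add: distrib_right mult.assoc)
  qed (simp add: ideal_span_zero)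
qed

lemma ideal_span_sum: "w \<in> ideal_span e \<Longrightarrow> \<exists>n a b. w = (\<Sum>i<(n::nat). a i * e * b i)"
proof (induction rule: ideal_span.induct)
  case ideal_span_zero
  show ?case by (rule exI[of _ 0]) simp
next
  case (ideal_span_step w c d)
  then obtain n a b where w: "w = (\<Sum>i<(n::nat). a i * e * b i)" by blast
  have "w + c * e * d = (\<Sum>i<Suc n. (a(n := c)) i * e * (b(n := d)) i)" unfolding w by simp
  then show ?case by blast
qed

text \<open>If every non-torsion \<open>e\<close> had a multiple \<open>e x\<close> generating a
  smaller non-zero right ideal generically, iteration from 1 would give an infinite descending
  chain. For a minimal \<open>e\<close>, simplicity puts 1 into the two-sided ideal generated by
  \<open>e\<close>, and clearing denominators produces the scalar \<open>phi r\<close>.\<close>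

lemma minimal_element_exists:
  assumes "tensor_Q_simple_artinian phi"
  shows "\<exists>e. (\<forall>x. \<not> torsion (e * x) \<longrightarrow> (\<exists>y r. r \<noteq> 0 \<and> torsion (e * x * y - phi r * e))) \<and>
    (\<exists>r n a b. r \<noteq> 0 \<and> phi r = (\<Sum>i<(n::nat). a i * e * b i))"
proof -
  interpret L: algebra_module phi "(*)" by (rule regular_algebra_module)
  define S where "S = UNIV - {0::'r}"
  have S: "multiplicative_set S" and S1: "1 \<in> S" and Sm: "\<And>s t. s \<in> S \<Longrightarrow> t \<in> S \<Longrightarrow> s * t \<in> S"
    and S0: "\<And>s. s \<in> S \<longleftrightarrow> s \<noteq> 0" by (auto simp: S_def multiplicative_set_def)
  let ?C = "loc_alg_carrier phi S" and ?add = "loc_add phi (*) S UNIV" and ?mul = "loc_smult phi (*) S UNIV"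
  let ?c = "\<lambda>x s. loc_class phi (*) S UNIV (x, s)"
  have sa: "simple_artinian ?C ?add ?mul (?c 0 1) (?c 1 1)"
    using assms by (simp add: tensor_Q_simple_artinian_def S_def)
  have chain: "\<not> (\<exists>I :: nat \<Rightarrow> ('l \<times> 'r) set set. \<forall>n. right_ideal_in ?C ?add ?mul (?c 0 1) (I n) \<and> I (Suc n) \<subset> I n)"
    and simple: "\<And>I. twosided_ideal_in ?C ?add ?mul (?c 0 1) I \<Longrightarrow> I = {?c 0 1} \<or> I = ?C" and one: "?c 0 1 \<noteq> ?c 1 1"
    by (rule simple_artinianD(1)[OF sa], erule simple_artinianD(2)[OF sa], rule simple_artinianD(3)[OF sa])
  have eq: "?c x s = ?c y t \<longleftrightarrow> (\<exists>u. u \<noteq> 0 \<and> x * phi (t * u) = y * phi (s * u))" if "s \<in> S" "t \<in> S" for x y s t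
    using L.cls_eq_iff[OF S that] S0 by (auto simp: L.smul_def)
  have add: "?add (?c x s) (?c y t) = ?c (x * phi t + y * phi s) (s * t)" if "s \<in> S" "t \<in> S" for x y s t
    using L.loc_add_cls[OF S that] by (simp add: L.smul_def)
  have mul: "?mul (?c x s) (?c y t) = ?c (x * y) (s * t)" if "s \<in> S" "t \<in> S" for x y s t
    using L.loc_smult_cls[OF S that] by simp
  have C: "c \<in> ?C \<longleftrightarrow> (\<exists>x. \<exists>s\<in>S. c = ?c x s)" for c by (rule L.loc_carrier_iff)
  have tors: "?c x s = ?c 0 1 \<longleftrightarrow> torsion x" if "s \<in> S" for x s
    using eq[OF that S1, of x 0] by (auto simp: torsion_def phi_central)
  have "\<exists>e. \<not> torsion e \<and> (\<forall>x. \<not> torsion (e * x) \<longrightarrow> (\<exists>y r. r \<noteq> 0 \<and> torsion (e * x * y - phi r * e)))"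
  proof (rule ccontr)
    assume "\<not> ?thesis"
    then have "\<forall>e. \<exists>x. \<not> torsion e \<longrightarrow> \<not> torsion (e * x) \<and> (\<forall>y r. r \<noteq> 0 \<longrightarrow> \<not> torsion (e * x * y - phi r * e))" by blast
    then obtain X where X: "\<And>e. \<not> torsion e \<Longrightarrow> \<not> torsion (e * X e)"
        "\<And>e y r. \<not> torsion e \<Longrightarrow> r \<noteq> 0 \<Longrightarrow> \<not> torsion (e * X e * y - phi r * e)"
      by (elim choice[THEN exE]) blast
    define E where "E n = ((\<lambda>e. e * X e) ^^ n) 1" for n
    have E_Suc: "E (Suc n) = E n * X (E n)" for n by (simp add: E_def)
    have "\<not> torsion 1" using one tors[OF S1, of 1] by simp
    then have E: "\<not> torsion (E n)" for n by (induction n) (auto simp: E_Suc X(1), simp add: E_def)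
    define I where "I n = {c. \<exists>y. \<exists>s\<in>S. c = ?c (E n * y) s}" for n
    have "right_ideal_in ?C ?add ?mul (?c 0 1) (I n)" for n
      unfolding right_ideal_in_def
    proof (intro conjI ballI)
      show "I n \<subseteq> ?C" unfolding I_def C[abs_def] subset_iff by (auto simp: C)
      show "?c 0 1 \<in> I n" unfolding I_def mem_Collect_eq using S1 by (intro exI[of _ 0] bexI[of _ 1]) simp_all
      fix c assume "c \<in> I n"
      then obtain y s where c: "s \<in> S" "c = ?c (E n * y) s" unfolding I_def by blast
      show "?add c d \<in> I n" if dI: "d \<in> I n" for d
      proof -
        obtain z t where d: "t \<in> S" "d = ?c (E n * z) t" using dI unfolding I_def by blast
        have "?add c d = ?c (E n * (y * phi t + z * phi s)) (s * t)"
          unfolding c d add[OF c(1) d(1)] by (simp add: distrib_left mult.assoc)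
        then show ?thesis unfolding I_def using Sm[OF c(1) d(1)] by blast
      qed
      show "?mul c d \<in> I n" if dC: "d \<in> ?C" for d
      proof -
        obtain z t where d: "t \<in> S" "d = ?c z t" using dC C by blast
        have "?mul c d = ?c (E n * (y * z)) (s * t)" unfolding c d mul[OF c(1) d(1)] by (simp add: mult.assoc)
        then show ?thesis unfolding I_def using Sm[OF c(1) d(1)] by blast
      qed
    qed
    moreover have "I (Suc n) \<subset> I n" for n
    proof
      show "I (Suc n) \<subseteq> I n" unfolding I_def E_Suc by (auto simp: mult.assoc)
      show "I (Suc n) \<noteq> I n"
      proof
        \<comment> \<open>Equality would make \<open>E n\<close> a fraction with numerator in the
          right ideal of \<open>E n * X (E n)\<close>; clearing denominators gives a relation that
          the choice of \<open>X\<close> excludes.\<close>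
        assume "I (Suc n) = I n"
        moreover have "?c (E n) 1 \<in> I n" unfolding I_def mem_Collect_eq using S1
          by (intro exI[of _ 1] bexI[of _ 1]) simp_all
        ultimately have "?c (E n) 1 \<in> I (Suc n)" by simp
        then obtain y s where s: "s \<in> S" "?c (E n) 1 = ?c (E (Suc n) * y) s" unfolding I_def by blast
        then obtain u where u: "u \<noteq> 0" "E n * phi (s * u) = E (Suc n) * y * phi (1 * u)" using eq[OF S1 s(1)] by blast
        have "phi u * (E n * X (E n) * y - phi s * E n) = 0"
        proof -
          have "phi u * (phi s * E n) = E n * phi (s * u)"
            using phi_simps(3)[of s u] phi_central by (metis mult.assoc)
          then show ?thesis using u(2) by (simp add: E_Suc right_diff_distrib phi_central)
        qed
        then have "torsion (E n * X (E n) * y - phi s * E n)" using u(1) unfolding torsion_def by blast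
        then show False using X(2)[OF E] s(1) S0 by blast
      qed
    qed
    ultimately have "\<forall>n. right_ideal_in ?C ?add ?mul (?c 0 1) (I n) \<and> I (Suc n) \<subset> I n" by blast
    then show False using chain by blast
  qed
  then obtain e where e: "\<not> torsion e" "\<forall>x. \<not> torsion (e * x) \<longrightarrow> (\<exists>y r. r \<noteq> 0 \<and> torsion (e * x * y - phi r * e))" by blast
  define T where "T = {c. \<exists>w\<in>ideal_span e. \<exists>s\<in>S. c = ?c w s}"
  have "twosided_ideal_in ?C ?add ?mul (?c 0 1) T"
    unfolding twosided_ideal_in_def right_ideal_in_def
  proof (intro conjI ballI)
    show "T \<subseteq> ?C" unfolding T_def subset_iff C by blast
    show "?c 0 1 \<in> T" unfolding T_def using S1 ideal_span_zero by blast
    fix c assume "c \<in> T"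
    then obtain y s where c: "y \<in> ideal_span e" "s \<in> S" "c = ?c y s" unfolding T_def by blast
    show "?add c d \<in> T" if dT: "d \<in> T" for d
    proof -
      obtain z t where d: "z \<in> ideal_span e" "t \<in> S" "d = ?c z t" using dT unfolding T_def by blast
      have "y * phi t + z * phi s \<in> ideal_span e" using c d by (intro ideal_span_add ideal_span_mult)
      then show ?thesis unfolding T_def c d add[OF c(2) d(2)] using Sm[OF c(2) d(2)] by blast
    qed
    fix d assume "d \<in> ?C"
    then obtain z t where d: "t \<in> S" "d = ?c z t" using C by blast
    show "?mul c d \<in> T" "?mul d c \<in> T"
      unfolding T_def c d mul[OF c(2) d(1)] mul[OF d(1) c(2)]
      using Sm[OF c(2) d(1)] Sm[OF d(1) c(2)] ideal_span_mult[OF c(1)] by blast+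
  qed
  moreover have "e \<in> ideal_span e" using ideal_span_step[OF ideal_span_zero, of 1 e 1] by simp
  then have "?c e 1 \<in> T" unfolding T_def using S1 by blast
  moreover have "?c e 1 \<noteq> ?c 0 1" using tors[OF S1] e(1) by blast
  ultimately have "T = ?C" using simple by blast
  moreover have "?c 1 1 \<in> ?C" using C S1 by blast
  ultimately obtain w s where w: "w \<in> ideal_span e" "s \<in> S" "?c 1 1 = ?c w s" unfolding T_def by blast
  then obtain u where u: "u \<noteq> 0" "1 * phi (s * u) = w * phi (1 * u)" using eq[OF S1 w(2)] by blast
  then have "phi (s * u) \<in> ideal_span e" using ideal_span_mult(2)[OF w(1)] by simp
  moreover have "s * u \<noteq> 0" using u(1) w(2) S0 by simp
  ultimately show ?thesis using e(2) ideal_span_sum by blast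
qed

end

section \<open>Maps between localizations\<close>

text \<open>\<open>loc_modules_iso\<close> without bijectivity, so that a local isomorphism and its
  inverse are treated alike.\<close>

definition loc_hom :: "('r::comm_ring_1 \<Rightarrow> 'l::ring_1) \<Rightarrow> ('m::ab_group_add \<Rightarrow> 'l \<Rightarrow> 'm)
     \<Rightarrow> ('n::ab_group_add \<Rightarrow> 'l \<Rightarrow> 'n) \<Rightarrow> 'r set \<Rightarrow> (('m \<times> 'r) set \<Rightarrow> ('n \<times> 'r) set) \<Rightarrow> bool" where
  "loc_hom phi actM actN S f \<longleftrightarrow>
    (\<forall>c\<in>loc_carrier phi actM S UNIV. f c \<in> loc_carrier phi actN S UNIV) \<and>
    (\<forall>c\<in>loc_carrier phi actM S UNIV. \<forall>d\<in>loc_carrier phi actM S UNIV.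
          f (loc_add phi actM S UNIV c d) = loc_add phi actN S UNIV (f c) (f d)) \<and>
    (\<forall>c\<in>loc_carrier phi actM S UNIV. \<forall>\<alpha>\<in>loc_alg_carrier phi S.
          f (loc_smult phi actM S UNIV c \<alpha>) = loc_smult phi actN S UNIV (f c) \<alpha>)"

locale torsion_free_module_pair = M: torsion_free_module phi actM + N: torsion_free_module phi actN
  for phi :: "'r::idom \<Rightarrow> 'l::ring_1" and actM :: "'m::ab_group_add \<Rightarrow> 'l \<Rightarrow> 'm"
    and actN :: "'n::ab_group_add \<Rightarrow> 'l \<Rightarrow> 'n"
begin

text \<open>Over a fixed denominator \<open>s\<close> the numerators add and take scalars like
  vectors; this is how maps of fractions lead back to maps of modules.\<close>

lemma loc_hom_cls:
  assumes S: "multiplicative_set S" and f: "loc_hom phi actM actN S f" and s: "s \<in> S"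
  shows "f (M.cls S x 1) = N.cls S n s \<Longrightarrow> f (M.cls S y 1) = N.cls S n' s \<Longrightarrow> f (M.cls S (x + y) 1) = N.cls S (n + n') s"
    and "f (M.cls S x 1) = N.cls S n s \<Longrightarrow> f (M.cls S (actM x a) 1) = N.cls S (actN n a) s"
    and "\<exists>n. \<exists>t\<in>S. f (M.cls S x 1) = N.cls S n t"
    and "f (M.cls S 0 1) = N.cls S 0 s"
proof -
  have S1: "1 \<in> S" and Sm: "\<And>s t. s \<in> S \<Longrightarrow> t \<in> S \<Longrightarrow> s * t \<in> S" using S by (auto simp: multiplicative_set_def)
  have C: "M.cls S x 1 \<in> loc_carrier phi actM S UNIV" for x unfolding M.loc_carrier_iff using S1 by blast
  interpret L: algebra_module phi "(*)" by (rule M.regular_algebra_module)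
  have A: "M.alg_cls S a 1 \<in> loc_alg_carrier phi S" for a unfolding L.loc_carrier_iff using S1 by blast
  show "f (M.cls S (x + y) 1) = N.cls S (n + n') s" if "f (M.cls S x 1) = N.cls S n s" "f (M.cls S y 1) = N.cls S n' s"
  proof -
    have "M.cls S (x + y) 1 = loc_add phi actM S UNIV (M.cls S x 1) (M.cls S y 1)"
      using M.loc_add_cls[OF S S1 S1, of x y] by simp
    then have "f (M.cls S (x + y) 1) = loc_add phi actN S UNIV (N.cls S n s) (N.cls S n' s)"
      using f C that unfolding loc_hom_def by simp
    also have "\<dots> = N.cls S (N.smul s (n + n')) (s * s)"
      unfolding N.loc_add_cls[OF S s s] by (simp add: N.R.scale_right_distrib)
    also have "\<dots> = N.cls S (n + n') s"
      unfolding N.cls_eq_iff[OF S Sm[OF s s] s] by (intro bexI[OF _ S1]) simp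
    finally show ?thesis .
  qed
  have act: "f (M.cls S (actM x a) 1) = N.cls S (actN n a) t" if "f (M.cls S x 1) = N.cls S n t" "t \<in> S" for x n t a
  proof -
    have "M.cls S (actM x a) 1 = loc_smult phi actM S UNIV (M.cls S x 1) (M.alg_cls S a 1)"
      using M.loc_smult_cls[OF S S1 S1, of x a] by simp
    then have "f (M.cls S (actM x a) 1) = loc_smult phi actN S UNIV (N.cls S n t) (M.alg_cls S a 1)"
      using f C A that(1) unfolding loc_hom_def by simp
    also have "\<dots> = N.cls S (actN n a) t" using N.loc_smult_cls[OF S that(2) S1] by simp
    finally show ?thesis .
  qed
  show "f (M.cls S (actM x a) 1) = N.cls S (actN n a) s" if "f (M.cls S x 1) = N.cls S n s"
    using act that s by blast
  show ex: "\<exists>n. \<exists>t\<in>S. f (M.cls S x 1) = N.cls S n t" for x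
    using f C[of x] unfolding loc_hom_def N.loc_carrier_iff by blast
  obtain n t where "t \<in> S" "f (M.cls S 0 1) = N.cls S n t" using ex[of 0] by blast
  then have "f (M.cls S 0 1) = N.cls S 0 t" using act[of 0 n t 0] by simp
  also have "\<dots> = N.cls S 0 s" unfolding N.cls_eq_iff[OF S \<open>t \<in> S\<close> s] by (intro bexI[OF _ S1]) simp
  finally show "f (M.cls S 0 1) = N.cls S 0 s" .
qed

lemma cls_inject:
  assumes "multiplicative_set S" "0 \<notin> S" "s \<in> S" "N.cls S n s = N.cls S n' s"
  shows "n = n'"
proof -
  obtain u where "u \<in> S" "N.smul (s * u) n = N.smul (s * u) n'" using N.cls_eq_iff[OF assms(1,3,3)] assms(4) by blast
  moreover from this have "s * u \<noteq> 0" using assms(1-3) by (metis multiplicative_set_def)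
  ultimately show ?thesis using N.smul_cancel by blast
qed

text \<open>The product of the denominators at the finitely many generators serves the whole image
  of \<open>e\<close>. Torsion-freeness makes numerators unique, so the map \<open>F\<close> to the
  numerators is additive and linear.\<close>

lemma common_denominator:
  assumes S: "multiplicative_set S" "0 \<notin> S" and f: "loc_hom phi actM actN S f" and G: "finite G"
    and e: "\<And>x y. e (x + y) = e x + e y" "\<And>x a. e (actM x a) = actM (e x) a"
      "\<And>x. \<exists>c. e x = (\<Sum>g\<in>G. actM g (c g))"
  shows "\<exists>s\<in>S. \<exists>F. (\<forall>x y. F (x + y) = F x + F y) \<and> (\<forall>x a. F (actM x a) = actN (F x) a) \<and>
    (\<forall>x. f (M.cls S (e x) 1) = N.cls S (F x) s)"
proof -
  have S1: "1 \<in> S" and Sm: "\<And>s t. s \<in> S \<Longrightarrow> t \<in> S \<Longrightarrow> s * t \<in> S" using S by (auto simp: multiplicative_set_def)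
  have Sprod: "(\<Prod>g\<in>H. t g) \<in> S" if "\<And>g. t g \<in> S" for H and t :: "'m \<Rightarrow> 'r"
    by (induction H rule: infinite_finite_induct) (auto simp: S1 Sm that)
  have "\<forall>g. \<exists>n t. t \<in> S \<and> f (M.cls S g 1) = N.cls S n t" using loc_hom_cls(3)[OF S(1) f S1] by blast
  then obtain n t where nt: "\<And>g. t g \<in> S" "\<And>g. f (M.cls S g 1) = N.cls S (n g) (t g)" by metis
  define s where "s = (\<Prod>g\<in>G. t g)"
  have s: "s \<in> S" unfolding s_def using Sprod nt(1) by blast
  have gen: "\<exists>k. f (M.cls S g 1) = N.cls S k s" if "g \<in> G" for g
  proof -
    define r where "r = (\<Prod>h\<in>G - {g}. t h)"
    have "s = t g * r" unfolding s_def r_def using G that by (rule prod.remove)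
    then have "N.cls S (n g) (t g) = N.cls S (N.smul r (n g)) s"
      unfolding N.cls_eq_iff[OF S(1) nt(1) s] by (intro bexI[OF _ S1]) simp
    then show ?thesis using nt(2) by metis
  qed
  have sum: "\<exists>k. f (M.cls S (\<Sum>g\<in>H. actM g (c g)) 1) = N.cls S k s" if "H \<subseteq> G" for H c
    using finite_subset[OF that G] that
  proof (induction H rule: finite_induct)
    case empty
    then show ?case using loc_hom_cls(4)[OF S(1) f s] by auto
  next
    case (insert g H)
    obtain k where k: "f (M.cls S g 1) = N.cls S k s" using gen insert.prems by blast
    obtain l where l: "f (M.cls S (\<Sum>g\<in>H. actM g (c g)) 1) = N.cls S l s" using insert by blast
    show ?case
      using loc_hom_cls(1)[OF S(1) f s loc_hom_cls(2)[OF S(1) f s k, of "c g"] l] insert.hyps by auto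
  qed
  have "\<forall>x. \<exists>k. f (M.cls S (e x) 1) = N.cls S k s" using sum[OF order_refl] e(3) by metis
  then obtain F where F: "\<And>x. f (M.cls S (e x) 1) = N.cls S (F x) s" by metis
  have "F (x + y) = F x + F y" for x y
    using cls_inject[OF S s] F[of "x + y"] loc_hom_cls(1)[OF S(1) f s F[of x] F[of y]] e(1) by simp
  moreover have "F (actM x a) = actN (F x) a" for x a
    using cls_inject[OF S s] F[of "actM x a"] loc_hom_cls(2)[OF S(1) f s F[of x]] e(2) by simp
  ultimately show ?thesis using s F by blast
qed

end

text \<open>The projections onto the partial sums of a decomposition into nonzero finitely generated summands.\<close>

definition partial_projections :: "('m::ab_group_add \<Rightarrow> 'l::ring_1 \<Rightarrow> 'm) \<Rightarrow> (nat \<Rightarrow> 'm \<Rightarrow> 'm) \<Rightarrow> bool" where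
  "partial_projections act p \<longleftrightarrow> (\<forall>k x y. p k (x + y) = p k x + p k y) \<and> (\<forall>k x a. p k (act x a) = act (p k x) a) \<and>
    (\<forall>x. p 0 x = 0) \<and> (\<forall>i j x. p i (p j x) = p (min i j) x) \<and> (\<forall>x. \<exists>k. p k x = x) \<and>
    (\<forall>k. \<exists>x. p k x \<noteq> p (Suc k) x) \<and>
    (\<forall>k. \<exists>G. finite G \<and> (\<forall>g\<in>G. p k g = g) \<and> (\<forall>x. \<exists>c. p k x = (\<Sum>g\<in>G. act g (c g))))"

lemma partial_projectionsD:
  assumes "partial_projections act p"
  shows "p k (x + y) = p k x + p k y" "p k (act x a) = act (p k x) a" "p 0 x = 0" "p i (p j x) = p (min i j) x"
    "\<exists>k. p k x = x" "\<exists>x. p k x \<noteq> p (Suc k) x"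
    "\<exists>G. finite G \<and> (\<forall>g\<in>G. p k g = g) \<and> (\<forall>x. \<exists>c. p k x = (\<Sum>g\<in>G. act g (c g)))"
    "i \<le> j \<Longrightarrow> p j (p i x) = p i x"
  using assms unfolding partial_projections_def by (blast | simp add: min_absorb2)+

lemma partial_projections_sum:
  assumes "partial_projections act p" "finite I"
  shows "p k (\<Sum>i\<in>I. x i) = (\<Sum>i\<in>I. p k (x i))"
proof -
  have "p k 0 = 0" using partial_projectionsD(1)[OF assms(1), of k 0 0] by simp
  with assms(2) show ?thesis
    by (induction I rule: finite_induct) (simp_all add: partial_projectionsD(1)[OF assms(1)])
qed

context torsion_free_module_pair
begin

lemma loc_modules_iso_inverse:
  assumes S: "multiplicative_set S" and iso: "loc_modules_iso phi actM actN S"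
  shows "\<exists>f g. loc_hom phi actM actN S f \<and> loc_hom phi actN actM S g \<and>
    (\<forall>c\<in>loc_carrier phi actM S UNIV. g (f c) = c) \<and> (\<forall>c\<in>loc_carrier phi actN S UNIV. f (g c) = c)"
proof -
  have Sm: "\<And>s t. s \<in> S \<Longrightarrow> t \<in> S \<Longrightarrow> s * t \<in> S" using S by (auto simp: multiplicative_set_def)
  let ?M = "loc_carrier phi actM S UNIV" and ?N = "loc_carrier phi actN S UNIV"
  obtain f where f: "bij_betw f ?M ?N"
    "\<And>c d. c \<in> ?M \<Longrightarrow> d \<in> ?M \<Longrightarrow> f (loc_add phi actM S UNIV c d) = loc_add phi actN S UNIV (f c) (f d)"
    "\<And>c \<alpha>. c \<in> ?M \<Longrightarrow> \<alpha> \<in> loc_alg_carrier phi S \<Longrightarrow>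
      f (loc_smult phi actM S UNIV c \<alpha>) = loc_smult phi actN S UNIV (f c) \<alpha>"
    using iso unfolding loc_modules_iso_def by blast
  have fN: "f c \<in> ?N" if "c \<in> ?M" for c using f(1) that by (rule bij_betw_apply)
  have fh: "loc_hom phi actM actN S f" unfolding loc_hom_def using f(2,3) fN by blast
  interpret L: algebra_module phi "(*)" by (rule M.regular_algebra_module)
  have cM: "loc_add phi actM S UNIV c d \<in> ?M" if "c \<in> ?M" "d \<in> ?M" for c d
    using that M.loc_add_cls[OF S(1)] Sm unfolding M.loc_carrier_iff by fast
  have sM: "loc_smult phi actM S UNIV c \<alpha> \<in> ?M" if "c \<in> ?M" "\<alpha> \<in> loc_alg_carrier phi S" for c \<alpha>
    using that M.loc_smult_cls[OF S(1)] Sm unfolding M.loc_carrier_iff L.loc_carrier_iff by fast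
  define g where "g = inv_into ?M f"
  have gM: "g c \<in> ?M" if "c \<in> ?N" for c using bij_betw_inv_into[OF f(1)] that unfolding g_def by (rule bij_betw_apply)
  have fg: "f (g c) = c" if "c \<in> ?N" for c unfolding g_def by (rule bij_betw_inv_into_right[OF f(1) that])
  have gf: "g (f c) = c" if "c \<in> ?M" for c unfolding g_def by (rule bij_betw_inv_into_left[OF f(1) that])
  have "g (loc_add phi actN S UNIV c d) = loc_add phi actM S UNIV (g c) (g d)" if "c \<in> ?N" "d \<in> ?N" for c d
    using f(2)[OF gM[OF that(1)] gM[OF that(2)]] fg that gf[OF cM[OF gM[OF that(1)] gM[OF that(2)]]] by simp
  moreover have "g (loc_smult phi actN S UNIV c \<alpha>) = loc_smult phi actM S UNIV (g c) \<alpha>"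
    if "c \<in> ?N" "\<alpha> \<in> loc_alg_carrier phi S" for c \<alpha>
    using f(3)[OF gM[OF that(1)] that(2)] fg that(1) gf[OF sM[OF gM[OF that(1)] that(2)]] by simp
  ultimately have "loc_hom phi actN actM S g" unfolding loc_hom_def using gM by blast
  with fh fg gf show ?thesis by blast
qed

text \<open>Restricted to the finitely generated stage \<open>k\<close>, the local isomorphism has a
  common denominator and reaches only a finite stage \<open>l\<close>, because the generators do.
  The inverse on stage \<open>l\<close> has a common denominator too, and \<open>r\<close> is the
  product of both.\<close>

lemma loc_iso_split:
  assumes S: "multiplicative_set S" "0 \<notin> S" and fh: "loc_hom phi actM actN S f" and gh: "loc_hom phi actN actM S g"
    and gf: "\<And>c. c \<in> loc_carrier phi actM S UNIV \<Longrightarrow> g (f c) = c"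
    and p: "partial_projections actM p" and q: "partial_projections actN q"
  shows "\<exists>l F G r. r \<in> S \<and> (\<forall>x y. F (x + y) = F x + F y) \<and> (\<forall>x a. F (actM x a) = actN (F x) a) \<and>
    (\<forall>x y. G (x + y) = G x + G y) \<and> (\<forall>x a. G (actN x a) = actM (G x) a) \<and>
    (\<forall>x. q l (F x) = F x) \<and> (\<forall>x. G (F x) = M.smul r (p k x))"
proof -
  interpret swap: torsion_free_module_pair phi actN actM by unfold_locales
  have S1: "1 \<in> S" and Sm: "\<And>s t. s \<in> S \<Longrightarrow> t \<in> S \<Longrightarrow> s * t \<in> S" using S by (auto simp: multiplicative_set_def)
  note P = partial_projectionsD[OF p] and Q = partial_projectionsD[OF q]
  obtain X where X: "finite X" "\<And>x. x \<in> X \<Longrightarrow> p k x = x" "\<And>x. \<exists>c. p k x = (\<Sum>g\<in>X. actM g (c g))" using P(7)[of k] by blast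
  obtain s F where s: "s \<in> S" and F: "\<And>x y. F (x + y) = F x + F y" "\<And>x a. F (actM x a) = actN (F x) a"
      "\<And>x. f (M.cls S (p k x) 1) = N.cls S (F x) s"
    using common_denominator[OF S fh X(1) P(1,2) X(3)] by blast
  have Fp: "F (p k x) = F x" for x
    using cls_inject[OF S s, of "F (p k x)" "F x"] F(3)[of "p k x"] F(3)[of x] P(4)[of k k x] by simp
  have F0: "F 0 = 0" using F(1)[of 0 0] by simp
  have Fsum: "F (\<Sum>g\<in>X. actM g (c g)) = (\<Sum>g\<in>X. actN (F g) (c g))" for c
    using X(1) by (induction X rule: finite_induct) (simp_all add: F0 F(1,2))
  obtain l0 where l0: "\<And>y. q (l0 y) y = y" using Q(5) by metis
  define l where "l = Max (insert 0 ((\<lambda>x. l0 (F x)) ` X))"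
  have "q l (F x) = F x" if "x \<in> X" for x
  proof -
    have "l0 (F x) \<le> l" unfolding l_def using X(1) that by (intro Max_ge) auto
    then show ?thesis using Q(8)[of "l0 (F x)" l "F x"] l0 by simp
  qed
  then have qF: "q l (F x) = F x" for x
  proof -
    obtain c where c: "p k x = (\<Sum>g\<in>X. actM g (c g))" using X(3) by blast
    have Fx: "F x = (\<Sum>g\<in>X. actN (F g) (c g))" using Fp[of x] Fsum[of c] c by simp
    show ?thesis unfolding Fx partial_projections_sum[OF q X(1)]
      by (intro sum.cong refl) (simp add: Q(2) \<open>\<And>x. x \<in> X \<Longrightarrow> q l (F x) = F x\<close>)
  qed
  obtain Y where Y: "finite Y" "\<And>x. \<exists>c. q l x = (\<Sum>g\<in>Y. actN g (c g))" using Q(7)[of l] by blast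
  obtain t G where t: "t \<in> S" and G: "\<And>x y. G (x + y) = G x + G y" "\<And>x a. G (actN x a) = actM (G x) a"
      "\<And>x. g (N.cls S (q l x) 1) = M.cls S (G x) t"
    using swap.common_denominator[OF S gh Y(1) Q(1,2) Y(2)] by blast
  \<comment> \<open>The fraction \<open>F x / 1\<close> is the image of \<open>s\<close> times
    \<open>p k x\<close>; applying the inverse and comparing numerators over \<open>t\<close> gives
    the factor \<open>t * s\<close>.\<close>
  have "G (F x) = M.smul (t * s) (p k x)" for x
  proof -
    have Cs: "M.cls S (actM (p k x) (phi s)) 1 \<in> loc_carrier phi actM S UNIV" unfolding M.loc_carrier_iff using S1 by blast
    have "f (M.cls S (actM (p k x) (phi s)) 1) = N.cls S (actN (F x) (phi s)) s"
      by (rule loc_hom_cls(2)[OF S(1) fh s F(3)])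
    also have "\<dots> = N.cls S (F x) 1"
      unfolding N.cls_eq_iff[OF S(1) s S1] by (intro bexI[OF _ S1]) (simp add: N.smul_def N.phi_simps(1))
    finally have "g (N.cls S (F x) 1) = M.cls S (actM (p k x) (phi s)) 1" using gf[OF Cs] by simp
    then have "M.cls S (G (F x)) t = M.cls S (actM (p k x) (phi s)) 1" using G(3)[of "F x"] qF by simp
    also have "\<dots> = M.cls S (M.smul (t * s) (p k x)) t"
      unfolding M.cls_eq_iff[OF S(1) S1 t] by (intro bexI[OF _ S1]) (simp add: M.smul_def[symmetric])
    finally show ?thesis by (rule swap.cls_inject[OF S t])
  qed
  then show ?thesis using F(1,2) G(1,2) qF Sm[OF t s] by blast
qed

end

section \<open>Direct sums\<close>

text \<open>A vector killed by \<open>r \<noteq> 0\<close> has the same class as 0. The classes are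
  formed inside \<open>X\<close> and not in the whole module, so their members are compared
  directly.\<close>

lemma R_torsion_freeD:
  assumes "R_torsion_free (phi :: 'r::idom \<Rightarrow> 'l::ring_1) act X" "algebra_module phi act" "0 \<in> X" "x \<in> X" "r \<noteq> 0" "act x (phi r) = 0"
  shows "x = 0"
proof -
  interpret algebra_module phi act by (rule assms(2))
  have rx: "r \<cdot> x = 0" using assms(6) by (simp add: smul_def)
  have "loc_class phi act (UNIV - {0}) X (x, 1) = loc_class phi act (UNIV - {0}) X (0, 1)"
  proof -
    have iff: "(\<exists>u. u \<noteq> 0 \<and> (t * u) \<cdot> x = (1 * u) \<cdot> y) \<longleftrightarrow> (\<exists>u. u \<noteq> 0 \<and> (t * u) \<cdot> (0::'a) = (1 * u) \<cdot> y)" for y t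
    proof
      assume "\<exists>u. u \<noteq> 0 \<and> (t * u) \<cdot> x = (1 * u) \<cdot> y"
      then obtain u where u: "u \<noteq> 0" "(t * u) \<cdot> x = u \<cdot> y" by auto
      have "(r * u) \<cdot> y = (t * u) \<cdot> r \<cdot> x" by (metis R.scale_scale mult.commute u(2))
      then have "(t * (r * u)) \<cdot> 0 = (1 * (r * u)) \<cdot> y" using rx by simp
      then show "\<exists>u. u \<noteq> 0 \<and> (t * u) \<cdot> (0::'a) = (1 * u) \<cdot> y" using u(1) assms(5) by (intro exI[of _ "r * u"]) simp
    next
      assume "\<exists>u. u \<noteq> 0 \<and> (t * u) \<cdot> (0::'a) = (1 * u) \<cdot> y"
      then obtain u where u: "u \<noteq> 0" "u \<cdot> y = 0" by auto
      have "(t * (r * u)) \<cdot> x = (t * u) \<cdot> r \<cdot> x" by (simp add: ac_simps)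
      also have "\<dots> = (1 * (r * u)) \<cdot> y" using rx u(2) by (simp add: R.scale_scale[symmetric] del: R.scale_scale)
      finally show "\<exists>u. u \<noteq> 0 \<and> (t * u) \<cdot> x = (1 * u) \<cdot> y" using u(1) assms(5) by (intro exI[of _ "r * u"]) simp
    qed
    have mem: "(y, t) \<in> loc_class phi act (UNIV - {0}) X (z, 1) \<longleftrightarrow>
        y \<in> X \<and> t \<noteq> 0 \<and> (\<exists>u. u \<noteq> 0 \<and> (t * u) \<cdot> z = (1 * u) \<cdot> y)" if "z \<in> X" for y t z
      using that by (auto simp: loc_class_def loc_rel_def smul_def)
    have "p \<in> loc_class phi act (UNIV - {0}) X (x, 1) \<longleftrightarrow> p \<in> loc_class phi act (UNIV - {0}) X (0, 1)" for p
      by (cases p) (simp only: mem[OF assms(3)] mem[OF assms(4)] iff)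
    then show ?thesis by blast
  qed
  then show ?thesis using assms(1,3,4) unfolding R_torsion_free_def by (auto dest: inj_onD)
qed

context algebra_module
begin

definition component :: "(nat \<Rightarrow> 'a set) \<Rightarrow> 'a \<Rightarrow> nat \<Rightarrow> 'a" where
  "component A x = (THE f. (\<forall>i. f i \<in> A i) \<and> finite {i. f i \<noteq> 0} \<and> x = (\<Sum>i\<in>{i. f i \<noteq> 0}. f i))"

context
  fixes A :: "nat \<Rightarrow> 'a set"
  assumes A: "internal_dsum act A"
begin

lemma component: "component A x i \<in> A i" "finite {i. component A x i \<noteq> 0}"
    "x = (\<Sum>i\<in>{i. component A x i \<noteq> 0}. component A x i)"
proof -
  have "\<exists>!f. (\<forall>i. f i \<in> A i) \<and> finite {i. f i \<noteq> 0} \<and> x = (\<Sum>i\<in>{i. f i \<noteq> 0}. f i)"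
    using A unfolding internal_dsum_def by blast
  from theI'[OF this] show "component A x i \<in> A i" "finite {i. component A x i \<noteq> 0}"
    "x = (\<Sum>i\<in>{i. component A x i \<noteq> 0}. component A x i)" unfolding component_def by blast+
qed

lemma component_eqI:
  assumes "\<And>i. f i \<in> A i" "finite I" "\<And>i. i \<notin> I \<Longrightarrow> f i = 0" "x = (\<Sum>i\<in>I. f i)"
  shows "component A x = f"
proof -
  have ex1: "\<exists>!f. (\<forall>i. f i \<in> A i) \<and> finite {i. f i \<noteq> 0} \<and> x = (\<Sum>i\<in>{i. f i \<noteq> 0}. f i)"
    using A unfolding internal_dsum_def by blast
  have sub: "{i. f i \<noteq> 0} \<subseteq> I" using assms(3) by blast
  have "x = (\<Sum>i\<in>{i. f i \<noteq> 0}. f i)"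
    unfolding assms(4) using sub assms(2) by (intro sum.mono_neutral_right) auto
  then have "(\<forall>i. f i \<in> A i) \<and> finite {i. f i \<noteq> 0} \<and> x = (\<Sum>i\<in>{i. f i \<noteq> 0}. f i)"
    using assms(1) finite_subset[OF sub assms(2)] by blast
  then show ?thesis unfolding component_def by (rule the1_equality[OF ex1])
qed

lemma summand_closed: "0 \<in> A i" "x \<in> A i \<Longrightarrow> y \<in> A i \<Longrightarrow> x + y \<in> A i" "x \<in> A i \<Longrightarrow> act x a \<in> A i"
  using A unfolding internal_dsum_def rsubmodule_def by blast+

lemma component_sum:
  assumes "finite I" "{i. component A x i \<noteq> 0} \<subseteq> I"
  shows "x = (\<Sum>i\<in>I. component A x i)"
  using component(3)[of x] sum.mono_neutral_right[OF assms(1,2), of "component A x"] by simp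

lemma component_add: "component A (x + y) = (\<lambda>i. component A x i + component A y i)"
proof (rule component_eqI)
  let ?I = "{i. component A x i \<noteq> 0} \<union> {i. component A y i \<noteq> 0}"
  show fin: "finite ?I" using component(2) by blast
  show "x + y = (\<Sum>i\<in>?I. component A x i + component A y i)"
    unfolding sum.distrib using component_sum[OF fin, of x] component_sum[OF fin, of y] by simp
qed (auto intro: summand_closed component(1))

lemma component_act: "component A (act x a) = (\<lambda>i. act (component A x i) a)"
proof (rule component_eqI)
  show "act x a = (\<Sum>i\<in>{i. component A x i \<noteq> 0}. act (component A x i) a)"
    using component(3)[of x] act_sum_left by metis
qed (auto intro: summand_closed component)

lemma component_summand: "x \<in> A j \<Longrightarrow> component A x = (\<lambda>i. if i = j then x else 0)"
  by (rule component_eqI[of _ "{j}"]) (auto intro: summand_closed)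

definition partial_sum :: "nat \<Rightarrow> 'a \<Rightarrow> 'a" where
  "partial_sum k x = (\<Sum>i<k. component A x i)"

lemma component_partial_sum: "component A (partial_sum k x) = (\<lambda>i. if i < k then component A x i else 0)"
  by (rule component_eqI[of _ "{..<k}"]) (auto simp: partial_sum_def intro: summand_closed component)

lemma partial_sum_generators:
  assumes "\<And>i. fin_gen_rsubmodule act (A i)"
  shows "\<exists>G. finite G \<and> (\<forall>g\<in>G. partial_sum k g = g) \<and> (\<forall>x. \<exists>c. partial_sum k x = (\<Sum>g\<in>G. act g (c g)))"
proof (induction k)
  case 0
  show ?case by (rule exI[of _ "{}"]) (simp add: partial_sum_def)
next
  case (Suc k)
  then obtain G where G: "finite G" "\<And>g. g \<in> G \<Longrightarrow> partial_sum k g = g" "\<And>x. \<exists>c. partial_sum k x = (\<Sum>g\<in>G. act g (c g))"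
    by blast
  obtain H where H: "finite H" "H \<subseteq> A k" "A k = {\<Sum>g\<in>H. act g (c g) | c. True}"
    using assms[of k] unfolding fin_gen_rsubmodule_def by blast
  have "partial_sum (Suc k) g = g" if "g \<in> G \<union> H" for g
  proof (cases "g \<in> G")
    case True
    have "component A g k = component A (partial_sum k g) k" using G(2)[OF True] by simp
    also have "\<dots> = 0" by (simp add: component_partial_sum)
    finally show ?thesis using G(2)[OF True] by (simp add: partial_sum_def)
  next
    case False
    then have "g \<in> A k" using that H(2) by blast
    then show ?thesis unfolding partial_sum_def by (simp add: component_summand)
  qed
  moreover have "\<exists>c. partial_sum (Suc k) x = (\<Sum>g\<in>G \<union> H. act g (c g))" for x
  proof -
    obtain c where c: "partial_sum k x = (\<Sum>g\<in>G. act g (c g))" using G(3) by blast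
    obtain d where d: "component A x k = (\<Sum>g\<in>H. act g (d g))" using component(1)[of x k] H(3) by blast
    \<comment> \<open>Both \<open>G\<close> and \<open>H\<close> may contain 0, so the two families
      of coefficients are extended to the union and added.\<close>
    have "(\<Sum>g\<in>G. act g (c g)) = (\<Sum>g\<in>G \<union> H. act g (if g \<in> G then c g else 0))"
      using G(1) H(1) by (intro sum.mono_neutral_cong_left) auto
    moreover have "(\<Sum>g\<in>H. act g (d g)) = (\<Sum>g\<in>G \<union> H. act g (if g \<in> H then d g else 0))"
      using G(1) H(1) by (intro sum.mono_neutral_cong_left) auto
    ultimately have "partial_sum (Suc k) x = (\<Sum>g\<in>G \<union> H. act g ((if g \<in> G then c g else 0) + (if g \<in> H then d g else 0)))"
      using c d by (simp add: partial_sum_def sum.distrib)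
    then show ?thesis
      by (intro exI[of _ "\<lambda>g. (if g \<in> G then c g else 0) + (if g \<in> H then d g else 0)"])
  qed
  ultimately show ?case using G(1) H(1) by (intro exI[of _ "G \<union> H"]) blast
qed

lemma partial_projections_partial_sum:
  assumes "\<And>i. A i \<noteq> {0}" "\<And>i. fin_gen_rsubmodule act (A i)"
  shows "partial_projections act partial_sum"
  unfolding partial_projections_def
proof (intro conjI allI)
  show "partial_sum k (x + y) = partial_sum k x + partial_sum k y" for k x y
    by (simp add: partial_sum_def component_add sum.distrib)
  show "partial_sum k (act x a) = act (partial_sum k x) a" for k x a
    by (simp add: partial_sum_def component_act act_sum_left)
  show "partial_sum 0 x = 0" for x by (simp add: partial_sum_def)
  show "partial_sum i (partial_sum j x) = partial_sum (min i j) x" for i j x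
  proof -
    have "(\<Sum>l<i. if l < j then component A x l else 0) = (\<Sum>l\<in>{l \<in> {..<i}. l < j}. component A x l)"
      by (rule sum.inter_filter[symmetric]) simp
    also have "{l \<in> {..<i}. l < j} = {..<min i j}" by auto
    finally show ?thesis by (simp add: partial_sum_def[of i "partial_sum j x"] component_partial_sum) (simp add: partial_sum_def)
  qed
  show "\<exists>k. partial_sum k x = x" for x
  proof -
    obtain k where "{i. component A x i \<noteq> 0} \<subseteq> {..<k}" using component(2) unfolding finite_nat_set_iff_bounded by blast
    then show ?thesis using component_sum[of "{..<k}" x] by (intro exI[of _ k]) (simp add: partial_sum_def)
  qed
  show "\<exists>x. partial_sum k x \<noteq> partial_sum (Suc k) x" for k
  proof -
    obtain x where "x \<in> A k" "x \<noteq> 0" using assms(1)[of k] summand_closed(1)[of k] by blast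
    then show ?thesis by (intro exI[of _ x]) (simp add: partial_sum_def component_summand)
  qed
qed (use partial_sum_generators[OF assms(2)] in blast)

lemma dsum_torsion_free:
  assumes "\<And>i. R_torsion_free phi act (A i)"
  shows "torsion_free_module phi act"
proof
  fix r x assume r: "r \<noteq> 0" "act x (phi r) = 0"
  have "component A 0 = (\<lambda>_. 0)" by (rule component_eqI[of _ "{}"]) (auto intro: summand_closed)
  then have "act (component A x i) (phi r) = 0" for i
    using component_act[of x "phi r"] r(2) by metis
  then have "component A x i = 0" for i
    using R_torsion_freeD[OF assms algebra_module_axioms summand_closed(1) component(1) r(1)] by blast
  then show "x = 0" using component(3)[of x] by simp
qed

end

end

text \<open>The products of generators over the algebra with generators of the algebra over the base
  ring suffice. Different pairs may give the same vector, so coefficients are summed over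
  fibres.\<close>

lemma (in torsion_free_module) fgen_of_algebra_generators:
  assumes R: "fin_gen_over_R phi" and e: "lin e" and G: "finite G" "\<And>g. g \<in> G \<Longrightarrow> app e g = g"
    "\<And>x. \<exists>c. app e x = (\<Sum>g\<in>G. act g (c g))"
  shows "fgen e"
proof -
  obtain H where H: "finite H" "\<And>x. \<exists>c. x = (\<Sum>h\<in>H. phi (c h) * h)"
    using R unfolding fin_gen_over_R_def by blast
  define I where "I = (\<lambda>(g, h). act g h) ` (G \<times> H)"
  have "\<exists>c. app e x = (\<Sum>v\<in>I. c v \<cdot> v)" for x
  proof -
    obtain c where c: "app e x = (\<Sum>g\<in>G. act g (c g))" using G(3) by blast
    obtain d where d: "\<And>x. x = (\<Sum>h\<in>H. phi (d x h) * h)" using H(2) by metis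
    have "act g (c g) = (\<Sum>h\<in>H. d (c g) h \<cdot> act g h)" for g
      using arg_cong[OF d[of "c g"], of "act g"] by (simp add: act_sum_right act_phi_mult)
    then have "app e x = (\<Sum>g\<in>G. \<Sum>h\<in>H. d (c g) h \<cdot> act g h)" unfolding c by simp
    also have "\<dots> = (\<Sum>(g, h)\<in>G \<times> H. d (c g) h \<cdot> act g h)" by (rule sum.cartesian_product)
    also have "\<dots> = (\<Sum>v\<in>I. \<Sum>p\<in>{p \<in> G \<times> H. (case p of (g, h) \<Rightarrow> act g h) = v}. case p of (g, h) \<Rightarrow> d (c g) h \<cdot> act g h)"
      unfolding I_def by (rule sum.image_gen) (use G(1) H(1) in simp)
    also have "\<dots> = (\<Sum>v\<in>I. (\<Sum>p\<in>{p \<in> G \<times> H. (case p of (g, h) \<Rightarrow> act g h) = v}. d (c (fst p)) (snd p)) \<cdot> v)"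
      by (intro sum.cong refl) (auto simp: R.scale_sum_left intro!: sum.cong)
    finally show ?thesis
      by (intro exI[of _ "\<lambda>v. \<Sum>p\<in>{p \<in> G \<times> H. (case p of (g, h) \<Rightarrow> act g h) = v}. d (c (fst p)) (snd p)"])
  qed
  moreover have "app e v = v" if "v \<in> I" for v using that G(2) by (auto simp: I_def linD[OF e])
  moreover have "finite I" using G(1) H(1) by (simp add: I_def)
  ultimately show ?thesis unfolding fgen_def by blast
qed

section \<open>From the genus to an isomorphism of the direct sums\<close>

lemma complement_of_maximal_ideal:
  assumes "maximal_ideal m"
  shows "multiplicative_set (UNIV - m)" "0 \<notin> UNIV - m"
  using maximal_ideal_prime[OF assms] comm_idealD(1)[of m]
  by (auto simp: multiplicative_set_def prime_comm_ideal_def)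

lemma module_isomorphism:
  fixes phi :: "'r::idom \<Rightarrow> 'l::ring_1"
    and actM :: "'m::ab_group_add \<Rightarrow> 'l \<Rightarrow> 'm"
    and actN :: "'n::ab_group_add \<Rightarrow> 'l \<Rightarrow> 'n"
  assumes fc: "finite_character TYPE('r)" and R: "fin_gen_over_R phi" and sa: "tensor_Q_simple_artinian phi"
    and pair: "torsion_free_module_pair phi actM actN"
    and p: "partial_projections actM p" and q: "partial_projections actN q"
    and genus: "same_genus phi actM actN"
  shows "\<exists>F. bij F \<and> (\<forall>x y. F (x + y) = F x + F y) \<and> (\<forall>x a. F (actM x a) = actN (F x) a)"
proof -
  interpret MN: torsion_free_module_pair phi actM actN by (rule pair)
  interpret NM: torsion_free_module_pair phi actN actM by unfold_locales
  define act where "act z a = (actM (fst z) a, actN (snd z) a)" for z a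
  interpret torsion_free_module phi act
  proof
    show "R_algebra phi" by (rule MN.M.algebra)
    show "rmodule act" by (auto simp: rmodule_def act_def MN.M.act_mult MN.N.act_mult)
    show "x = 0" if "r \<noteq> 0" "act x (phi r) = 0" for r x
      using that MN.M.torsion_free MN.N.torsion_free by (auto simp: act_def zero_prod_def prod_eq_iff)
  qed
  have smul_pair: "smul r (x, y) = (MN.M.smul r x, MN.N.smul r y)" for r x y
    by (simp add: smul_def MN.M.smul_def MN.N.smul_def act_def)
  obtain e where "\<And>x. \<not> torsion (e * x) \<Longrightarrow> \<exists>y r. r \<noteq> 0 \<and> torsion (e * x * y - phi r * e)"
      "\<exists>r n a b. r \<noteq> 0 \<and> phi r = (\<Sum>i<(n::nat). a i * e * b i)"
    using minimal_element_exists[OF sa] by blast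
  \<comment> \<open>The element \<open>e\<close> was found in the algebra, so it is available for
    the product module as well.\<close>
  then interpret minimal_element_module phi act e by unfold_locales
  interpret generically_split_module phi act
    by unfold_locales (rule fc, rule generic_splitting_of_filtration)
  note P = partial_projectionsD[OF p] and Q = partial_projectionsD[OF q]
  define PP where "PP k = Endo (\<lambda>z. (p k (fst z), 0 :: 'n))" for k
  define QQ where "QQ k = Endo (\<lambda>z. (0 :: 'm, q k (snd z)))" for k
  have PP: "app (PP k) z = (p k (fst z), 0)" for k and z :: "'m \<times> 'n"
    unfolding PP_def by (subst app_Endo) (simp_all add: P(1))
  have QQ: "app (QQ k) z = (0, q k (snd z))" for k and z :: "'m \<times> 'n"
    unfolding QQ_def by (subst app_Endo) (simp_all add: Q(1))
  have lP: "lin (PP k)" and lQ: "lin (QQ k)" for k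
    by (simp_all add: lin_def PP QQ act_def P(2) Q(2))
  have fP: "fgen (PP k)" for k
  proof -
    obtain G where G: "finite G" "\<And>g. g \<in> G \<Longrightarrow> p k g = g" "\<And>x. \<exists>c. p k x = (\<Sum>g\<in>G. actM g (c g))" using P(7)[of k] by blast
    show ?thesis
    proof (rule fgen_of_algebra_generators[OF R lP, of "(\<lambda>g. (g, 0)) ` G"])
      fix z :: "'m \<times> 'n"
      obtain c where c: "p k (fst z) = (\<Sum>g\<in>G. actM g (c g))" using G(3) by blast
      have "app (PP k) z = (\<Sum>g\<in>G. act (g, 0) (c g))" by (simp add: PP c act_def sum_prod)
      also have "\<dots> = (\<Sum>h\<in>(\<lambda>g. (g, 0)) ` G. act h (c (fst h)))"
        by (subst sum.reindex) (auto simp: inj_on_def)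
      finally show "\<exists>c. app (PP k) z = (\<Sum>h\<in>(\<lambda>g. (g, 0)) ` G. act h (c h))" by (intro exI[of _ "\<lambda>h. c (fst h)"])
    qed (use G(1,2) in \<open>auto simp: PP\<close>)
  qed
  have fQ: "fgen (QQ k)" for k
  proof -
    obtain G where G: "finite G" "\<And>g. g \<in> G \<Longrightarrow> q k g = g" "\<And>x. \<exists>c. q k x = (\<Sum>g\<in>G. actN g (c g))" using Q(7)[of k] by blast
    show ?thesis
    proof (rule fgen_of_algebra_generators[OF R lQ, of "(\<lambda>g. (0, g)) ` G"])
      fix z :: "'m \<times> 'n"
      obtain c where c: "q k (snd z) = (\<Sum>g\<in>G. actN g (c g))" using G(3) by blast
      have "app (QQ k) z = (\<Sum>g\<in>G. act (0, g) (c g))" by (simp add: QQ c act_def sum_prod)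
      also have "\<dots> = (\<Sum>h\<in>(\<lambda>g. (0, g)) ` G. act h (c (snd h)))"
        by (subst sum.reindex) (auto simp: inj_on_def)
      finally show "\<exists>c. app (QQ k) z = (\<Sum>h\<in>(\<lambda>g. (0, g)) ` G. act h (c h))" by (intro exI[of _ "\<lambda>h. c (snd h)"])
    qed (use G(1,2) in \<open>auto simp: QQ\<close>)
  qed
  have "PP k \<noteq> PP (Suc k)" for k
  proof
    assume eq: "PP k = PP (Suc k)"
    have "p k x = p (Suc k) x" for x using arg_cong[OF eq, of "\<lambda>h. app h (x, 0)"] by (simp add: PP)
    then show False using P(6) by blast
  qed
  then have filtP: "filtration PP" unfolding filtration_def
    using lP fP by (auto intro!: endo_eqI simp: PP P(3,4) zero_prod_def)
  have "QQ k \<noteq> QQ (Suc k)" for k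
  proof
    assume eq: "QQ k = QQ (Suc k)"
    have "q k x = q (Suc k) x" for x using arg_cong[OF eq, of "\<lambda>h. app h (0, x)"] by (simp add: QQ)
    then show False using Q(6) by blast
  qed
  then have filtQ: "filtration QQ" unfolding filtration_def
    using lQ fQ by (auto intro!: endo_eqI simp: QQ Q(3,4) zero_prod_def)
  have "\<exists>l. local_summand m (PP k) (QQ l)" "\<exists>l. local_summand m (QQ k) (PP l)" if m: "maximal_ideal m" for m k
  proof -
    note S = complement_of_maximal_ideal[OF m]
    obtain f g where fg: "loc_hom phi actM actN (UNIV - m) f" "loc_hom phi actN actM (UNIV - m) g"
        "\<And>c. c \<in> loc_carrier phi actM (UNIV - m) UNIV \<Longrightarrow> g (f c) = c"
        "\<And>c. c \<in> loc_carrier phi actN (UNIV - m) UNIV \<Longrightarrow> f (g c) = c"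
      using MN.loc_modules_iso_inverse[OF S(1)] genus m unfolding same_genus_def by metis
    show "\<exists>l. local_summand m (PP k) (QQ l)"
    proof -
      obtain l F G r where r: "r \<in> UNIV - m" and F: "\<And>x y. F (x + y) = F x + F y" "\<And>x a. F (actM x a) = actN (F x) a"
          and G: "\<And>x y. G (x + y) = G x + G y" "\<And>x a. G (actN x a) = actM (G x) a"
          and FG: "\<And>x. q l (F x) = F x" "\<And>x. G (F x) = MN.M.smul r (p k x)"
        using MN.loc_iso_split[OF S fg(1-3) p q, of k] by metis
      \<comment> \<open>Cutting \<open>F\<close> and \<open>G\<close> down by \<open>p k\<close> and
        \<open>q l\<close> gives the source and target conditions of \<open>local_summand\<close>
        and leaves the composite equal to \<open>r\<close> times \<open>p k\<close>.\<close>
      define f' where "f' = Endo (\<lambda>z. (0 :: 'm, F (p k (fst z))))"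
      define g' where "g' = Endo (\<lambda>z. (p k (G (q l (snd z))), 0 :: 'n))"
      have f': "app f' z = (0, F (p k (fst z)))" for z
        unfolding f'_def by (subst app_Endo) (simp_all add: P(1) F(1))
      have g': "app g' z = (p k (G (q l (snd z))), 0)" for z
        unfolding g'_def by (subst app_Endo) (simp_all add: P(1) Q(1) G(1))
      have "lin f'" "lin g'" by (simp_all add: lin_def f' g' act_def P(2) Q(2) F(2) G(2))
      moreover have "QQ l * f' = f'" "f' * PP k = f'" "PP k * g' = g'" "g' * QQ l = g'" "g' * f' = sc r * PP k"
        by (rule endo_eqI; simp add: PP QQ f' g' FG P(2,4) Q(4) smul_pair MN.M.smul_def)+
      ultimately show ?thesis unfolding local_summand_def using r by blast
    qed
    show "\<exists>l. local_summand m (QQ k) (PP l)"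
    proof -
      obtain l F G r where r: "r \<in> UNIV - m" and F: "\<And>x y. F (x + y) = F x + F y" "\<And>x a. F (actN x a) = actM (F x) a"
          and G: "\<And>x y. G (x + y) = G x + G y" "\<And>x a. G (actM x a) = actN (G x) a"
          and FG: "\<And>x. p l (F x) = F x" "\<And>x. G (F x) = MN.N.smul r (q k x)"
        using NM.loc_iso_split[OF S fg(2,1,4) q p, of k] by metis
      define f' where "f' = Endo (\<lambda>z. (F (q k (snd z)), 0 :: 'n))"
      define g' where "g' = Endo (\<lambda>z. (0 :: 'm, q k (G (p l (fst z)))))"
      have f': "app f' z = (F (q k (snd z)), 0)" for z
        unfolding f'_def by (subst app_Endo) (simp_all add: Q(1) F(1))
      have g': "app g' z = (0, q k (G (p l (fst z))))" for z
        unfolding g'_def by (subst app_Endo) (simp_all add: P(1) Q(1) G(1))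
      have "lin f'" "lin g'" by (simp_all add: lin_def f' g' act_def P(2) Q(2) F(2) G(2))
      moreover have "PP l * f' = f'" "f' * QQ k = f'" "QQ k * g' = g'" "g' * PP l = g'" "g' * f' = sc r * QQ k"
        by (rule endo_eqI; simp add: PP QQ f' g' FG P(4) Q(2,4) smul_pair MN.N.smul_def)+
      ultimately show ?thesis unfolding local_summand_def using r by blast
    qed
  qed
  then obtain F where F: "bij_betw F {x. \<exists>k. app (PP k) x = x} {x. \<exists>k. app (QQ k) x = x}"
    "\<forall>x\<in>{x. \<exists>k. app (PP k) x = x}. \<forall>y\<in>{x. \<exists>k. app (PP k) x = x}. F (x + y) = F x + F y"
    "\<forall>x\<in>{x. \<exists>k. app (PP k) x = x}. \<forall>a. F (act x a) = act (F x) a"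
    using filtered_isomorphism[OF filtP filtQ] by blast
  \<comment> \<open>Every vector lies in some partial sum, so the unions of the two filtrations are
    the full copies of the two modules in the product.\<close>
  have X: "{x. \<exists>k. app (PP k) x = x} = range (\<lambda>x. (x, 0))"
    by (auto simp: PP prod_eq_iff image_iff, use P(5) in metis)
  have Y: "{x. \<exists>k. app (QQ k) x = x} = range (\<lambda>x. (0, x))"
    by (auto simp: QQ prod_eq_iff image_iff, use Q(5) in metis)
  define \<Phi> where "\<Phi> x = snd (F (x, 0))" for x
  have F_eq: "F (x, 0) = (0, \<Phi> x)" for x
    using bij_betw_apply[OF F(1), of "(x, 0)"] unfolding X Y \<Phi>_def by auto
  have "bij \<Phi>"
  proof (rule bijI)
    show "inj \<Phi>"
    proof (rule injI)
      fix x y assume "\<Phi> x = \<Phi> y"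
      then have "F (x, 0) = F (y, 0)" by (simp add: F_eq)
      then have "(x, 0 :: 'n) = (y, 0)" using F(1) unfolding X bij_betw_def by (auto dest: inj_onD)
      then show "x = y" by simp
    qed
    show "surj \<Phi>"
      unfolding surj_def
    proof
      fix y
      have "(0, y) \<in> F ` range (\<lambda>x. (x, 0))" using F(1) unfolding X Y bij_betw_def by auto
      then obtain x where "(0, y) = F (x, 0)" by blast
      then show "\<exists>x. y = \<Phi> x" by (auto simp: F_eq)
    qed
  qed
  moreover have "\<Phi> (x + y) = \<Phi> x + \<Phi> y" for x y
  proof -
    have "F ((x, 0) + (y, 0)) = F (x, 0) + F (y, 0)" using F(2) unfolding X by blast
    then show ?thesis by (simp add: F_eq)
  qed
  moreover have "\<Phi> (actM x a) = actN (\<Phi> x) a" for x a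
  proof -
    have "F (act (x, 0) a) = act (F (x, 0)) a" using F(3) unfolding X by blast
    then show ?thesis by (simp add: F_eq act_def)
  qed
  ultimately show ?thesis by blast
qed

section \<open>Transport of decompositions along an isomorphism\<close>

lemma internal_dsum_image:
  assumes f: "bij f" "\<And>x y. f (x + y) = f x + f y" "\<And>x a. f (actM x a) = actN (f x) a"
    and A: "internal_dsum actM A"
  shows "internal_dsum actN (\<lambda>i. f ` A i)"
proof -
  define g where "g = inv_into UNIV f"
  have gf: "g (f x) = x" and fg: "f (g y) = y" for x y
    unfolding g_def using f(1) by (simp_all add: bij_is_inj bij_is_surj surj_f_inv_f)
  have g_add: "g (x + y) = g x + g y" for x y using f(2)[of "g x" "g y"] gf[of "g x + g y"] by (simp add: fg)
  have f0: "f 0 = 0" and g0: "g 0 = 0" using f(2)[of 0 0] g_add[of 0 0] by simp_all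
  have f_sum: "f (\<Sum>i\<in>I. x i) = (\<Sum>i\<in>I. f (x i))" for I :: "nat set" and x
    by (induction I rule: infinite_finite_induct) (simp_all add: f0 f(2))
  have g_sum: "g (\<Sum>i\<in>I. x i) = (\<Sum>i\<in>I. g (x i))" for I :: "nat set" and x
    by (induction I rule: infinite_finite_induct) (simp_all add: g0 g_add)
  have f_eq0: "f x = 0 \<longleftrightarrow> x = 0" and g_eq0: "g y = 0 \<longleftrightarrow> y = 0" for x y using gf fg f0 g0 by metis+
  have sub: "rsubmodule actN (f ` A i)" for i
    unfolding rsubmodule_def
  proof (intro conjI ballI allI)
    have Ai: "rsubmodule actM (A i)" using A unfolding internal_dsum_def by blast
    show "0 \<in> f ` A i" using Ai f0 unfolding rsubmodule_def by (metis image_eqI)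
    show "x + y \<in> f ` A i" if "x \<in> f ` A i" "y \<in> f ` A i" for x y
      using Ai that unfolding rsubmodule_def by (auto simp: f(2)[symmetric])
    show "actN x a \<in> f ` A i" if "x \<in> f ` A i" for x a
      using Ai that unfolding rsubmodule_def by (auto simp: f(3)[symmetric])
  qed
  have "\<exists>!h. (\<forall>i. h i \<in> f ` A i) \<and> finite {i. h i \<noteq> 0} \<and> y = (\<Sum>i\<in>{i. h i \<noteq> 0}. h i)" for y
  proof -
    let ?D = "\<lambda>k. (\<forall>i. k i \<in> A i) \<and> finite {i. k i \<noteq> 0} \<and> g y = (\<Sum>i\<in>{i. k i \<noteq> 0}. k i)"
    have "\<exists>!k. ?D k" using A unfolding internal_dsum_def by blast
    then obtain k where k: "?D k" and uniq: "\<forall>k'. ?D k' \<longrightarrow> k' = k" by (rule ex1E)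
    show ?thesis
    proof (rule ex1I[of _ "\<lambda>i. f (k i)"])
      have "y = f (\<Sum>i\<in>{i. k i \<noteq> 0}. k i)" using k fg by metis
      then show "(\<forall>i. f (k i) \<in> f ` A i) \<and> finite {i. f (k i) \<noteq> 0} \<and> y = (\<Sum>i\<in>{i. f (k i) \<noteq> 0}. f (k i))"
        using k by (simp add: f_eq0 f_sum)
      fix h assume h: "(\<forall>i. h i \<in> f ` A i) \<and> finite {i. h i \<noteq> 0} \<and> y = (\<Sum>i\<in>{i. h i \<noteq> 0}. h i)"
      have "g (h i) \<in> A i" for i
      proof -
        obtain a where "a \<in> A i" "h i = f a" using h by blast
        then show ?thesis by (simp add: gf)
      qed
      moreover have "g y = (\<Sum>i\<in>{i. h i \<noteq> 0}. g (h i))" using h g_sum by metis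
      ultimately have "?D (\<lambda>i. g (h i))" using h by (simp add: g_eq0)
      with uniq have "(\<lambda>i. g (h i)) = k" by simp
      then show "h = (\<lambda>i. f (k i))" using fg by auto
    qed
  qed
  then show ?thesis unfolding internal_dsum_def using sub by blast
qed

lemma fin_gen_rsubmodule_image:
  assumes f: "bij f" "\<And>x y. f (x + y) = f x + f y" "\<And>x a. f (actM x a) = actN (f x) a"
    and X: "fin_gen_rsubmodule actM X"
  shows "fin_gen_rsubmodule actN (f ` X)"
proof -
  have f0: "f 0 = 0" using f(2)[of 0 0] by simp
  obtain G where G: "finite G" "G \<subseteq> X" "X = {\<Sum>g\<in>G. actM g (c g) | c. True}" and sub: "rsubmodule actM X"
    using X unfolding fin_gen_rsubmodule_def by blast
  have inj: "inj_on f G" using f(1) by (meson bij_is_inj inj_on_subset subset_UNIV)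
  have f_sum: "f (\<Sum>g\<in>G. actM g (c g)) = (\<Sum>g\<in>G. actN (f g) (c g))" for c
    using G(1) by (induction G rule: finite_induct) (simp_all add: f0 f(2,3))
  have "f ` X = {\<Sum>h\<in>f ` G. actN h (c h) | c. True}"
  proof (intro equalityI subsetI)
    fix y assume "y \<in> f ` X"
    then obtain c where "y = f (\<Sum>g\<in>G. actM g (c g))" using G(3) by blast
    also have "\<dots> = (\<Sum>h\<in>f ` G. actN h (c (inv_into G f h)))"
      unfolding f_sum using inj by (subst sum.reindex) simp_all
    finally show "y \<in> {\<Sum>h\<in>f ` G. actN h (c h) | c. True}" unfolding mem_Collect_eq by (intro exI conjI TrueI)
  next
    fix y assume "y \<in> {\<Sum>h\<in>f ` G. actN h (c h) | c. True}"
    then obtain c where "y = (\<Sum>h\<in>f ` G. actN h (c h))" by blast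
    also have "\<dots> = f (\<Sum>g\<in>G. actM g (c (f g)))"
      unfolding f_sum using inj by (subst sum.reindex) simp_all
    finally have "y = f (\<Sum>g\<in>G. actM g (c (f g)))" .
    moreover have "(\<Sum>g\<in>G. actM g (c (f g))) \<in> X"
      unfolding G(3) mem_Collect_eq by (intro exI[of _ "\<lambda>g. c (f g)"] conjI refl TrueI)
    ultimately show "y \<in> f ` X" by blast
  qed
  moreover have "rsubmodule actN (f ` X)" using sub f0 unfolding rsubmodule_def
    by (auto simp: f(2)[symmetric] f(3)[symmetric] image_iff)
  ultimately show ?thesis unfolding fin_gen_rsubmodule_def using G(1,2) by blast
qed

theorem mainTheorem14:
  fixes phi :: "'r::idom \<Rightarrow> 'l::ring_1"
    and actM :: "'m::ab_group_add \<Rightarrow> 'l \<Rightarrow> 'm"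
    and actN :: "'n::ab_group_add \<Rightarrow> 'l \<Rightarrow> 'n"
    and A :: "nat \<Rightarrow> 'm set" and B :: "nat \<Rightarrow> 'n set"
  assumes "finite_character TYPE('r)"
    and "R_algebra phi" and "fin_gen_over_R phi"
    and "tensor_Q_simple_artinian phi"
    and "rmodule actM" and "rmodule actN"
    and "internal_dsum actM A" and "internal_dsum actN B"
    and "\<And>i. A i \<noteq> {0} \<and> fin_gen_rsubmodule actM (A i) \<and> R_torsion_free phi actM (A i)"
    and "\<And>i. B i \<noteq> {0} \<and> fin_gen_rsubmodule actN (B i) \<and> R_torsion_free phi actN (B i)"
    and "same_genus phi actM actN"
  shows "(\<exists>Mi :: nat \<Rightarrow> 'm set. \<exists>Ni :: nat \<Rightarrow> 'n set.
            internal_dsum actM Mi \<and> internal_dsum actN Ni \<and>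
            (\<forall>i. fin_gen_rsubmodule actM (Mi i) \<and> fin_gen_rsubmodule actN (Ni i) \<and>
                 rmod_iso_on actM actN (Mi i) (Ni i)))
         \<and> rmod_iso_on actM actN UNIV UNIV"
proof -
  interpret M: algebra_module phi actM using assms(2,5) by unfold_locales
  interpret N: algebra_module phi actN using assms(2,6) by unfold_locales
  have "torsion_free_module phi actM" using M.dsum_torsion_free[OF assms(7)] assms(9) by blast
  moreover have "torsion_free_module phi actN" using N.dsum_torsion_free[OF assms(8)] assms(10) by blast
  ultimately have pair: "torsion_free_module_pair phi actM actN" by (rule torsion_free_module_pair.intro)
  have "partial_projections actM (M.partial_sum A)" "partial_projections actN (N.partial_sum B)"
    using M.partial_projections_partial_sum[OF assms(7)] N.partial_projections_partial_sum[OF assms(8)] assms(9,10) by blast+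
  from module_isomorphism[OF assms(1,3,4) pair this assms(11)]
  obtain F where F: "bij F" "\<And>x y. F (x + y) = F x + F y" "\<And>x a. F (actM x a) = actN (F x) a" by blast
  have iso: "rmod_iso_on actM actN X (F ` X)" for X
    unfolding rmod_iso_on_def using F bij_betw_subset[OF F(1), of X] by (intro exI[of _ F]) auto
  have "internal_dsum actN (\<lambda>i. F ` A i)"
    by (rule internal_dsum_image[where f = F and actM = actM and actN = actN, OF F(1) F(2) F(3) assms(7)])
  moreover have "fin_gen_rsubmodule actN (F ` A i)" for i
    by (rule fin_gen_rsubmodule_image[where f = F and actM = actM and actN = actN, OF F(1) F(2) F(3)]) (simp add: assms(9))
  moreover have "rmod_iso_on actM actN UNIV UNIV" using iso[of UNIV] F(1) by (simp add: bij_is_surj)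
  ultimately show ?thesis using assms(7,9) iso
    by (intro conjI exI[of _ A] exI[of _ "\<lambda>i. F ` A i"] allI) simp_all
qed

end
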